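(* Let $\epsilon\in\{-1,0,1\}$. Let $f:M^m:=N^{m-1}\times I\to\mathbb{Q}_\epsilon^n\times\mathbb{R}$ be the map constructed in the context from an isometric immersion $g:N^{m-1}\to\mathbb{Q}_\epsilon^n$, an orthonormal set of parallel normal vector fields $\xi_1,\dots,\xi_k$ along $g$, and a smooth regular curve $\alpha:I\to\mathbb{Q}_\epsilon^k\times\mathbb{R}$ whose last coordinate $\alpha_{k+1}$ has nowhere vanishing derivative. Then $f$ defines, at regular points, an immersion in class $\mathcal{A}$ (with respect to the induced metric). Conversely, any isometric immersion $f:M^m\to\mathbb{Q}_\epsilon^n\times\mathbb{R}$, $m\ge2$, in class $\mathcal{A}$ is locally given in this way.
   Context: $\mathbb{Q}_\epsilon^n$ denotes $\mathbb{S}^n$, $\mathbb{R}^n$ or $\mathbb{H}^n$ (curvature $\epsilon$) according as $\epsilon=1,0,-1$. Let $\partial/\partial t$ be a unit vector field tangent to the factor $\mathbb{R}$ of $\mathbb{Q}_\epsilon^n\times\mathbb{R}$ (for $\epsilon=0$, a constant unit vector field in $\mathbb{R}^{n+1}$). For an isometric immersion $f:M^m\to\mathbb{Q}_\epsilon^n\times\mathbb{R}$, a tangent vector field $T$ on $M$ and a normal vector field $\eta$ along $f$ are defined by $\frac{\partial}{\partial t}=f_*T+\eta$. Class $\mathcal{A}$ is the class of isometric immersions $f:M^m\to\mathbb{Q}_\epsilon^n\times\mathbb{R}$ such that $T$ is an eigenvector of all shape operators of $f$ (in particular, $T$ is nowhere vanishing). Construction for $\epsilon\in\{-1,1\}$.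 Let $\mathbb{E}^{n+2}$ be Euclidean space $\mathbb{R}^{n+2}$ if $\epsilon=1$ and Lorentzian space $\mathbb{L}^{n+2}$ if $\epsilon=-1$; let $j:\mathbb{Q}_\epsilon^n\to\mathbb{Q}_\epsilon^n\times\mathbb{R}$ and $\iota:\mathbb{Q}_\epsilon^n\times\mathbb{R}\to\mathbb{E}^{n+2}$ be the canonical inclusions and $\kappa=\iota\circ j$. Let $g:N^{m-1}\to\mathbb{Q}_\epsilon^n$ be an isometric immersion with an orthonormal set $\xi_1,\dots,\xi_k$ of normal vector fields parallel in the normal connection of $g$ (the set may be empty, $k=0$). Put $\tilde g=\kappa\circ g$, $\tilde\xi_0=\tilde g$, $\tilde\xi_i=\kappa_*\xi_i$ for $1\le i\le k$, and $\tilde\xi_{k+1}=\iota_*\partial/\partial t$. Let $\alpha=(\alpha_0,\dots,\alpha_k,\alpha_{k+1}):I\to\mathbb{Q}_\epsilon^k\times\mathbb{R}\subset\mathbb{E}^{k+2}$ be a smooth regular curve on an open interval $I$, so that $\epsilon\alpha_0^2+\alpha_1^2+\cdots+\alpha_k^2=\epsilon$, with $\alpha_{k+1}'$ nowhere zero. Then $f$ is defined by $$(\iota\circ f)(x,s)=\sum_{i=0}^{k+1}\alpha_i(s)\tilde\xi_i(x),\qquad (x,s)\in N^{m-1}\times I.$$ Construction for $\epsilon=0$. Analogously, $f(x,s)=g(x)+\sum_{i=1}^k\alpha_i(s)\xi_i(x)+\alpha_{k+1}(s)\frac{\partial}{\partial t}$, for $g:N^{m-1}\to\mathbb{R}^n$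 and a smooth regular curve $\alpha=(\alpha_1,\dots,\alpha_{k+1}):I\to\mathbb{R}^k\times\mathbb{R}$ with $\alpha_{k+1}'$ nowhere zero. A regular point is a point where the differential of $f$ is injective. "Locally given in this way" means every point of $M^m$ has an open neighborhood isometric to a product $N^{m-1}\times I$ with the metric induced by such a map, under which $f$ corresponds to that map (up to a translation along the $\mathbb{R}$ factor). *)

theory Defs
  imports "HOL-Analysis.Analysis"
begin

section \<open>Smooth functions on open sets\<close>

primrec Ck_on :: "nat \<Rightarrow> 'a::real_normed_vector set \<Rightarrow> ('a \<Rightarrow> 'b::real_normed_vector) \<Rightarrow> bool" where
  "Ck_on 0 S f \<longleftrightarrow> continuous_on S f"
| "Ck_on (Suc n) S f \<longleftrightarrow> (\<forall>x\<in>S. f differentiable (at x)) \<and>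
     (\<forall>v. Ck_on n S (\<lambda>x. frechet_derivative f (at x) v))"

text \<open>Only used for open \<open>S\<close> in finite-dimensional spaces, where testing the iterated derivatives
  direction by direction is the usual notion of smoothness.\<close>

definition smooth_on :: "'a::real_normed_vector set \<Rightarrow> ('a \<Rightarrow> 'b::real_normed_vector) \<Rightarrow> bool" where
  "smooth_on S f \<longleftrightarrow> (\<forall>n. Ck_on n S f)"

section \<open>Smooth and Riemannian manifolds\<close>

type_synonym ('a, 'e) chart = "'a set \<times> ('a \<Rightarrow> 'e)"

record ('a, 'e) manifold =
  points :: "'a topology"
  atlas :: "('a, 'e) chart set"

definition in_coords :: "('a, 'e) chart \<Rightarrow> ('a \<Rightarrow> 'b) \<Rightarrow> 'e \<Rightarrow> 'b" where
  "in_coords c f = f \<circ> inv_into (fst c) (snd c)"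

text \<open>The model space \<open>'e\<close> is only required to be a real normed space with a basis of \<open>m\<close> elements,
  rather than an instance of \<^class>\<open>euclidean_space\<close>, so that \<open>m = 0\<close> is allowed.
  The atlas need not be maximal.\<close>

definition smooth_manifold :: "nat \<Rightarrow> ('a, 'e::real_normed_vector) manifold \<Rightarrow> bool" where
  "smooth_manifold m M \<longleftrightarrow>
     (\<exists>B::'e set. finite B \<and> independent B \<and> span B = UNIV \<and> card B = m) \<and>
     Hausdorff_space (points M) \<and> second_countable (points M) \<and>
     \<Union>(fst ` atlas M) = topspace (points M) \<and>
     (\<forall>(U, \<phi>)\<in>atlas M. openin (points M) U \<and> open (\<phi> ` U) \<and>
        homeomorphic_map (subtopology (points M) U) (top_of_set (\<phi> ` U)) \<phi>) \<and>
     (\<forall>(U, \<phi>)\<in>atlas M. \<forall>(V, \<psi>)\<in>atlas M. smooth_on (\<phi> ` (U \<inter> V)) (in_coords (U, \<phi>) \<psi>))"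

definition smooth_map_on ::
  "('a, 'e::real_normed_vector) manifold \<Rightarrow> 'a set \<Rightarrow> ('a \<Rightarrow> 'v::real_normed_vector) \<Rightarrow> bool" where
  "smooth_map_on M R f \<longleftrightarrow> (\<forall>c\<in>atlas M. smooth_on (snd c ` (fst c \<inter> R)) (in_coords c f))"

text \<open>A tangent vector at \<open>p\<close> is represented, in a chart \<open>c\<close> around \<open>p\<close>, by its coordinate vector
  in the model space.\<close>

definition differential ::
  "('a, 'e::real_normed_vector) chart \<Rightarrow> ('a \<Rightarrow> 'v::real_normed_vector) \<Rightarrow> 'a \<Rightarrow> 'e \<Rightarrow> 'v" where
  "differential c f p v = frechet_derivative (in_coords c f) (at (snd c p)) v"

definition second_differential ::
  "('a, 'e::real_normed_vector) chart \<Rightarrow> ('a \<Rightarrow> 'v::real_normed_vector) \<Rightarrow> 'a \<Rightarrow> 'e \<Rightarrow> 'e \<Rightarrow> 'v" where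
  "second_differential c f p v w =
     frechet_derivative (\<lambda>x. frechet_derivative (in_coords c f) (at x) w) (at (snd c p)) v"

text \<open>\<open>G c p v w\<close> is the inner product of the tangent vectors at \<open>p\<close> with coordinates \<open>v\<close>, \<open>w\<close> in \<open>c\<close>.\<close>

type_synonym ('a, 'e) metric = "('a, 'e) chart \<Rightarrow> 'a \<Rightarrow> 'e \<Rightarrow> 'e \<Rightarrow> real"

definition riemannian_metric_on ::
  "('a, 'e::real_normed_vector) manifold \<Rightarrow> 'a set \<Rightarrow> ('a, 'e) metric \<Rightarrow> bool" where
  "riemannian_metric_on M R G \<longleftrightarrow>
     (\<forall>c\<in>atlas M. \<forall>v w. smooth_on (snd c ` (fst c \<inter> R)) (in_coords c (\<lambda>p. G c p v w))) \<and>
     (\<forall>c\<in>atlas M. \<forall>p\<in>fst c \<inter> R. bilinear (G c p) \<and>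
        (\<forall>v w. G c p v w = G c p w v) \<and> (\<forall>v. v \<noteq> 0 \<longrightarrow> G c p v v > 0)) \<and>
     (\<forall>c\<in>atlas M. \<forall>d\<in>atlas M. \<forall>p\<in>fst c \<inter> fst d \<inter> R. \<forall>v w.
        G c p v w = G d p (differential c (snd d) p v) (differential c (snd d) p w))"

text \<open>\<open>\<Phi>\<close> is an isometry of the Riemannian manifold \<open>(P, K)\<close> onto the open subset \<open>U\<close> of \<open>(M, G)\<close>.\<close>

definition isometry_onto_open ::
  "('b, 'd::real_normed_vector) manifold \<Rightarrow> ('b, 'd) metric \<Rightarrow>
   ('a, 'e::real_normed_vector) manifold \<Rightarrow> ('a, 'e) metric \<Rightarrow> 'a set \<Rightarrow> ('b \<Rightarrow> 'a) \<Rightarrow> bool" where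
  "isometry_onto_open P K M G U \<Phi> \<longleftrightarrow>
     openin (points M) U \<and>
     homeomorphic_map (points P) (subtopology (points M) U) \<Phi> \<and>
     (\<forall>c\<in>atlas P. \<forall>d\<in>atlas M. let W = {z \<in> fst c. \<Phi> z \<in> fst d} in
        smooth_on (snd c ` W) (in_coords c (snd d \<circ> \<Phi>)) \<and>
        smooth_on (snd d ` \<Phi> ` W) (in_coords d (snd c \<circ> inv_into (topspace (points P)) \<Phi>)) \<and>
        (\<forall>z\<in>W. \<forall>v w. K c z v w =
           G d (\<Phi> z) (differential c (snd d \<circ> \<Phi>) z v) (differential c (snd d \<circ> \<Phi>) z w)))"

definition product_interval ::
  "('a, 'e) manifold \<Rightarrow> real set \<Rightarrow> ('a \<times> real, 'e \<times> real) manifold" where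
  "product_interval N I =
     \<lparr>points = prod_topology (points N) (top_of_set I),
      atlas = (\<lambda>(U, \<phi>). (U \<times> I, map_prod \<phi> id)) ` atlas N\<rparr>"

definition open_interval :: "real set \<Rightarrow> bool" where
  "open_interval I \<longleftrightarrow> open I \<and> is_interval I \<and> I \<noteq> {}"

section \<open>The ambient spaces\<close>

text \<open>A submanifold of a real vector space: its points, a bilinear form that restricts to the
  Riemannian metric on tangent spaces, and the tangent spaces.\<close>

record 'v ambient =
  locus :: "'v set"
  form :: "'v \<Rightarrow> 'v \<Rightarrow> real"
  tangent :: "'v \<Rightarrow> 'v set"

text \<open>\<open>Q \<epsilon>\<close> is the sphere in the Euclidean space \<open>\<real> \<times> \<real>\<^sup>n\<close> for \<open>\<epsilon> = 1\<close>, the upper sheet of the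
  hyperboloid in the Lorentzian space \<open>\<real> \<times> \<real>\<^sup>n\<close> (time-like coordinate first) for \<open>\<epsilon> = -1\<close>, and
  \<open>\<real>\<^sup>n\<close>, identified with \<open>{0} \<times> \<real>\<^sup>n\<close>, for \<open>\<epsilon> = 0\<close>.\<close>

definition Q_form :: "real \<Rightarrow> real \<times> (real^'n) \<Rightarrow> real \<times> (real^'n) \<Rightarrow> real" where
  "Q_form \<epsilon> y z = (if \<epsilon> = -1 then - (fst y * fst z) else fst y * fst z) + snd y \<bullet> snd z"

definition Q :: "real \<Rightarrow> (real \<times> (real^'n)) ambient" where
  "Q \<epsilon> = \<lparr>locus = (if \<epsilon> = 1 then {y. Q_form \<epsilon> y y = 1}
                   else if \<epsilon> = -1 then {y. Q_form \<epsilon> y y = -1 \<and> fst y > 0}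
                   else {y. fst y = 0}),
           form = Q_form \<epsilon>,
           tangent = (\<lambda>y. if \<epsilon> = 0 then {z. fst z = 0} else {z. Q_form \<epsilon> y z = 0})\<rparr>"

definition QxR :: "real \<Rightarrow> ((real \<times> (real^'n)) \<times> real) ambient" where
  "QxR \<epsilon> = \<lparr>locus = locus (Q \<epsilon>) \<times> UNIV,
             form = (\<lambda>y z. form (Q \<epsilon>) (fst y) (fst z) + snd y * snd z),
             tangent = (\<lambda>y. tangent (Q \<epsilon>) (fst y) \<times> UNIV)\<rparr>"

definition kappa :: "real \<times> (real^'n) \<Rightarrow> (real \<times> (real^'n)) \<times> real" where
  "kappa y = (y, 0)"

definition ddt :: "(real \<times> (real^'n)) \<times> real" where
  "ddt = (0, 1)"

section \<open>Isometric immersions and class A\<close>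

text \<open>In the following, \<open>R\<close> is an open subset of \<open>M\<close>, regarded as an open submanifold.\<close>

definition isometric_immersion_on ::
  "('a, 'e::real_normed_vector) manifold \<Rightarrow> 'a set \<Rightarrow> ('a, 'e) metric \<Rightarrow>
   'v::real_normed_vector ambient \<Rightarrow> ('a \<Rightarrow> 'v) \<Rightarrow> bool" where
  "isometric_immersion_on M R G S f \<longleftrightarrow>
     openin (points M) R \<and> riemannian_metric_on M R G \<and>
     f ` R \<subseteq> locus S \<and> smooth_map_on M R f \<and>
     (\<forall>c\<in>atlas M. \<forall>p\<in>fst c \<inter> R. inj (differential c f p) \<and>
        (\<forall>v w. form S (differential c f p v) (differential c f p w) = G c p v w))"

definition induced_metric ::
  "'v::real_normed_vector ambient \<Rightarrow> ('a \<Rightarrow> 'v) \<Rightarrow> ('a, 'e::real_normed_vector) metric" where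
  "induced_metric S f c p v w = form S (differential c f p v) (differential c f p w)"

definition normal_space ::
  "'v::real_normed_vector ambient \<Rightarrow> ('a, 'e::real_normed_vector) chart \<Rightarrow> ('a \<Rightarrow> 'v) \<Rightarrow> 'a \<Rightarrow> 'v set" where
  "normal_space S c f p =
     {\<zeta> \<in> tangent S (f p). \<forall>v. form S (differential c f p v) \<zeta> = 0}"

text \<open>Orthogonal projection onto the normal space of \<open>f\<close> in \<open>S\<close>. The Levi-Civita connection of \<open>S\<close> is
  the tangential projection of the flat connection of the surrounding vector space, so projecting
  flat derivatives yields the second fundamental form and the normal connection of \<open>f\<close>.\<close>

definition normal_part ::
  "'v::real_normed_vector ambient \<Rightarrow> ('a, 'e::real_normed_vector) chart \<Rightarrow> ('a \<Rightarrow> 'v) \<Rightarrow> 'a \<Rightarrow> 'v \<Rightarrow> 'v" where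
  "normal_part S c f p z =
     (THE \<zeta>. \<zeta> \<in> normal_space S c f p \<and> (\<forall>\<zeta>'\<in>normal_space S c f p. form S (z - \<zeta>) \<zeta>' = 0))"

definition second_fundamental_form ::
  "'v::real_normed_vector ambient \<Rightarrow> ('a, 'e::real_normed_vector) chart \<Rightarrow> ('a \<Rightarrow> 'v) \<Rightarrow> 'a \<Rightarrow> 'e \<Rightarrow> 'e \<Rightarrow> 'v" where
  "second_fundamental_form S c f p v w = normal_part S c f p (second_differential c f p v w)"

definition shape_operator ::
  "'v::real_normed_vector ambient \<Rightarrow> ('a, 'e::real_normed_vector) metric \<Rightarrow> ('a, 'e) chart \<Rightarrow>
   ('a \<Rightarrow> 'v) \<Rightarrow> 'a \<Rightarrow> 'v \<Rightarrow> 'e \<Rightarrow> 'e" where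
  "shape_operator S G c f p \<zeta> v =
     (THE u. \<forall>w. G c p u w = form S (second_fundamental_form S c f p v w) \<zeta>)"

definition normal_derivative ::
  "'v::real_normed_vector ambient \<Rightarrow> ('a, 'e::real_normed_vector) chart \<Rightarrow> ('a \<Rightarrow> 'v) \<Rightarrow>
   ('a \<Rightarrow> 'v) \<Rightarrow> 'a \<Rightarrow> 'e \<Rightarrow> 'v" where
  "normal_derivative S c f \<xi> p v = normal_part S c f p (differential c \<xi> p v)"

definition T_field ::
  "real \<Rightarrow> ('a, 'e::real_normed_vector) chart \<Rightarrow> ('a \<Rightarrow> (real \<times> (real^'n)) \<times> real) \<Rightarrow> 'a \<Rightarrow> 'e" where
  "T_field \<epsilon> c f p =
     (THE v. \<exists>\<eta>\<in>normal_space (QxR \<epsilon>) c f p. ddt = differential c f p v + \<eta>)"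

definition eigenvector :: "('e::real_vector \<Rightarrow> 'e) \<Rightarrow> 'e \<Rightarrow> bool" where
  "eigenvector A v \<longleftrightarrow> v \<noteq> 0 \<and> (\<exists>\<mu>. A v = \<mu> *\<^sub>R v)"

definition class_A_on ::
  "real \<Rightarrow> ('a, 'e::real_normed_vector) manifold \<Rightarrow> 'a set \<Rightarrow> ('a, 'e) metric \<Rightarrow>
   ('a \<Rightarrow> (real \<times> (real^'n)) \<times> real) \<Rightarrow> bool" where
  "class_A_on \<epsilon> M R G f \<longleftrightarrow>
     isometric_immersion_on M R G (QxR \<epsilon>) f \<and>
     (\<forall>c\<in>atlas M. \<forall>p\<in>fst c \<inter> R. \<forall>\<zeta>\<in>normal_space (QxR \<epsilon>) c f p.
        eigenvector (shape_operator (QxR \<epsilon>) G c f p \<zeta>) (T_field \<epsilon> c f p))"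

definition regular_points ::
  "('a, 'e::real_normed_vector) manifold \<Rightarrow> ('a \<Rightarrow> 'v::real_normed_vector) \<Rightarrow> 'a set" where
  "regular_points M f =
     {p \<in> topspace (points M). \<forall>c\<in>atlas M. p \<in> fst c \<longrightarrow> inj (differential c f p)}"

section \<open>The construction\<close>

definition orthonormal_parallel_normal_fields ::
  "('a, 'e::real_normed_vector) manifold \<Rightarrow> 'v::real_normed_vector ambient \<Rightarrow> ('a \<Rightarrow> 'v) \<Rightarrow>
   nat \<Rightarrow> (nat \<Rightarrow> 'a \<Rightarrow> 'v) \<Rightarrow> bool" where
  "orthonormal_parallel_normal_fields N S g k \<xi> \<longleftrightarrow>
     (\<forall>i\<in>{1..k}. smooth_map_on N (topspace (points N)) (\<xi> i)) \<and>
     (\<forall>i\<in>{1..k}. \<forall>c\<in>atlas N. \<forall>p\<in>fst c. \<xi> i p \<in> normal_space S c g p \<and>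
        (\<forall>v. normal_derivative S c g (\<xi> i) p v = 0)) \<and>
     (\<forall>i\<in>{1..k}. \<forall>j\<in>{1..k}. \<forall>p\<in>topspace (points N).
        form S (\<xi> i p) (\<xi> j p) = (if i = j then 1 else 0))"

text \<open>The curve has components \<open>\<alpha>\<^sub>0, \<dots>, \<alpha>\<^bsub>k+1\<^esub>\<close> if \<open>\<epsilon> \<noteq> 0\<close>, and \<open>\<alpha>\<^sub>1, \<dots>, \<alpha>\<^bsub>k+1\<^esub>\<close> if \<open>\<epsilon> = 0\<close>.\<close>

definition admissible_curve :: "real \<Rightarrow> nat \<Rightarrow> real set \<Rightarrow> (nat \<Rightarrow> real \<Rightarrow> real) \<Rightarrow> bool" where
  "admissible_curve \<epsilon> k I \<alpha> \<longleftrightarrow>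
     (let J = (if \<epsilon> = 0 then {1..k+1} else {0..k+1}) in
       (\<forall>i\<in>J. smooth_on I (\<alpha> i)) \<and>
       (\<forall>s\<in>I. \<exists>i\<in>J. deriv (\<alpha> i) s \<noteq> 0)) \<and>
     (\<epsilon> \<noteq> 0 \<longrightarrow> (\<forall>s\<in>I. \<epsilon> * (\<alpha> 0 s)\<^sup>2 + (\<Sum>i=1..k. (\<alpha> i s)\<^sup>2) = \<epsilon>)) \<and>
     (\<epsilon> = -1 \<longrightarrow> (\<forall>s\<in>I. \<alpha> 0 s > 0)) \<and>
     (\<forall>s\<in>I. deriv (\<alpha> (k+1)) s \<noteq> 0)"

definition construction_data ::
  "real \<Rightarrow> nat \<Rightarrow> ('a, 'e::real_normed_vector) manifold \<Rightarrow> ('a, 'e) metric \<Rightarrow>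
   ('a \<Rightarrow> real \<times> (real^'n)) \<Rightarrow> nat \<Rightarrow> (nat \<Rightarrow> 'a \<Rightarrow> real \<times> (real^'n)) \<Rightarrow>
   real set \<Rightarrow> (nat \<Rightarrow> real \<Rightarrow> real) \<Rightarrow> bool" where
  "construction_data \<epsilon> d N H g k \<xi> I \<alpha> \<longleftrightarrow>
     smooth_manifold d N \<and>
     isometric_immersion_on N (topspace (points N)) H (Q \<epsilon>) g \<and>
     orthonormal_parallel_normal_fields N (Q \<epsilon>) g k \<xi> \<and>
     open_interval I \<and> admissible_curve \<epsilon> k I \<alpha>"

definition xi_tilde ::
  "('a \<Rightarrow> real \<times> (real^'n)) \<Rightarrow> nat \<Rightarrow> (nat \<Rightarrow> 'a \<Rightarrow> real \<times> (real^'n)) \<Rightarrow>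
   nat \<Rightarrow> 'a \<Rightarrow> (real \<times> (real^'n)) \<times> real" where
  "xi_tilde g k \<xi> i x = (if i = 0 then kappa (g x) else if i \<le> k then kappa (\<xi> i x) else ddt)"

definition constructed_map ::
  "real \<Rightarrow> ('a \<Rightarrow> real \<times> (real^'n)) \<Rightarrow> nat \<Rightarrow> (nat \<Rightarrow> 'a \<Rightarrow> real \<times> (real^'n)) \<Rightarrow>
   (nat \<Rightarrow> real \<Rightarrow> real) \<Rightarrow> 'a \<times> real \<Rightarrow> (real \<times> (real^'n)) \<times> real" where
  "constructed_map \<epsilon> g k \<xi> \<alpha> = (\<lambda>(x, s).
     if \<epsilon> = 0 then kappa (g x) + (\<Sum>i=1..k. \<alpha> i s *\<^sub>R kappa (\<xi> i x)) + \<alpha> (k+1) s *\<^sub>R ddt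
     else (\<Sum>i=0..k+1. \<alpha> i s *\<^sub>R xi_tilde g k \<xi> i x))"

text \<open>\<open>f\<close> is locally given by the construction; the manifolds \<open>N\<close> may be taken to be modelled on \<open>'p\<close>
  with underlying set in \<open>'p\<close>, since locally every manifold is diffeomorphic to an open subset of
  its model space.\<close>

definition locally_constructed ::
  "'p::euclidean_space itself \<Rightarrow> real \<Rightarrow> nat \<Rightarrow> ('a, 'e::real_normed_vector) manifold \<Rightarrow>
   ('a, 'e) metric \<Rightarrow> ('a \<Rightarrow> (real \<times> (real^'n)) \<times> real) \<Rightarrow> bool" where
  "locally_constructed _ \<epsilon> d M G f \<longleftrightarrow>
     (\<forall>p\<in>topspace (points M). \<exists>U. p \<in> U \<and>
       (\<exists>(N :: ('p, 'p) manifold) H g k \<xi> I \<alpha> \<Phi> t\<^sub>0.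
          construction_data \<epsilon> d N H g k \<xi> I \<alpha> \<and>
          isometry_onto_open
            (product_interval N I) (induced_metric (QxR \<epsilon>) (constructed_map \<epsilon> g k \<xi> \<alpha>)) M G U \<Phi> \<and>
          (\<forall>z\<in>topspace (points (product_interval N I)).
             f (\<Phi> z) = constructed_map \<epsilon> g k \<xi> \<alpha> z + t\<^sub>0 *\<^sub>R ddt)))"

end

theory Submission
  imports Defs
begin

text \<open>Direct part: since the \<open>\<xi>\<^sub>i\<close> are parallel, the derivatives of \<open>f\<close> along \<open>N\<close> lie in the image of
  \<open>dg\<close>, while \<open>\<partial>\<^sub>s f\<close> is orthogonal to it. Hence \<open>T\<close> is a multiple of \<open>\<partial>\<^sub>s\<close>, and at regular points the mixed
  derivatives \<open>\<partial>\<^sub>s \<partial>\<^sub>v f\<close> are tangent to \<open>f\<close>, so that \<open>II(T, v) = 0\<close> for \<open>v \<bottom> T\<close>.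

  Converse: let \<open>h\<close> be the height function and \<open>W = f\<^sub>* T\<^sup>\<bottom>\<close>, where \<open>T\<^sup>\<bottom> = ker dh\<close>. By the class A condition,
  differentiating a section of \<open>W\<close> along \<open>T\<close> in the surrounding vector space gives a section of \<open>W\<close>,
  so a suitably normalized frame of \<open>W\<close> is constant along \<open>T\<close>. This frame yields coordinates
  \<open>(x, s)\<close> with \<open>s = h\<close> and \<open>\<partial>\<^sub>s\<close> parallel to \<open>T\<close>, without integrating the flow of \<open>T\<close>. As \<open>W\<close> only depends
  on \<open>x\<close>, the horizontal part of \<open>f(\<cdot>, s)\<close> minus a constant multiple of \<open>g = f(\<cdot>, s\<^sub>0)\<close> is, for every \<open>s\<close>,
  a parallel normal field along \<open>g\<close>, and it is a combination of a maximal orthonormal family of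
  parallel normal fields with coefficients that only depend on \<open>s\<close>.\<close>

section \<open>Smooth functions\<close>

text \<open>Regularity enters the direct part through a dimension count: at a regular point the
  differential of f along N maps injectively into the image of dg, hence onto it, so whatever lies
  in the image of dg is tangent to f. In the converse a derivative along T of a section of W has no
  normal part, as II(T, w) = 0 for dh w = 0, and no part along the position vector, as W is
  orthogonal to T. So far this only says that W is carried along T; prescribing the products of the
  frame with one fixed basis of W at a base point removes the remaining freedom. The multiple of g
  comes from the position vector: for \<epsilon> \<noteq> 0 it is orthogonal to the tangent spaces
  of all slices at once, so its product with g is the same at all points of a slice; for \<epsilon>
  = 0 the multiple is 1, and orthogonality is obtained by integration in s instead. For \<epsilon> =
  -1 the surrounding form is indefinite, so projections and representing vectors are always found
  inside tangent spaces, where the form is positive.\<close>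

abbreviation fD :: "('a::real_normed_vector \<Rightarrow> 'b::real_normed_vector) \<Rightarrow> 'a \<Rightarrow> 'a \<Rightarrow> 'b" where
  "fD f x \<equiv> frechet_derivative f (at x)"

lemma fD_eqI: "(f has_derivative f') (at x) \<Longrightarrow> fD f x = f'"
  using frechet_derivative_at by metis

lemma has_derivative_fD: "f differentiable (at x) \<Longrightarrow> (f has_derivative fD f x) (at x)"
  by (simp add: frechet_derivative_works)

lemma bounded_linear_fD: "f differentiable (at x) \<Longrightarrow> bounded_linear (fD f x)"
  using has_derivative_fD has_derivative_bounded_linear by blast

lemma has_derivative_cong_open:
  assumes "open S" "x \<in> S" "\<And>y. y \<in> S \<Longrightarrow> f y = g y"
  shows "(f has_derivative f') (at x) \<longleftrightarrow> (g has_derivative f') (at x)"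
  using has_derivative_transform_within_open[of f f' x UNIV S g]
    has_derivative_transform_within_open[of g f' x UNIV S f] assms by auto

lemma fD_cong_open:
  assumes "open S" "x \<in> S" "\<And>y. y \<in> S \<Longrightarrow> f y = g y"
  shows "fD f x = fD g x"
  using has_derivative_cong_open[OF assms] by (simp add: frechet_derivative_def)

lemma differentiable_cong_open:
  assumes "open S" "x \<in> S" "\<And>y. y \<in> S \<Longrightarrow> f y = g y"
  shows "f differentiable (at x) \<longleftrightarrow> g differentiable (at x)"
  using has_derivative_cong_open[OF assms] by (simp add: differentiable_def)

section \<open>Calculus of iterated directional derivatives\<close>

lemma Ck_on_cong:
  assumes "open S" "\<And>y. y \<in> S \<Longrightarrow> f y = g y" "Ck_on n S f"
  shows "Ck_on n S g"
  using assms
proof (induction n arbitrary: f g)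
  case 0
  then show ?case by (auto cong: continuous_on_cong)
next
  case (Suc n)
  show ?case
    unfolding Ck_on.simps
  proof (intro conjI ballI allI)
    fix x assume "x \<in> S"
    then show "g differentiable (at x)"
      using Suc.prems differentiable_cong_open[of S x f g] by auto
  next
    fix v
    show "Ck_on n S (\<lambda>x. fD g x v)"
    proof (rule Suc.IH)
      show "fD f y v = fD g y v" if "y \<in> S" for y
        using fD_cong_open[of S y f g] Suc.prems that by auto
    qed (use Suc.prems in auto)
  qed
qed

lemma Ck_on_subset: "Ck_on n S f \<Longrightarrow> T \<subseteq> S \<Longrightarrow> Ck_on n T f"
  by (induction n arbitrary: f) (auto intro: continuous_on_subset)

lemma Ck_on_SucD: "Ck_on (Suc n) S f \<Longrightarrow> Ck_on n S f"
proof (induction n arbitrary: f)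
  case 0
  then show ?case
    by (auto intro!: continuous_at_imp_continuous_on differentiable_imp_continuous_within)
next
  case (Suc n)
  then have "Ck_on n S (\<lambda>x. fD f x v)" for v
    by (intro Suc.IH) (use Suc.prems in \<open>auto simp only: Ck_on.simps\<close>)
  with Suc.prems show ?case by simp
qed

lemma Ck_on_continuous: "Ck_on n S f \<Longrightarrow> continuous_on S f"
  by (induction n arbitrary: f)
    (auto intro!: continuous_at_imp_continuous_on differentiable_imp_continuous_within)

lemma Ck_on_const: "Ck_on n S (\<lambda>x. c)"
  by (induction n arbitrary: c) (auto intro: continuous_on_const)

lemma Ck_on_linear: "bounded_linear L \<Longrightarrow> Ck_on n S L"
proof (cases n)
  case 0
  assume "bounded_linear L"
  with 0 show ?thesis by (simp add: linear_continuous_on)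
next
  case (Suc k)
  assume L: "bounded_linear L"
  have "(L has_derivative L) (at x)" for x
    using L by (rule bounded_linear_imp_has_derivative)
  then have "fD L x = L" "L differentiable (at x)" for x
    by (auto simp: fD_eqI differentiable_def)
  then show ?thesis using Suc by (simp add: Ck_on_const)
qed

lemma Ck_on_linear_compose:
  assumes "open S" "bounded_linear L" "Ck_on n S f"
  shows "Ck_on n S (\<lambda>x. L (f x))"
  using assms(3)
proof (induction n arbitrary: f)
  case 0
  then show ?case using bounded_linear.continuous_on[OF assms(2)] by auto
next
  case (Suc n)
  have *: "((\<lambda>x. L (f x)) has_derivative (\<lambda>v. L (fD f x v))) (at x)" if "x \<in> S" for x
    using bounded_linear.has_derivative[OF assms(2) has_derivative_fD[of f x]] Suc.prems that by auto
  then have "fD (\<lambda>x. L (f x)) x = (\<lambda>v. L (fD f x v))" "(\<lambda>x. L (f x)) differentiable (at x)"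
    if "x \<in> S" for x
    using that by (auto intro: fD_eqI simp: differentiable_def)
  moreover have "Ck_on n S (\<lambda>x. L (fD f x v))" for v
    using Suc by simp
  ultimately show ?case
    by (simp add: Ck_on_cong[OF assms(1)])
qed

text \<open>The direction \<open>L v\<close> in the derivative does not depend on the point, so the
  induction stays within constant directions. It serves for compositions with projections from model
  spaces that are merely normed, where the general chain rule does not apply.\<close>

lemma Ck_on_compose_linear:
  assumes "open S" "open T" "bounded_linear L" "L ` S \<subseteq> T" "Ck_on n T f"
  shows "Ck_on n S (\<lambda>x. f (L x))"
  using assms(5)
proof (induction n arbitrary: f)
  case 0
  have "continuous_on S L" using assms(3) by (rule linear_continuous_on)
  with 0 show ?case using continuous_on_compose2 assms(4) by auto
next
  case (Suc n)
  have *: "((\<lambda>x. f (L x)) has_derivative (\<lambda>v. fD f (L x) (L v))) (at x)" if "x \<in> S" for x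
  proof -
    have "(L has_derivative L) (at x)"
      using assms(3) by (rule bounded_linear_imp_has_derivative)
    moreover have "(f has_derivative fD f (L x)) (at (L x))"
      using Suc.prems that assms(4) by (auto intro!: has_derivative_fD)
    ultimately show ?thesis by (rule has_derivative_compose)
  qed
  then have "fD (\<lambda>x. f (L x)) x = (\<lambda>v. fD f (L x) (L v))" "(\<lambda>x. f (L x)) differentiable (at x)"
    if "x \<in> S" for x
    using that by (auto intro: fD_eqI simp: differentiable_def)
  moreover have "Ck_on n S (\<lambda>x. fD f (L x) (L v))" for v
    using Suc.IH[of "\<lambda>x. fD f x (L v)"] Suc.prems by simp
  ultimately show ?case
    by (simp add: Ck_on_cong[OF assms(1)])
qed

lemma Ck_on_Pair:
  assumes "open S" "Ck_on n S f" "Ck_on n S g"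
  shows "Ck_on n S (\<lambda>x. (f x, g x))"
  using assms(2,3)
proof (induction n arbitrary: f g)
  case 0
  then show ?case by (auto intro: continuous_on_Pair)
next
  case (Suc n)
  have *: "((\<lambda>x. (f x, g x)) has_derivative (\<lambda>v. (fD f x v, fD g x v))) (at x)" if "x \<in> S" for x
    using Suc.prems that by (auto intro!: has_derivative_Pair has_derivative_fD)
  then have "fD (\<lambda>x. (f x, g x)) x = (\<lambda>v. (fD f x v, fD g x v))"
    "(\<lambda>x. (f x, g x)) differentiable (at x)" if "x \<in> S" for x
    using that by (auto intro: fD_eqI simp: differentiable_def)
  moreover have "Ck_on n S (\<lambda>x. (fD f x v, fD g x v))" for v
    using Suc by simp
  ultimately show ?case
    by (simp add: Ck_on_cong[OF assms(1)])
qed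

lemma Ck_on_add:
  assumes "open S" "Ck_on n S f" "Ck_on n S g"
  shows "Ck_on n S (\<lambda>x. f x + g x)"
proof -
  have "bounded_linear (\<lambda>p::'b \<times> 'b. fst p + snd p)"
    by (intro bounded_linear_add bounded_linear_fst bounded_linear_snd)
  from Ck_on_linear_compose[OF assms(1) this Ck_on_Pair[OF assms]] show ?thesis by simp
qed

lemma Ck_on_minus:
  assumes "open S" "Ck_on n S f"
  shows "Ck_on n S (\<lambda>x. - f x)"
  using Ck_on_linear_compose[OF assms(1) _ assms(2), of uminus]
  by (simp add: bounded_linear_minus[OF bounded_linear_ident])

lemma Ck_on_diff:
  assumes "open S" "Ck_on n S f" "Ck_on n S g"
  shows "Ck_on n S (\<lambda>x. f x - g x)"
  using Ck_on_add[OF assms(1,2) Ck_on_minus[OF assms(1,3)]] by simp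

lemma Ck_on_sum:
  assumes "open S" "\<And>i. i \<in> A \<Longrightarrow> Ck_on n S (f i)"
  shows "Ck_on n S (\<lambda>x. \<Sum>i\<in>A. f i x)"
  using assms(2)
  by (induction A rule: infinite_finite_induct) (auto intro: Ck_on_const Ck_on_add[OF assms(1)])

lemma Ck_on_bilinear:
  assumes "open S" "bounded_bilinear b" "Ck_on n S f" "Ck_on n S g"
  shows "Ck_on n S (\<lambda>x. b (f x) (g x))"
  using assms(3,4)
proof (induction n arbitrary: f g)
  case 0
  then show ?case using bounded_bilinear.continuous_on[OF assms(2)] by auto
next
  case (Suc n)
  have *: "((\<lambda>x. b (f x) (g x)) has_derivative (\<lambda>v. b (f x) (fD g x v) + b (fD f x v) (g x))) (at x)"
    if "x \<in> S" for x
    using Suc.prems that by (auto intro!: bounded_bilinear.FDERIV[OF assms(2)] has_derivative_fD)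
  then have "fD (\<lambda>x. b (f x) (g x)) x = (\<lambda>v. b (f x) (fD g x v) + b (fD f x v) (g x))"
    "(\<lambda>x. b (f x) (g x)) differentiable (at x)" if "x \<in> S" for x
    using that by (auto intro: fD_eqI simp: differentiable_def)
  moreover have "Ck_on n S (\<lambda>x. b (f x) (fD g x v) + b (fD f x v) (g x))" for v
    by (intro Ck_on_add[OF assms(1)] Suc.IH)
      (use Suc.prems Ck_on_SucD[OF Suc.prems(1)] Ck_on_SucD[OF Suc.prems(2)] in auto)
  ultimately show ?case
    by (simp add: Ck_on_cong[OF assms(1)])
qed

lemmas Ck_on_scaleR = Ck_on_bilinear[OF _ bounded_bilinear_scaleR]

text \<open>The chain rule needs a basis of the intermediate space, because \<^const>\<open>Ck_on\<close> only
  differentiates in constant directions.\<close>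

lemma linear_basis_expansion:
  fixes L :: "'a::euclidean_space \<Rightarrow> 'b::real_vector"
  assumes "linear L"
  shows "L z = (\<Sum>i\<in>Basis. (z \<bullet> i) *\<^sub>R L i)"
proof -
  have "L z = L (\<Sum>i\<in>Basis. (z \<bullet> i) *\<^sub>R i)" by (simp add: euclidean_representation)
  also have "\<dots> = (\<Sum>i\<in>Basis. (z \<bullet> i) *\<^sub>R L i)"
    by (simp add: linear_sum[OF assms] linear_scale[OF assms])
  finally show ?thesis .
qed

lemma Ck_on_inner_const:
  assumes "open S" "Ck_on n S f"
  shows "Ck_on n S (\<lambda>x. f x \<bullet> c)"
  using Ck_on_linear_compose[OF assms(1) bounded_linear_inner_left assms(2)] .

text \<open>Here the direction varies with the point; expanding it in \<open>Basis\<close> leaves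
  products of scalar coefficients with values of the family in fixed directions.\<close>

lemma Ck_on_linear_family_apply:
  fixes L :: "'x::real_normed_vector \<Rightarrow> 'a::euclidean_space \<Rightarrow> 'b::real_normed_vector"
  assumes "open S" "\<And>y. y \<in> S \<Longrightarrow> linear (L y)" "\<And>v. v \<in> Basis \<Longrightarrow> Ck_on n S (\<lambda>y. L y v)" "Ck_on n S z"
  shows "Ck_on n S (\<lambda>y. L y (z y))"
proof (rule Ck_on_cong[OF assms(1)])
  show "Ck_on n S (\<lambda>y. \<Sum>i\<in>Basis. (z y \<bullet> i) *\<^sub>R L y i)"
    by (intro Ck_on_sum Ck_on_scaleR Ck_on_inner_const assms)
  show "(\<Sum>i\<in>Basis. (z y \<bullet> i) *\<^sub>R L y i) = L y (z y)" if "y \<in> S" for y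
    using linear_basis_expansion[OF assms(2)[OF that]] by metis
qed

lemma Ck_on_compose:
  fixes g :: "'x::real_normed_vector \<Rightarrow> 'a::euclidean_space" and f :: "'a \<Rightarrow> 'b::real_normed_vector"
  assumes "open S" "open T" "Ck_on n S g" "g ` S \<subseteq> T" "Ck_on n T f"
  shows "Ck_on n S (\<lambda>x. f (g x))"
  using assms(3,5)
proof (induction n arbitrary: f)
  case 0
  then show ?case using continuous_on_compose2 assms(4) by auto
next
  case (Suc n)
  have *: "((\<lambda>x. f (g x)) has_derivative (\<lambda>v. fD f (g x) (fD g x v))) (at x)" if "x \<in> S" for x
    by (rule has_derivative_compose[of g]) (use Suc.prems that assms(4) in \<open>auto intro!: has_derivative_fD\<close>)
  then have "fD (\<lambda>x. f (g x)) x = (\<lambda>v. fD f (g x) (fD g x v))"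
    "(\<lambda>x. f (g x)) differentiable (at x)" if "x \<in> S" for x
    using that by (auto intro: fD_eqI simp: differentiable_def)
  moreover have "Ck_on n S (\<lambda>x. fD f (g x) (fD g x v))" for v
  proof (rule Ck_on_linear_family_apply[OF assms(1)])
    show "linear (fD f (g y))" if "y \<in> S" for y
      using that Suc.prems assms(4) by (auto intro!: bounded_linear.linear bounded_linear_fD)
    show "Ck_on n S (\<lambda>y. fD f (g y) v)" for v
      using Suc.IH[of "\<lambda>y. fD f y v"] Suc.prems Ck_on_SucD[OF Suc.prems(1)] by auto
    show "Ck_on n S (\<lambda>y. fD g y v)" using Suc.prems by auto
  qed
  ultimately show ?case
    by (simp add: Ck_on_cong[OF assms(1)])
qed

text \<open>The minimum \<open>b\<close> of \<open>norm (L x v)\<close> over the compact unit sphere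
  is positive by injectivity. Where the images of the basis vectors have moved by less than
  \<open>b / 2\<close> in total, half of this bound survives, so pointwise continuity of the family
  suffices.\<close>

lemma linear_inj_family_bounded_below:
  fixes L :: "'x::real_normed_vector \<Rightarrow> 'a::euclidean_space \<Rightarrow> 'b::real_normed_vector"
  assumes "open S" "x \<in> S" "\<And>y. y \<in> S \<Longrightarrow> linear (L y)" "\<And>v. continuous_on S (\<lambda>y. L y v)" "inj (L x)"
  shows "\<exists>U c. open U \<and> x \<in> U \<and> U \<subseteq> S \<and> c > 0 \<and> (\<forall>y\<in>U. \<forall>v. c * norm v \<le> norm (L y v))"
proof -
  have "bounded_linear (L x)" using assms(2,3) linear_conv_bounded_linear by blast
  obtain b where b: "b > 0" "\<And>v. b * norm v \<le> norm (L x v)"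
  proof -
    have cont: "continuous_on (sphere 0 1) (\<lambda>v. norm (L x v))"
      using \<open>bounded_linear (L x)\<close> by (intro continuous_on_norm linear_continuous_on)
    obtain i::'a where "i \<in> Basis" using nonempty_Basis by blast
    then have "i \<in> sphere 0 1" by simp
    then obtain u where u: "u \<in> sphere 0 1" "\<And>v. v \<in> sphere 0 1 \<Longrightarrow> norm (L x u) \<le> norm (L x v)"
      using continuous_attains_inf[OF _ _ cont] by (metis compact_sphere empty_iff)
    have lx: "linear (L x)" using assms by auto
    have "u \<noteq> 0" using u by auto
    then have "L x u \<noteq> 0" using assms(5) linear_0[OF lx] by (metis injD)
    moreover have "norm (L x u) * norm v \<le> norm (L x v)" for v
    proof (cases "v = 0")
      case False
      then have "norm (L x u) \<le> norm (L x (v /\<^sub>R norm v))" by (intro u) simp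
      also have "\<dots> = norm (L x v) / norm v"
        by (simp add: linear_scale[OF lx] divide_inverse mult.commute)
      finally show ?thesis using False by (simp add: field_simps)
    qed (simp add: linear_0[OF lx])
    ultimately show ?thesis using that[of "norm (L x u)"] by simp
  qed
  define \<delta> where "\<delta> y = (\<Sum>i\<in>Basis. norm (L y i - L x i))" for y
  have "continuous_on S \<delta>" unfolding \<delta>_def
    by (intro continuous_intros assms(4))
  then have "open (S \<inter> \<delta> -` {..<b / 2})"
    by (rule continuous_open_preimage[OF _ assms(1) open_lessThan])
  moreover have "S \<inter> \<delta> -` {..<b / 2} = {y\<in>S. \<delta> y < b / 2}" by auto
  ultimately have "open {y\<in>S. \<delta> y < b / 2}" by simp
  moreover have "x \<in> {y\<in>S. \<delta> y < b / 2}" using assms(2) b by (simp add: \<delta>_def)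
  moreover have "b / 2 * norm v \<le> norm (L y v)" if y: "y \<in> {y\<in>S. \<delta> y < b / 2}" for y v
  proof -
    have lin: "linear (\<lambda>v. L y v - L x v)"
      using y assms(2,3) by (auto intro: linear_compose_sub)
    have "norm (L y v - L x v) = norm (\<Sum>i\<in>Basis. (v \<bullet> i) *\<^sub>R (L y i - L x i))"
      using linear_basis_expansion[OF lin, of v] by simp
    also have "\<dots> \<le> (\<Sum>i\<in>Basis. \<bar>v \<bullet> i\<bar> * norm (L y i - L x i))"
      by (rule order_trans[OF norm_sum]) simp
    also have "\<dots> \<le> (\<Sum>i\<in>Basis. norm v * norm (L y i - L x i))"
      by (intro sum_mono mult_right_mono) (auto simp: Basis_le_norm)
    also have "\<dots> = norm v * \<delta> y" by (simp add: \<delta>_def sum_distrib_left)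
    also have "\<dots> \<le> norm v * (b / 2)" using y by (intro mult_left_mono) auto
    finally have "norm (L y v - L x v) \<le> norm v * (b / 2)" .
    moreover have "norm (L x v) - norm (L y v) \<le> norm (L y v - L x v)"
      by (metis norm_minus_commute norm_triangle_ineq2)
    ultimately show ?thesis using b(2)[of v] by (simp add: algebra_simps)
  qed
  ultimately show ?thesis using b(1)
    by (intro exI[of _ "{y\<in>S. \<delta> y < b / 2}"] exI[of _ "b/2"]) auto
qed

text \<open>Since \<open>u\<close> vanishes at \<open>x\<close>, it is of first order there, and
  \<open>u y *\<^sub>R (k y - k x)\<close> is negligible as soon as \<open>k\<close> is continuous.
  In the application to inverse families \<open>k\<close> is the very map whose differentiability is
  to be shown.\<close>

lemma has_derivative_scaleR_zero:
  fixes u :: "'x::real_normed_vector \<Rightarrow> real" and k :: "'x \<Rightarrow> 'b::real_normed_vector"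
  assumes "(u has_derivative u') (at x)" "u x = 0" "isCont k x"
  shows "((\<lambda>y. u y *\<^sub>R k y) has_derivative (\<lambda>v. u' v *\<^sub>R k x)) (at x)"
proof -
  have bl: "bounded_linear u'" using assms(1) has_derivative_bounded_linear by blast
  have 1: "((\<lambda>y. u y *\<^sub>R k x) has_derivative (\<lambda>v. u' v *\<^sub>R k x)) (at x)"
    using assms(1) by (rule has_derivative_scaleR_left)
  obtain C where C: "C > 0" "\<And>v. norm (u' v) \<le> norm v * C" using bounded_linear.pos_bounded[OF bl] by auto
  have 2: "((\<lambda>y. u y *\<^sub>R (k y - k x)) has_derivative (\<lambda>v. 0)) (at x)"
    unfolding has_derivative_at_within
  proof (intro conjI)
    show "bounded_linear (\<lambda>v. 0::'b)" by (rule bounded_linear_zero)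
    have q: "((\<lambda>y. (u y - u x - u' (y - x)) /\<^sub>R norm (y - x)) \<longlongrightarrow> 0) (at x)"
      using assms(1) by (simp add: has_derivative_at_within)
    have q': "((\<lambda>y. norm ((u y - u x - u' (y - x)) /\<^sub>R norm (y - x)) + C) \<longlongrightarrow> norm (0::real) + C) (at x)"
      by (intro tendsto_intros q)
    have kk: "((\<lambda>y. norm (k y - k x)) \<longlongrightarrow> 0) (at x)"
      using assms(3) by (metis isCont_def LIM_zero tendsto_norm_zero)
    have lim: "((\<lambda>y. (norm ((u y - u x - u' (y - x)) /\<^sub>R norm (y - x)) + C) * norm (k y - k x)) \<longlongrightarrow> 0) (at x)"
      using tendsto_mult[OF q' kk] by simp
    show "((\<lambda>y. ((u y *\<^sub>R (k y - k x) - u x *\<^sub>R (k x - k x)) - 0) /\<^sub>R norm (y - x)) \<longlongrightarrow> 0) (at x)"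
    proof (rule Lim_null_comparison[OF _ lim], rule eventuallyI)
      fix y
      have "norm (u y) \<le> norm (u y - u x - u' (y - x)) + norm (y - x) * C"
        using norm_triangle_ineq[of "u y - u x - u' (y-x)" "u' (y-x)"] C(2)[of "y - x"] assms(2)
        by simp
      then have "norm (u y) / norm (y - x) \<le> norm ((u y - u x - u' (y - x)) /\<^sub>R norm (y - x)) + C"
        by (cases "y = x") (use C in \<open>auto simp: field_simps\<close>)
      from mult_right_mono[OF this norm_ge_zero[of "k y - k x"]]
      have "norm (u y) / norm (y - x) * norm (k y - k x)
        \<le> (norm ((u y - u x - u' (y - x)) /\<^sub>R norm (y - x)) + C) * norm (k y - k x)" .
      moreover have "norm (((u y *\<^sub>R (k y - k x) - u x *\<^sub>R (k x - k x)) - 0) /\<^sub>R norm (y - x))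
        = norm (u y) / norm (y - x) * norm (k y - k x)"
        by (simp add: divide_inverse abs_mult mult_ac)
      ultimately show "norm (((u y *\<^sub>R (k y - k x) - u x *\<^sub>R (k x - k x)) - 0) /\<^sub>R norm (y - x))
        \<le> (norm ((u y - u x - u' (y - x)) /\<^sub>R norm (y - x)) + C) * norm (k y - k x)"
        by argo
    qed
  qed
  have "((\<lambda>y. u y *\<^sub>R k x + u y *\<^sub>R (k y - k x)) has_derivative (\<lambda>v. u' v *\<^sub>R k x + 0)) (at x)"
    by (rule has_derivative_add[OF 1 2])
  then show ?thesis by (simp add: scaleR_right_diff_distrib)
qed

text \<open>Continuity comes first: \<open>L y (K y w - K x w) = L x (K x w) - L y (K x w)\<close>,
  and \<open>L y\<close> is bounded below near \<open>x\<close>. The formula DK = - K (DL) K then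
  expresses derivatives of \<open>K\<close> through \<open>K\<close> and derivatives of
  \<open>L\<close>, which feeds the induction.\<close>

lemma Ck_on_inverse_family:
  fixes L :: "'x::real_normed_vector \<Rightarrow> 'a::euclidean_space \<Rightarrow> 'b::euclidean_space"
  assumes S: "open S" and L: "\<And>y. y \<in> S \<Longrightarrow> linear (L y)" "\<And>v. Ck_on n S (\<lambda>y. L y v)"
    and K: "\<And>y. y \<in> S \<Longrightarrow> linear (K y)" "\<And>y w. y \<in> S \<Longrightarrow> L y (K y w) = w"
      "\<And>y v. y \<in> S \<Longrightarrow> K y (L y v) = v"
  shows "Ck_on n S (\<lambda>y. K y w)"
proof -
  have cont: "isCont (\<lambda>y. K y w) x" if x: "x \<in> S" for x w
  proof -
    have inj: "inj (L x)" using K(3)[OF x] by (metis injI)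
    obtain U c where U: "open U" "x \<in> U" "U \<subseteq> S" "c > 0" "\<And>y v. y \<in> U \<Longrightarrow> c * norm v \<le> norm (L y v)"
      using linear_inj_family_bounded_below[OF S x L(1) Ck_on_continuous[OF L(2)] inj] by blast
    have "isCont (\<lambda>y. L y (K x w)) x"
      using Ck_on_continuous[OF L(2)] S x by (simp add: continuous_on_eq_continuous_at)
    then have "((\<lambda>y. norm (L y (K x w) - L x (K x w)) / c) \<longlongrightarrow> 0) (at x)"
      unfolding isCont_def by (intro tendsto_divide_zero tendsto_norm_zero) (rule LIM_zero)
    then have "((\<lambda>y. K y w - K x w) \<longlongrightarrow> 0) (at x)"
    proof (rule Lim_null_comparison[rotated])
      show "\<forall>\<^sub>F y in at x. norm (K y w - K x w) \<le> norm (L y (K x w) - L x (K x w)) / c"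
        using eventually_at_in_open'[OF U(1,2)]
      proof eventually_elim
        case (elim y)
        then have y: "y \<in> S" using U by auto
        have "c * norm (K y w - K x w) \<le> norm (L y (K y w - K x w))" using U(5)[OF elim] .
        also have "L y (K y w - K x w) = L x (K x w) - L y (K x w)"
          using K(2)[OF y] K(2)[OF x] by (simp add: linear_diff[OF L(1)[OF y]])
        finally show ?case using U(4) by (simp add: field_simps norm_minus_commute)
      qed
    qed
    then show ?thesis unfolding isCont_def by (rule LIM_zero_cancel)
  qed
  show ?thesis using L(2)
  proof (induction n arbitrary: w)
    case 0
    then show ?case using cont by (simp add: continuous_at_imp_continuous_on)
  next
    case (Suc n)
    have der: "((\<lambda>y. K y w) has_derivative (\<lambda>v. - K x (fD (\<lambda>y. L y (K x w)) x v))) (at x)"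
      if "x \<in> S" for x
    proof -
      \<comment> \<open>With this \<open>z\<close> one has
        \<open>K y w = z - K y (L y z - w)\<close>, and the argument \<open>L y z - w\<close>
        vanishes at \<open>y = x\<close>. Hence continuity of \<open>K\<close> is enough to
        differentiate the right-hand side at \<open>x\<close>.\<close>
      define z where "z = K x w"
      have d: "((\<lambda>y. L y z) has_derivative fD (\<lambda>y. L y z) x) (at x)"
        using Suc.prems[of z] that by (intro has_derivative_fD) simp
      have "((\<lambda>y. z - (\<Sum>i\<in>Basis. ((L y z - w) \<bullet> i) *\<^sub>R K y i)) has_derivative
          (\<lambda>v. 0 - (\<Sum>i\<in>Basis. (fD (\<lambda>y. L y z) x v \<bullet> i) *\<^sub>R K x i))) (at x)"
      proof (intro has_derivative_diff has_derivative_const has_derivative_sum has_derivative_scaleR_zero)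
        fix i :: 'b
        have "((\<lambda>y. L y z - w) has_derivative (\<lambda>v. fD (\<lambda>y. L y z) x v - 0)) (at x)"
          by (intro has_derivative_diff d has_derivative_const)
        then show "((\<lambda>y. (L y z - w) \<bullet> i) has_derivative (\<lambda>v. fD (\<lambda>y. L y z) x v \<bullet> i)) (at x)"
          using has_derivative_inner_left by fastforce
        show "(L x z - w) \<bullet> i = 0" using K(2)[OF that] by (simp add: z_def)
        show "isCont (\<lambda>y. K y i) x" by (rule cont[OF that])
      qed
      moreover have "(\<Sum>i\<in>Basis. (u \<bullet> i) *\<^sub>R K y i) = K y u" if "y \<in> S" for y u
        using linear_basis_expansion[OF K(1)[OF that]] by metis
      ultimately have d2: "((\<lambda>y. z - (\<Sum>i\<in>Basis. ((L y z - w) \<bullet> i) *\<^sub>R K y i)) has_derivative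
          (\<lambda>v. - K x (fD (\<lambda>y. L y z) x v))) (at x)" using that by simp
      show ?thesis
        unfolding z_def[symmetric]
      proof (rule has_derivative_transform_within_open[OF d2 S that])
        fix y assume y: "y \<in> S"
        have "(\<Sum>i\<in>Basis. ((L y z - w) \<bullet> i) *\<^sub>R K y i) = K y (L y z - w)"
          using linear_basis_expansion[OF K(1)[OF y]] by metis
        also have "\<dots> = z - K y w" using K(3)[OF y] by (simp add: linear_diff[OF K(1)[OF y]])
        finally show "z - (\<Sum>i\<in>Basis. ((L y z - w) \<bullet> i) *\<^sub>R K y i) = K y w" by simp
      qed
    qed
    have 1: "fD (\<lambda>y. K y w) x v = - K x (fD (\<lambda>y. L y (K x w)) x v)"
      "(\<lambda>y. K y w) differentiable (at x)" if "x \<in> S" for x v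
      using fD_eqI[OF der[OF that]] der[OF that] by (auto simp: differentiable_def)
    have IH: "Ck_on n S (\<lambda>y. K y w)" for w
      using Suc.IH Suc.prems Ck_on_SucD by blast
    have D: "Ck_on n S (\<lambda>y. fD (\<lambda>y. L y u) y v)" for u v
      using Suc.prems by simp
    have lin: "linear (\<lambda>u. fD (\<lambda>y. L y u) y v)" if y: "y \<in> S" for y v
    proof (rule linearI)
      have d: "((\<lambda>y. L y u) has_derivative fD (\<lambda>y. L y u) y) (at y)" for u
        using Suc.prems y by (intro has_derivative_fD) simp
      fix a b r
      have "((\<lambda>y. L y (a + b)) has_derivative (\<lambda>v. fD (\<lambda>y. L y a) y v + fD (\<lambda>y. L y b) y v)) (at y)"
        by (rule has_derivative_transform_within_open[OF has_derivative_add[OF d d] S y])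
          (simp add: linear_add[OF L(1)])
      then show "fD (\<lambda>y. L y (a + b)) y v = fD (\<lambda>y. L y a) y v + fD (\<lambda>y. L y b) y v"
        by (simp add: fD_eqI)
      have "((\<lambda>y. L y (r *\<^sub>R a)) has_derivative (\<lambda>v. r *\<^sub>R fD (\<lambda>y. L y a) y v)) (at y)"
        by (rule has_derivative_transform_within_open[OF has_derivative_scaleR_right[OF d] S y])
          (simp add: linear_scale[OF L(1)])
      then show "fD (\<lambda>y. L y (r *\<^sub>R a)) y v = r *\<^sub>R fD (\<lambda>y. L y a) y v"
        by (simp add: fD_eqI)
    qed
    have "Ck_on n S (\<lambda>x. fD (\<lambda>y. L y (K x w)) x v)" for v
      using lin D IH
      by (intro Ck_on_linear_family_apply[OF S, where L = "\<lambda>x u. fD (\<lambda>y. L y u) x v" and z = "\<lambda>x. K x w"])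
    then have "Ck_on n S (\<lambda>x. - K x (fD (\<lambda>y. L y (K x w)) x v))" for v
      using K(1) IH
      by (intro Ck_on_minus[OF S] Ck_on_linear_family_apply[OF S,
            where L = K and z = "\<lambda>x. fD (\<lambda>y. L y (K x w)) x v"])
    then have "Ck_on n S (\<lambda>x. fD (\<lambda>y. K y w) x v)" for v
      by (rule Ck_on_cong[OF S, rotated]) (simp add: 1)
    then show ?case using 1 by simp
  qed
qed

text \<open>Functionals \<open>k b\<close> dual to the images \<open>L x b\<close> turn
  \<open>L y\<close> into a square matrix that is the identity at \<open>x\<close>. While its
  entries deviate from those of the identity by less than 1/2 in total, it has no kernel. The domain
  is given by a finite basis, so that model spaces of dimension 0 are covered.\<close>

lemma open_Collect_inj_family:
  fixes L :: "'x::real_normed_vector \<Rightarrow> 'd::real_vector \<Rightarrow> 'c::euclidean_space"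
  assumes S: "open S" and B: "finite B" "independent B" "span B = UNIV"
    and L: "\<And>y. y \<in> S \<Longrightarrow> linear (L y)" "\<And>v. v \<in> B \<Longrightarrow> continuous_on S (\<lambda>y. L y v)"
  shows "open {y\<in>S. inj (L y)}"
  unfolding open_subopen[of "{y\<in>S. inj (L y)}"]
proof
  fix x assume "x \<in> {y\<in>S. inj (L y)}"
  then have x: "x \<in> S" "inj (L x)" by auto
  have inj: "inj_on (L x) (span B)" using x(2) by (rule inj_on_subset) simp
  have ind: "independent (L x ` B)"
    using linear_independent_injective_image[OF L(1)[OF x(1)] B(2)] inj by blast
  have "\<exists>k::'c \<Rightarrow> real. linear k \<and> (\<forall>a\<in>B. k (L x a) = (if a = b then 1 else 0))" if "b \<in> B" for b
    using linear_independent_extend[OF ind, of "\<lambda>z. if z = L x b then 1 else (0::real)"] x(2)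
    by (auto simp: inj_eq)
  then obtain k :: "'d \<Rightarrow> 'c \<Rightarrow> real" where k: "\<And>b. b \<in> B \<Longrightarrow> linear (k b)"
    "\<And>a b. a \<in> B \<Longrightarrow> b \<in> B \<Longrightarrow> k b (L x a) = (if a = b then 1 else 0)" by metis
  define \<delta> where "\<delta> y = (\<Sum>a\<in>B. \<Sum>b\<in>B. \<bar>(if a = b then 1 else 0) - k b (L y a)\<bar>)" for y
  have "continuous_on S (\<lambda>y. k b (L y a))" if "a \<in> B" "b \<in> B" for a b
    using bounded_linear.continuous_on[OF linear_conv_bounded_linear[THEN iffD1, OF k(1)[OF that(2)]] L(2)[OF that(1)]] .
  then have "continuous_on S \<delta>" unfolding \<delta>_def
    by (intro continuous_intros) auto
  then have op: "open (S \<inter> \<delta> -` {..<1/2})"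
    by (rule continuous_open_preimage[OF _ S open_lessThan])
  have "\<delta> x = 0" unfolding \<delta>_def using k(2) by (intro sum.neutral ballI) auto
  then have xin: "x \<in> S \<inter> \<delta> -` {..<1/2}" using x by auto
  have "inj (L y)" if y: "y \<in> S \<inter> \<delta> -` {..<1/2}" for y
  proof -
    have lin: "linear (L y)" using y L by auto
    show ?thesis unfolding linear_injective_0[OF lin]
    proof (intro allI impI)
      fix v assume v: "L y v = 0"
      obtain c where c: "v = (\<Sum>b\<in>B. c b *\<^sub>R b)"
        using span_finite[OF B(1)] B(3) by (metis (no_types, lifting) UNIV_I imageE)
      \<comment> \<open>For \<open>v\<close> in the kernel the coefficient vector \<open>c\<close>
        is reproduced by the deviation of the matrix from the identity. In the l1 norm
        \<open>s\<close> this gives \<open>s \<le> s * (1/2)\<close>, so \<open>c\<close>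
        vanishes.\<close>
      have cb: "c b = (\<Sum>a\<in>B. c a * ((if a = b then 1 else 0) - k b (L y a)))" if "b \<in> B" for b
      proof -
        have "k b (L y v) = (\<Sum>a\<in>B. c a * k b (L y a))"
          unfolding c using linear_sum[OF lin, of "\<lambda>b. c b *\<^sub>R b" B]
          by (simp add: linear_scale[OF lin] linear_sum[OF k(1)[OF that]] linear_scale[OF k(1)[OF that]])
        then have "(\<Sum>a\<in>B. c a * k b (L y a)) = 0" using v linear_0[OF k(1)[OF that]] by simp
        moreover have "(\<Sum>a\<in>B. c a * (if a = b then 1 else 0)) = c b"
          using that B(1) by (simp add: if_distrib[of "\<lambda>t. c _ * t"] sum.delta cong: if_cong)
        ultimately show ?thesis by (simp add: right_diff_distrib sum_subtractf)
      qed
      define s where "s = (\<Sum>b\<in>B. \<bar>c b\<bar>)"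
      have "s \<le> (\<Sum>b\<in>B. \<Sum>a\<in>B. \<bar>c a\<bar> * \<bar>(if a = b then 1 else 0) - k b (L y a)\<bar>)"
        unfolding s_def
      proof (rule sum_mono)
        fix b assume "b \<in> B"
        show "\<bar>c b\<bar> \<le> (\<Sum>a\<in>B. \<bar>c a\<bar> * \<bar>(if a = b then 1 else 0) - k b (L y a)\<bar>)"
          by (subst cb[OF \<open>b \<in> B\<close>]) (rule order_trans[OF sum_abs], simp add: abs_mult)
      qed
      also have "\<dots> \<le> (\<Sum>b\<in>B. \<Sum>a\<in>B. s * \<bar>(if a = b then 1 else 0) - k b (L y a)\<bar>)"
      proof (intro sum_mono mult_right_mono)
        fix a assume "a \<in> B"
        then show "\<bar>c a\<bar> \<le> s" unfolding s_def by (intro member_le_sum) (use B in auto)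
      qed simp
      also have "\<dots> = s * \<delta> y"
        unfolding \<delta>_def by (subst sum.swap) (simp add: sum_distrib_left)
      also have "\<dots> \<le> s * (1/2)"
        using y by (intro mult_left_mono) (auto simp: s_def intro: sum_nonneg)
      finally have "s \<le> s * (1/2)" .
      moreover have "s \<ge> 0" unfolding s_def by (simp add: sum_nonneg)
      ultimately have "s = 0" by simp
      then have "\<forall>b\<in>B. c b = 0" unfolding s_def using B(1) by (simp add: sum_nonneg_eq_0_iff)
      then show "v = 0" unfolding c by simp
    qed
  qed
  then show "\<exists>T. open T \<and> x \<in> T \<and> T \<subseteq> {y\<in>S. inj (L y)}"
    using op xin by (intro exI[of _ "S \<inter> \<delta> -` {..<1/2}"]) auto
qed

section \<open>Rules for smooth functions\<close>

lemma smooth_on_cong: "open S \<Longrightarrow> (\<And>y. y \<in> S \<Longrightarrow> f y = g y) \<Longrightarrow> smooth_on S f \<Longrightarrow> smooth_on S g"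
  unfolding smooth_on_def using Ck_on_cong by blast

lemma smooth_on_subset: "smooth_on S f \<Longrightarrow> T \<subseteq> S \<Longrightarrow> smooth_on T f"
  unfolding smooth_on_def using Ck_on_subset by blast

lemma smooth_on_differentiable: "smooth_on S f \<Longrightarrow> x \<in> S \<Longrightarrow> f differentiable (at x)"
  unfolding smooth_on_def by (metis Ck_on.simps(2))

lemma smooth_on_has_derivative: "smooth_on S f \<Longrightarrow> x \<in> S \<Longrightarrow> (f has_derivative fD f x) (at x)"
  by (intro has_derivative_fD smooth_on_differentiable)

lemma smooth_on_linear_fD: "smooth_on S f \<Longrightarrow> x \<in> S \<Longrightarrow> linear (fD f x)"
  by (intro bounded_linear.linear bounded_linear_fD smooth_on_differentiable)

lemma smooth_on_fD: "smooth_on S f \<Longrightarrow> smooth_on S (\<lambda>x. fD f x v)"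
  unfolding smooth_on_def by (metis Ck_on.simps(2))

lemma smooth_on_continuous: "smooth_on S f \<Longrightarrow> continuous_on S f"
  unfolding smooth_on_def using Ck_on_continuous by blast

lemma smooth_on_const: "smooth_on S (\<lambda>x. c)"
  by (simp add: smooth_on_def Ck_on_const)

lemma smooth_on_linear: "bounded_linear L \<Longrightarrow> smooth_on S L"
  by (simp add: smooth_on_def Ck_on_linear)

lemma smooth_on_ident: "smooth_on S (\<lambda>x. x)"
  using smooth_on_linear bounded_linear_ident .

lemma smooth_on_linear_compose: "open S \<Longrightarrow> bounded_linear L \<Longrightarrow> smooth_on S f \<Longrightarrow> smooth_on S (\<lambda>x. L (f x))"
  by (simp add: smooth_on_def Ck_on_linear_compose)

lemma smooth_on_compose_linear:
  "open S \<Longrightarrow> open T \<Longrightarrow> bounded_linear L \<Longrightarrow> L ` S \<subseteq> T \<Longrightarrow> smooth_on T f \<Longrightarrow> smooth_on S (\<lambda>x. f (L x))"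
  unfolding smooth_on_def using Ck_on_compose_linear by blast

lemma smooth_on_Pair: "open S \<Longrightarrow> smooth_on S f \<Longrightarrow> smooth_on S g \<Longrightarrow> smooth_on S (\<lambda>x. (f x, g x))"
  by (simp add: smooth_on_def Ck_on_Pair)

lemma smooth_on_add: "open S \<Longrightarrow> smooth_on S f \<Longrightarrow> smooth_on S g \<Longrightarrow> smooth_on S (\<lambda>x. f x + g x)"
  by (simp add: smooth_on_def Ck_on_add)

lemma smooth_on_diff: "open S \<Longrightarrow> smooth_on S f \<Longrightarrow> smooth_on S g \<Longrightarrow> smooth_on S (\<lambda>x. f x - g x)"
  by (simp add: smooth_on_def Ck_on_diff)

lemma smooth_on_sum: "open S \<Longrightarrow> (\<And>i. i \<in> A \<Longrightarrow> smooth_on S (f i)) \<Longrightarrow> smooth_on S (\<lambda>x. \<Sum>i\<in>A. f i x)"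
  by (simp add: smooth_on_def Ck_on_sum)

lemma smooth_on_bilinear:
  "open S \<Longrightarrow> bounded_bilinear b \<Longrightarrow> smooth_on S f \<Longrightarrow> smooth_on S g \<Longrightarrow> smooth_on S (\<lambda>x. b (f x) (g x))"
  by (simp add: smooth_on_def Ck_on_bilinear)

lemmas smooth_on_scaleR = smooth_on_bilinear[OF _ bounded_bilinear_scaleR]

lemma smooth_on_compose:
  fixes g :: "'x::real_normed_vector \<Rightarrow> 'a::euclidean_space" and f :: "'a \<Rightarrow> 'b::real_normed_vector"
  shows "open S \<Longrightarrow> open T \<Longrightarrow> smooth_on S g \<Longrightarrow> g ` S \<subseteq> T \<Longrightarrow> smooth_on T f \<Longrightarrow> smooth_on S (\<lambda>x. f (g x))"
  unfolding smooth_on_def using Ck_on_compose by blast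

lemma smooth_on_linear_family_apply:
  fixes L :: "'x::real_normed_vector \<Rightarrow> 'a::euclidean_space \<Rightarrow> 'b::real_normed_vector"
  shows "open S \<Longrightarrow> (\<And>y. y \<in> S \<Longrightarrow> linear (L y)) \<Longrightarrow> (\<And>v. smooth_on S (\<lambda>y. L y v)) \<Longrightarrow> smooth_on S z \<Longrightarrow>
    smooth_on S (\<lambda>y. L y (z y))"
  by (simp add: smooth_on_def Ck_on_linear_family_apply)

lemma smooth_on_inverse_family:
  fixes L :: "'x::real_normed_vector \<Rightarrow> 'a::euclidean_space \<Rightarrow> 'b::euclidean_space"
  assumes "open S" "\<And>y. y \<in> S \<Longrightarrow> linear (L y)" "\<And>v. smooth_on S (\<lambda>y. L y v)"
    "\<And>y. y \<in> S \<Longrightarrow> linear (K y)" "\<And>y w. y \<in> S \<Longrightarrow> L y (K y w) = w" "\<And>y v. y \<in> S \<Longrightarrow> K y (L y v) = v"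
  shows "smooth_on S (\<lambda>y. K y w)"
  unfolding smooth_on_def
proof
  fix n
  have "Ck_on n S (\<lambda>y. L y v)" for v
    using assms(3) by (simp add: smooth_on_def)
  then show "Ck_on n S (\<lambda>y. K y w)"
    using assms by (intro Ck_on_inverse_family[of S L n K])
qed

text \<open>The inverse \<open>g\<close> is at first only differentiable, with derivative
  \<open>inv (fD f (g y))\<close>. If \<open>g\<close> is of class C^n, then so are the maps
  \<open>fD f (g y) v\<close>, hence so is the family of their inverses, hence \<open>g\<close> is
  of class C^(n+1).\<close>

lemma smooth_inverse_function_endo:
  fixes f :: "'a::euclidean_space \<Rightarrow> 'a"
  assumes S: "open S" and f: "smooth_on S f" and x0: "x0 \<in> S" and inj: "inj (fD f x0)"
  obtains U V g where "open U" "x0 \<in> U" "U \<subseteq> S" "open V" "f ` U = V"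
    "\<And>x. x \<in> U \<Longrightarrow> g (f x) = x" "\<And>y. y \<in> V \<Longrightarrow> g y \<in> U \<and> f (g y) = y" "smooth_on V g"
proof -
  define f' where "f' x = Blinfun (fD f x)" for x
  have f': "blinfun_apply (f' x) = fD f x" if "x \<in> S" for x
    unfolding f'_def using bounded_linear_Blinfun_apply bounded_linear_fD smooth_on_differentiable[OF f that] by blast
  have lin: "linear (fD f x)" if "x \<in> S" for x using smooth_on_linear_fD[OF f that] .
  have cont: "continuous_on S f'"
  proof (rule continuous_on_blinfun_componentwise)
    fix i :: 'a
    have "continuous_on S (\<lambda>x. fD f x i)" using smooth_on_continuous[OF smooth_on_fD[OF f]] .
    then show "continuous_on S (\<lambda>x. blinfun_apply (f' x) i)"
      by (rule continuous_on_eq) (simp add: f')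
  qed
  obtain h where h: "linear h" "h \<circ> fD f x0 = id"
    using linear_injective_left_inverse[OF lin[OF x0] inj] by blast
  have "Blinfun h o\<^sub>L f' x0 = id_blinfun"
  proof (rule blinfun_eqI)
    fix i
    have "bounded_linear h" using h(1) linear_conv_bounded_linear by blast
    then show "blinfun_apply (Blinfun h o\<^sub>L f' x0) i = blinfun_apply id_blinfun i"
      using h(2) f'[OF x0] by (simp add: bounded_linear_Blinfun_apply pointfree_idE)
  qed
  then obtain U V g g' where U: "open U" "U \<subseteq> S" "x0 \<in> U" "open V" "homeomorphism U V f g"
    and g: "\<And>y. y \<in> V \<Longrightarrow> (g has_derivative (g' y)) (at y)"
    "\<And>y. y \<in> V \<Longrightarrow> g' y = inv (blinfun_apply (f' (g y)))"
    "\<And>y. y \<in> V \<Longrightarrow> bij (blinfun_apply (f' (g y)))"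
    using inverse_function_theorem[OF S _ cont x0, of f "Blinfun h"] f' smooth_on_has_derivative[OF f]
    by (metis (no_types, lifting))
  have gU: "g y \<in> U" "f (g y) = y" if "y \<in> V" for y
    using U(5) that by (auto simp: homeomorphism_def)
  have gV: "g ` V \<subseteq> S" using gU U by auto
  have bij: "bij (fD f (g y))" "fD g y = inv (fD f (g y))" if "y \<in> V" for y
    using g[OF that] f'[of "g y"] gV that fD_eqI by (auto simp: image_subset_iff)
  have "Ck_on n V g" for n
  proof (induction n)
    case 0
    then show ?case using U(5) by (simp add: homeomorphism_def)
  next
    case (Suc n)
    have linV: "linear (fD f (g y))" if "y \<in> V" for y using lin gV that by auto
    have "Ck_on n V (\<lambda>y. inv (fD f (g y)) v)" for v
    proof (rule Ck_on_inverse_family[OF U(4)])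
      show "linear (fD f (g y))" if "y \<in> V" for y using linV that .
      show "Ck_on n V (\<lambda>y. fD f (g y) v)" for v
        using smooth_on_fD[OF f, of v] by (intro Ck_on_compose[OF U(4) S Suc gV]) (simp add: smooth_on_def)
      show "linear (inv (fD f (g y)))" if "y \<in> V" for y
        using inj_linear_imp_inv_linear[OF linV[OF that] bij_is_inj[OF bij(1)[OF that]]] .
      show "fD f (g y) (inv (fD f (g y)) w) = w" if "y \<in> V" for y w
        using bij[OF that] by (simp add: bij_is_surj surj_f_inv_f)
      show "inv (fD f (g y)) (fD f (g y) v) = v" if "y \<in> V" for y v
        using bij[OF that] by (simp add: bij_is_inj)
    qed
    then have "Ck_on n V (\<lambda>y. fD g y v)" for v
      by (rule Ck_on_cong[OF U(4), rotated]) (simp add: bij)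
    then show ?case using g(1) by (auto simp: differentiable_def)
  qed
  then have sg: "smooth_on V g" by (simp add: smooth_on_def)
  show ?thesis
  proof (rule that[OF U(1,3,2,4)])
    show "f ` U = V" using U(5) by (simp add: homeomorphism_def)
    show "g (f x) = x" if "x \<in> U" for x using U(5) that by (simp add: homeomorphism_def)
    show "g y \<in> U \<and> f (g y) = y" if "y \<in> V" for y using gU[OF that] by blast
  qed (rule sg)
qed

text \<open>The coordinates constructed below take values in a product
  \<open>'p \<times> real\<close>, a different type of the same dimension, so the map is composed
  with a linear isometry back to its domain type.\<close>

lemma smooth_inverse_function:
  fixes f :: "'a::euclidean_space \<Rightarrow> 'b::euclidean_space"
  assumes S: "open S" and f: "smooth_on S f" and x0: "x0 \<in> S" and inj: "inj (fD f x0)"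
    and dim: "DIM('a) = DIM('b)"
  obtains U V g where "open U" "x0 \<in> U" "U \<subseteq> S" "open V" "f ` U = V"
    "\<And>x. x \<in> U \<Longrightarrow> g (f x) = x" "\<And>y. y \<in> V \<Longrightarrow> g y \<in> U \<and> f (g y) = y" "smooth_on V g"
proof -
  obtain i :: "'b \<Rightarrow> 'a" and j where ij: "linear i" "linear j" "\<And>x. norm (i x) = norm x"
    "\<And>y. norm (j y) = norm y" "\<And>x. j (i x) = x" "\<And>y. i (j y) = y"
    using isomorphisms_UNIV_UNIV[OF dim[symmetric]] by metis
  have bl: "bounded_linear i" "bounded_linear j" using ij(1,2) by (simp_all add: linear_conv_bounded_linear)
  have F: "smooth_on S (\<lambda>x. i (f x))" by (rule smooth_on_linear_compose[OF S bl(1) f])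
  have "fD (\<lambda>x. i (f x)) x0 = (\<lambda>v. i (fD f x0 v))"
    by (intro fD_eqI bounded_linear.has_derivative[OF bl(1)] smooth_on_has_derivative[OF f x0])
  then have injF: "inj (fD (\<lambda>x. i (f x)) x0)"
    using inj by (metis (no_types, lifting) ij(5) injD injI)
  obtain U V g where U: "open U" "x0 \<in> U" "U \<subseteq> S" "open V" "(\<lambda>x. i (f x)) ` U = V"
    "\<And>x. x \<in> U \<Longrightarrow> g (i (f x)) = x" "\<And>y. y \<in> V \<Longrightarrow> g y \<in> U \<and> i (f (g y)) = y" "smooth_on V g"
    by (rule smooth_inverse_function_endo[OF S F x0 injF]) blast
  show ?thesis
  proof (rule that[OF U(1,2,3)])
    show o: "open (i -` V)"
      using bl(1) U(4) by (simp add: linear_continuous_at continuous_open_vimage)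
    show "g (i (f x)) = x" if "x \<in> U" for x using U(6)[OF that] .
    show "f ` U = i -` V"
    proof (intro set_eqI iffI)
      fix y assume "y \<in> i -` V"
      then obtain x where "x \<in> U" "i y = i (f x)" using U(5) by auto
      then show "y \<in> f ` U" using ij(5) by (metis imageI)
    qed (use U(5) in auto)
    show "g (i y) \<in> U \<and> f (g (i y)) = y" if "y \<in> i -` V" for y
    proof -
      have "g (i y) \<in> U" "i (f (g (i y))) = i y" using U(7)[of "i y"] that by auto
      then show ?thesis using ij(5) by metis
    qed
    show "smooth_on (i -` V) (\<lambda>y. g (i y))"
      by (rule smooth_on_compose_linear[OF o U(4) bl(1) _ U(8)]) auto
  qed
qed

section \<open>Symmetric bilinear forms\<close>

text \<open>Definiteness is left out, because for \<epsilon> = -1 the form is Lorentzian. Positivity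
  is assumed lemma by lemma, on the subspace concerned.\<close>

locale symmetric_form =
  fixes b :: "'v::euclidean_space \<Rightarrow> 'v \<Rightarrow> real"
  assumes bounded: "bounded_bilinear b" and sym: "b y z = b z y"
begin

lemmas add_left = bounded_bilinear.add_left[OF bounded]
  and add_right = bounded_bilinear.add_right[OF bounded]
  and diff_left = bounded_bilinear.diff_left[OF bounded]
  and diff_right = bounded_bilinear.diff_right[OF bounded]
  and minus_left = bounded_bilinear.minus_left[OF bounded]
  and minus_right = bounded_bilinear.minus_right[OF bounded]
  and scaleR_left = bounded_bilinear.scaleR_left[OF bounded]
  and scaleR_right = bounded_bilinear.scaleR_right[OF bounded]
  and sum_left = bounded_bilinear.sum_left[OF bounded]
  and sum_right = bounded_bilinear.sum_right[OF bounded]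
  and zero_left = bounded_bilinear.zero_left[OF bounded]
  and zero_right = bounded_bilinear.zero_right[OF bounded]

lemmas simps = add_left add_right diff_left diff_right minus_left minus_right scaleR_left scaleR_right
  sum_left sum_right zero_left zero_right

lemma linear_right: "linear (b y)"
  by (rule linearI) (simp_all add: simps)

definition orthonormal :: "'i set \<Rightarrow> ('i \<Rightarrow> 'v) \<Rightarrow> bool" where
  "orthonormal A e \<longleftrightarrow> (\<forall>i\<in>A. \<forall>j\<in>A. b (e i) (e j) = (if i = j then 1 else 0))"

lemma orthonormal_coefficient:
  assumes "finite A" "orthonormal A e" "j \<in> A"
  shows "b (\<Sum>i\<in>A. c i *\<^sub>R e i) (e j) = c j"
proof -
  have "b (\<Sum>i\<in>A. c i *\<^sub>R e i) (e j) = (\<Sum>i\<in>A. c i * b (e i) (e j))"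
    by (simp add: sum_left scaleR_left)
  also have "\<dots> = (\<Sum>i\<in>A. if i = j then c i else 0)"
    using assms(2,3) by (intro sum.cong) (auto simp: orthonormal_def)
  also have "\<dots> = c j" using assms(1,3) by simp
  finally show ?thesis .
qed

text \<open>Pairing a linear relation with \<open>e j\<close> isolates one coefficient, for an
  indefinite form as well. The bound makes maximal orthonormal families exist, of vectors here and
  of parallel fields later.\<close>

lemma orthonormal_card_le:
  assumes "finite A" "orthonormal A e"
  shows "card A \<le> DIM('v)"
proof -
  have o: "b (e i) (e j) = (if i = j then 1 else 0)" if "i \<in> A" "j \<in> A" for i j
    using assms(2) that unfolding orthonormal_def by blast
  have inj: "inj_on e A"
  proof (rule inj_onI)
    fix i j assume ij: "i \<in> A" "j \<in> A" "e i = e j"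
    then have "b (e i) (e j) = 1" using o[OF ij(2,2)] by simp
    then show "i = j" using o[OF ij(1,2)] by (simp split: if_splits)
  qed
  have "independent (e ` A)"
  proof
    assume "dependent (e ` A)"
    then obtain u where u: "(\<Sum>v\<in>e ` A. u v *\<^sub>R v) = 0" "\<exists>v\<in>e ` A. u v \<noteq> 0"
      unfolding dependent_finite[OF finite_imageI[OF assms(1)]] by blast
    then obtain j where j: "j \<in> A" "u (e j) \<noteq> 0" by auto
    have "0 = b (\<Sum>i\<in>A. u (e i) *\<^sub>R e i) (e j)"
      using u(1) by (simp add: sum.reindex[OF inj] zero_left)
    also have "\<dots> = u (e j)"
      by (rule orthonormal_coefficient[OF assms j(1)])
    finally show False using j(2) by simp
  qed
  then have "card (e ` A) \<le> DIM('v)"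
    using independent_card_le_dim[of "e ` A" UNIV] by simp
  then show ?thesis using card_image[OF inj] by simp
qed

text \<open>A family of maximal length spans: a nonzero remainder \<open>r\<close> would have
  positive square, and after division by \<open>sqrt (b r r)\<close> it would extend the
  family.\<close>

lemma orthonormal_basis_exists:
  assumes V: "subspace V" and pos: "\<And>z. z \<in> V \<Longrightarrow> z \<noteq> 0 \<Longrightarrow> b z z > 0"
  obtains k and e :: "nat \<Rightarrow> 'v" where "\<And>i. i < k \<Longrightarrow> e i \<in> V" "orthonormal {..<k} e"
    "\<And>z. z \<in> V \<Longrightarrow> z = (\<Sum>i<k. b z (e i) *\<^sub>R e i)"
proof -
  define P where "P k \<longleftrightarrow> (\<exists>e. (\<forall>i<k::nat. e i \<in> V) \<and> orthonormal {..<k} e)" for k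
  have "P 0" by (simp add: P_def orthonormal_def)
  moreover have "k \<le> DIM('v)" if "P k" for k
    using that orthonormal_card_le[of "{..<k}"] by (auto simp: P_def)
  ultimately obtain k where k: "P k" "\<And>l. P l \<Longrightarrow> l \<le> k"
    using Nat.ex_has_greatest_nat[of P "0::nat" "DIM('v)"] by blast
  from k(1) obtain e where e: "\<And>i. i < k \<Longrightarrow> e i \<in> V" "orthonormal {..<k} e"
    unfolding P_def by blast
  have o: "b (e i) (e j) = (if i = j then 1 else 0)" if "i < k" "j < k" for i j
    using e(2) that unfolding orthonormal_def by blast
  have "z = (\<Sum>i<k. b z (e i) *\<^sub>R e i)" if z: "z \<in> V" for z
  proof (rule ccontr)
    define r where "r = z - (\<Sum>i<k. b z (e i) *\<^sub>R e i)"
    assume "\<not> ?thesis"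
    then have "r \<noteq> 0" by (simp add: r_def)
    have rV: "r \<in> V" unfolding r_def
      by (intro subspace_diff[OF V] z subspace_sum[OF V] subspace_scale[OF V] e) auto
    have rr: "b r r > 0" using pos[OF rV \<open>r \<noteq> 0\<close>] .
    have re: "b r (e j) = 0" if "j < k" for j
      using that orthonormal_coefficient[OF _ e(2), of j "\<lambda>i. b z (e i)"] by (simp add: r_def diff_left)
    define e' where "e' = e(k := (1 / sqrt (b r r)) *\<^sub>R r)"
    have "P (Suc k)" unfolding P_def
    proof (intro exI[of _ e'] conjI allI impI)
      show "e' i \<in> V" if "i < Suc k" for i
        using that e(1) rV subspace_scale[OF V] by (cases "i = k") (auto simp: e'_def)
      show "orthonormal {..<Suc k} e'"
        unfolding orthonormal_def
      proof (intro ballI)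
        fix i j assume "i \<in> {..<Suc k}" "j \<in> {..<Suc k}"
        then have "i < k \<or> i = k" "j < k \<or> j = k" by auto
        then consider "i < k" "j < k" | "i = k" "j < k" | "i < k" "j = k" | "i = k" "j = k" by blast
        then show "b (e' i) (e' j) = (if i = j then 1 else 0)"
        proof cases
          case 1
          then show ?thesis using o by (simp add: e'_def)
        next
          case 2
          then show ?thesis using re by (simp add: e'_def scaleR_left)
        next
          case 3
          then show ?thesis using re sym[of "e i" r] by (simp add: e'_def scaleR_right)
        next
          case 4
          then show ?thesis using rr by (simp add: e'_def scaleR_left scaleR_right)
        qed
      qed
    qed
    from k(2)[OF this] show False by simp
  qed
  with e show ?thesis by (rule that)
qed

lemma projection_exists:
  assumes V: "subspace V" and pos: "\<And>z. z \<in> V \<Longrightarrow> z \<noteq> 0 \<Longrightarrow> b z z > 0"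
  shows "\<exists>u\<in>V. \<forall>v\<in>V. b (z - u) v = 0"
proof -
  obtain k and e :: "nat \<Rightarrow> 'v" where e: "\<And>i. i < k \<Longrightarrow> e i \<in> V" "orthonormal {..<k} e"
    "\<And>z. z \<in> V \<Longrightarrow> z = (\<Sum>i<k. b z (e i) *\<^sub>R e i)"
    by (rule orthonormal_basis_exists[OF V pos]) blast+
  define u where "u = (\<Sum>i<k. b z (e i) *\<^sub>R e i)"
  have "u \<in> V" unfolding u_def by (intro subspace_sum[OF V] subspace_scale[OF V] e) auto
  moreover have 1: "b (z - u) (e j) = 0" if "j < k" for j
    using that orthonormal_coefficient[OF _ e(2), of j "\<lambda>i. b z (e i)"] by (simp add: u_def diff_left)
  have "b (z - u) v = 0" if "v \<in> V" for v
    by (subst e(3)[OF that]) (simp add: sum_right scaleR_right 1)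
  ultimately show ?thesis by blast
qed

text \<open>A Riesz representation on the image of \<open>L\<close>, pulled back to the domain,
  which carries no inner product of its own. It is the source of existence for the shape operators
  and for T.\<close>

lemma representation_exists:
  fixes L :: "'e::real_vector \<Rightarrow> 'v" and l :: "'e \<Rightarrow> real"
  assumes L: "linear L" "inj L" and l: "linear l" and pos: "\<And>z. z \<in> range L \<Longrightarrow> z \<noteq> 0 \<Longrightarrow> b z z > 0"
  shows "\<exists>u. \<forall>w. b (L u) (L w) = l w"
proof -
  obtain k and e :: "nat \<Rightarrow> 'v" where e: "\<And>i. i < k \<Longrightarrow> e i \<in> range L"
    "\<And>z. z \<in> range L \<Longrightarrow> z = (\<Sum>i<k. b z (e i) *\<^sub>R e i)"
    by (rule orthonormal_basis_exists[OF linear_subspace_image[OF L(1) subspace_UNIV] pos]) blast+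
  then have "\<forall>i. \<exists>x. i < k \<longrightarrow> e i = L x" by blast
  then obtain a where a: "\<And>i. i < k \<Longrightarrow> e i = L (a i)" by metis
  have w: "w = (\<Sum>i<k. b (L w) (e i) *\<^sub>R a i)" for w
  proof (rule injD[OF L(2)])
    have "L w = (\<Sum>i<k. b (L w) (e i) *\<^sub>R e i)" by (intro e(2)) simp
    also have "\<dots> = (\<Sum>i<k. b (L w) (e i) *\<^sub>R L (a i))" by (simp add: a)
    also have "\<dots> = L (\<Sum>i<k. b (L w) (e i) *\<^sub>R a i)"
      by (simp add: linear_sum[OF L(1)] linear_scale[OF L(1)])
    finally show "L w = L (\<Sum>i<k. b (L w) (e i) *\<^sub>R a i)" .
  qed
  show ?thesis
  proof (intro exI allI)
    fix w
    have "b (L (\<Sum>i<k. l (a i) *\<^sub>R a i)) (L w) = (\<Sum>i<k. l (a i) * b (e i) (L w))"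
      by (simp add: linear_sum[OF L(1)] linear_scale[OF L(1)] simps a)
    also have "\<dots> = l (\<Sum>i<k. b (L w) (e i) *\<^sub>R a i)"
      unfolding linear_sum[OF l] linear_scale[OF l] by (intro sum.cong refl) (simp add: sym[of "e _"] mult.commute)
    also have "\<dots> = l w" by (rule arg_cong[OF w[symmetric]])
    finally show "b (L (\<Sum>i<k. l (a i) *\<^sub>R a i)) (L w) = l w" .
  qed
qed

end

section \<open>Ambient spaces\<close>

text \<open>Positivity on tangent spaces makes the objects behind the definite descriptions (normal
  part, shape operator, T) exist and be unique, although the form itself may be Lorentzian.\<close>

locale ambient_space = symmetric_form "form S" for S :: "'v::euclidean_space ambient" +
  assumes tangent_subspace: "y \<in> locus S \<Longrightarrow> subspace (tangent S y)"
    and form_pos: "y \<in> locus S \<Longrightarrow> z \<in> tangent S y \<Longrightarrow> z \<noteq> 0 \<Longrightarrow> form S z z > 0"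
begin

lemma normal_space_subspace: "f p \<in> locus S \<Longrightarrow> subspace (normal_space S c f p)"
  using tangent_subspace[of "f p"]
  by (auto simp: subspace_def normal_space_def simps)

lemma normal_spaceD: "\<zeta> \<in> normal_space S c f p \<Longrightarrow> form S (differential c f p v) \<zeta> = 0"
  "\<zeta> \<in> normal_space S c f p \<Longrightarrow> \<zeta> \<in> tangent S (f p)"
  by (simp_all add: normal_space_def)

lemma form_eq_0D: "y \<in> locus S \<Longrightarrow> z \<in> tangent S y \<Longrightarrow> form S z z = 0 \<Longrightarrow> z = 0"
  using form_pos by fastforce

lemma normal_part_eqI:
  assumes p: "f p \<in> locus S" and "\<zeta> \<in> normal_space S c f p"
    "\<And>\<zeta>'. \<zeta>' \<in> normal_space S c f p \<Longrightarrow> form S (z - \<zeta>) \<zeta>' = 0"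
  shows "normal_part S c f p z = \<zeta>"
  unfolding normal_part_def
proof (rule the_equality)
  show "\<zeta> \<in> normal_space S c f p \<and> (\<forall>\<zeta>'\<in>normal_space S c f p. form S (z - \<zeta>) \<zeta>' = 0)"
    using assms by blast
next
  fix \<eta> assume \<eta>: "\<eta> \<in> normal_space S c f p \<and> (\<forall>\<zeta>'\<in>normal_space S c f p. form S (z - \<eta>) \<zeta>' = 0)"
  then have "\<eta> - \<zeta> \<in> normal_space S c f p"
    using assms subspace_diff[OF normal_space_subspace[of f p c, OF p]] by blast
  then have "form S (\<eta> - \<zeta>) (\<eta> - \<zeta>) = 0" "\<eta> - \<zeta> \<in> tangent S (f p)"
    using assms(3)[of "\<eta> - \<zeta>"] \<eta> by (auto simp: diff_left normal_space_def)
  then show "\<eta> = \<zeta>" using form_eq_0D[OF p, of "\<eta> - \<zeta>"] by auto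
qed

lemma normal_part:
  assumes p: "f p \<in> locus S"
  shows "normal_part S c f p z \<in> normal_space S c f p"
    "\<zeta> \<in> normal_space S c f p \<Longrightarrow> form S (normal_part S c f p z) \<zeta> = form S z \<zeta>"
proof -
  have "\<exists>u\<in>normal_space S c f p. \<forall>v\<in>normal_space S c f p. form S (z - u) v = 0"
    by (rule projection_exists[OF normal_space_subspace[of f p, OF p]]) (rule form_pos[OF p normal_spaceD(2)[where f = f and p = p]])
  then obtain u where u: "u \<in> normal_space S c f p" "\<And>v. v \<in> normal_space S c f p \<Longrightarrow> form S (z - u) v = 0"
    by blast
  have eq: "normal_part S c f p z = u" by (rule normal_part_eqI[of f p, OF p u])
  show "normal_part S c f p z \<in> normal_space S c f p" using eq u by simp
  show "form S (normal_part S c f p z) \<zeta> = form S z \<zeta>" if "\<zeta> \<in> normal_space S c f p"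
    using eq u(2)[OF that] by (simp add: diff_left)
qed

lemma normal_part_eq_0_iff:
  assumes "f p \<in> locus S"
  shows "normal_part S c f p z = 0 \<longleftrightarrow> (\<forall>\<zeta>\<in>normal_space S c f p. form S z \<zeta> = 0)"
proof
  assume "normal_part S c f p z = 0"
  then show "\<forall>\<zeta>\<in>normal_space S c f p. form S z \<zeta> = 0"
    using normal_part(2)[of f p _ c z, OF assms] by (simp add: zero_left)
next
  assume z: "\<forall>\<zeta>\<in>normal_space S c f p. form S z \<zeta> = 0"
  show "normal_part S c f p z = 0"
    by (rule normal_part_eqI[of f p, OF assms subspace_0[OF normal_space_subspace[of f p, OF assms]]])
      (use z in simp)
qed

text \<open>The remainder of \<open>z\<close> after projection to the range is tangent and
  orthogonal to the range, hence by assumption orthogonal to \<open>z\<close>, hence to itself. In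
  this way a tangent vector without normal component is recognized as an image under the
  differential.\<close>

lemma double_orthogonal_in_range:
  assumes y: "y \<in> locus S" and L: "linear L" and tan: "range L \<subseteq> tangent S y"
    and z: "z \<in> tangent S y"
      "\<And>\<zeta>. \<zeta> \<in> tangent S y \<Longrightarrow> (\<And>v. form S (L v) \<zeta> = 0) \<Longrightarrow> form S z \<zeta> = 0"
  shows "z \<in> range L"
proof -
  have "\<exists>u\<in>range L. \<forall>v\<in>range L. form S (z - u) v = 0"
    by (rule projection_exists[OF linear_subspace_image[OF L subspace_UNIV]]) (rule form_pos[OF y subsetD[OF tan]])
  then obtain u where u: "u \<in> range L" "\<And>v. v \<in> range L \<Longrightarrow> form S (z - u) v = 0" by blast
  have t: "z - u \<in> tangent S y"
    using u(1) tan z(1) by (intro subspace_diff[OF tangent_subspace[OF y]]) auto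
  have "form S (L v) (z - u) = 0" for v using u(2)[of "L v"] sym[of "L v"] by simp
  then have "form S z (z - u) = 0" using z(2)[OF t] by blast
  moreover have "form S u (z - u) = 0" using u(2)[OF u(1)] sym[of u] by simp
  ultimately have "form S (z - u) (z - u) = 0" by (simp add: diff_left)
  then have "z = u" using form_eq_0D[OF y t] by simp
  then show ?thesis using u(1) by simp
qed

text \<open>For normal \<open>\<zeta>\<close>, the projection in the definition of the second fundamental form can be dropped.\<close>

lemma shape_operator_eqI:
  assumes p: "f p \<in> locus S" and L: "linear (differential c f p)" "inj (differential c f p)"
    and tan: "range (differential c f p) \<subseteq> tangent S (f p)"
    and G: "\<And>v w. G c p v w = form S (differential c f p v) (differential c f p w)"
    and \<zeta>: "\<zeta> \<in> normal_space S c f p"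
    and u: "\<And>w. G c p u w = form S (second_differential c f p v w) \<zeta>"
  shows "shape_operator S G c f p \<zeta> v = u"
  unfolding shape_operator_def
proof (rule the_equality)
  show "\<forall>w. G c p u w = form S (second_fundamental_form S c f p v w) \<zeta>"
    using u normal_part(2)[OF p \<zeta>] by (simp add: second_fundamental_form_def)
next
  fix u' assume "\<forall>w. G c p u' w = form S (second_fundamental_form S c f p v w) \<zeta>"
  then have "G c p u' w = G c p u w" for w
    using u normal_part(2)[OF p \<zeta>] by (simp add: second_fundamental_form_def)
  then have "form S (differential c f p u') z - form S (differential c f p u) z = 0"
    if "z \<in> range (differential c f p)" for z
    using that G by auto
  then have "form S (differential c f p u' - differential c f p u) (differential c f p (u' - u)) = 0"
    by (simp add: diff_left)
  then have "form S (differential c f p (u' - u)) (differential c f p (u' - u)) = 0"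
    using linear_diff[OF L(1), of u' u] by simp
  then have "differential c f p (u' - u) = 0" using form_eq_0D[OF p subsetD[OF tan rangeI]] by blast
  then show "u' = u" using injD[OF L(2), of "u' - u" 0] linear_0[OF L(1)] by simp
qed

text \<open>The product of \<open>second_differential c f p v w\<close> with \<open>\<zeta>\<close>
  is a linear functional of \<open>w\<close> and is therefore represented by a vector, which must be
  the value of the definite description.\<close>

lemma shape_operator:
  assumes p: "f p \<in> locus S" and L: "linear (differential c f p)" "inj (differential c f p)"
    and tan: "range (differential c f p) \<subseteq> tangent S (f p)"
    and G: "\<And>v w. G c p v w = form S (differential c f p v) (differential c f p w)"
    and \<zeta>: "\<zeta> \<in> normal_space S c f p"
    and lin: "linear (second_differential c f p v)"
  shows "G c p (shape_operator S G c f p \<zeta> v) w = form S (second_differential c f p v w) \<zeta>"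
proof -
  have l: "linear (\<lambda>w. form S (second_differential c f p v w) \<zeta>)"
    by (rule linearI) (simp_all add: linear_add[OF lin] linear_scale[OF lin] simps)
  have "\<exists>u. \<forall>w. form S (differential c f p u) (differential c f p w) = form S (second_differential c f p v w) \<zeta>"
    by (rule representation_exists[OF L l]) (rule form_pos[OF p subsetD[OF tan]])
  then obtain u where u: "\<And>w. form S (differential c f p u) (differential c f p w) = form S (second_differential c f p v w) \<zeta>"
    by blast
  then show ?thesis using shape_operator_eqI[of f p c G, OF p L tan G \<zeta>, of u v] by (simp add: G)
qed

end

subsection \<open>The spaces \<open>Q \<epsilon>\<close> and \<open>Q \<epsilon> \<times> \<real>\<close>\<close>

lemma bounded_bilinear_plus:
  assumes "bounded_bilinear f" "bounded_bilinear g"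
  shows "bounded_bilinear (\<lambda>x y. f x y + g x y)"
proof -
  interpret f: bounded_bilinear f by fact
  interpret g: bounded_bilinear g by fact
  obtain K L where "\<And>x y. norm (f x y) \<le> norm x * norm y * K" "\<And>x y. norm (g x y) \<le> norm x * norm y * L"
    using f.bounded g.bounded by auto
  then have "norm (f x y + g x y) \<le> norm x * norm y * (K + L)" for x y
    by (metis add_mono_thms_linordered_semiring(1) distrib_left norm_triangle_le)
  then show ?thesis
    by unfold_locales
      (auto simp: f.add_left f.add_right g.add_left g.add_right f.scaleR_left f.scaleR_right
        g.scaleR_left g.scaleR_right scaleR_add_right)
qed

lemma Q_form_bilinear: "bounded_bilinear (Q_form \<epsilon>)"
proof -
  have 1: "bounded_bilinear (\<lambda>y z :: real \<times> (real^'n). fst y * fst z)"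
    by (rule bounded_bilinear.comp[OF bounded_bilinear_mult bounded_linear_fst bounded_linear_fst])
  have 2: "bounded_bilinear (\<lambda>y z :: real \<times> (real^'n). snd y \<bullet> snd z)"
    by (rule bounded_bilinear.comp[OF bounded_bilinear_inner bounded_linear_snd bounded_linear_snd])
  have 3: "bounded_bilinear (\<lambda>y z :: real \<times> (real^'n). - fst y * fst z)"
    by (rule bounded_bilinear.comp[OF bounded_bilinear_mult bounded_linear_minus[OF bounded_linear_fst] bounded_linear_fst])
  show ?thesis
  proof (cases "\<epsilon> = -1")
    case True
    have "bounded_bilinear (\<lambda>y z :: real \<times> (real^'n). - fst y * fst z + snd y \<bullet> snd z)"
      by (rule bounded_bilinear_plus[OF 3 2])
    then show ?thesis using True by (simp add: Q_form_def[abs_def])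
  next
    case False
    have "bounded_bilinear (\<lambda>y z :: real \<times> (real^'n). fst y * fst z + snd y \<bullet> snd z)"
      by (rule bounded_bilinear_plus[OF 1 2])
    then show ?thesis using False by (simp add: Q_form_def[abs_def])
  qed
qed

lemma Q_form_sym: "Q_form \<epsilon> y z = Q_form \<epsilon> z y"
  by (simp add: Q_form_def inner_commute mult.commute)

lemma Q_simps: "form (Q \<epsilon>) = Q_form \<epsilon>"
  "tangent (Q \<epsilon>) y = (if \<epsilon> = 0 then {z. fst z = 0} else {z. Q_form \<epsilon> y z = 0})"
  "locus (QxR \<epsilon>) = locus (Q \<epsilon>) \<times> UNIV"
  "form (QxR \<epsilon>) a b = Q_form \<epsilon> (fst a) (fst b) + snd a * snd b"
  "tangent (QxR \<epsilon>) a = tangent (Q \<epsilon>) (fst a) \<times> UNIV"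
  by (simp_all add: Q_def QxR_def)

lemma locus_Q_form: "\<epsilon> \<in> {-1, 0, 1} \<Longrightarrow> \<epsilon> \<noteq> 0 \<Longrightarrow> y \<in> locus (Q \<epsilon>) \<Longrightarrow> Q_form \<epsilon> y y = \<epsilon>"
  by (auto simp: Q_def split: if_splits)

text \<open>For \<epsilon> = -1 tangent vectors are spacelike: tangency equates
  \<open>fst y * fst z\<close> with \<open>snd y \<bullet> snd z\<close>, and Cauchy-Schwarz
  together with (fst y)^2 = 1 + |snd y|^2 gives |snd z|^2 \<le> (fst y)^2 (|snd z|^2 - (fst z)^2).
  In the other cases the form is the Euclidean inner product.\<close>

lemma Q_form_pos:
  assumes e: "\<epsilon> \<in> {-1, 0, 1}" and y: "y \<in> locus (Q \<epsilon>)" and z: "z \<in> tangent (Q \<epsilon>) y" "z \<noteq> 0"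
  shows "Q_form \<epsilon> z z > 0"
proof (cases "\<epsilon> = -1")
  case False
  have "Q_form \<epsilon> z z = z \<bullet> z" using False by (simp add: Q_form_def inner_prod_def)
  then show ?thesis using z by simp
next
  case True
  have y1: "(fst y)\<^sup>2 = 1 + (norm (snd y))\<^sup>2" and y0: "fst y > 0"
    using y True by (auto simp: Q_def Q_form_def power2_eq_square dot_square_norm)
  have z1: "fst y * fst z = snd y \<bullet> snd z" using z True by (simp add: Q_simps Q_form_def)
  have "(fst y)\<^sup>2 * (fst z)\<^sup>2 \<le> (norm (snd y))\<^sup>2 * (norm (snd z))\<^sup>2"
    using Cauchy_Schwarz_ineq[of "snd y" "snd z"] z1
    by (simp flip: power_mult_distrib add: power2_norm_eq_inner)
  then have "(fst y)\<^sup>2 * (fst z)\<^sup>2 \<le> ((fst y)\<^sup>2 - 1) * (norm (snd z))\<^sup>2" using y1 by simp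
  then have *: "(norm (snd z))\<^sup>2 \<le> (fst y)\<^sup>2 * ((norm (snd z))\<^sup>2 - (fst z)\<^sup>2)" by (simp add: algebra_simps)
  have "snd z \<noteq> 0"
  proof
    assume "snd z = 0"
    then have "fst z = 0" using z1 y0 by simp
    then show False using \<open>snd z = 0\<close> z(2) by (simp add: prod_eq_iff)
  qed
  then have "0 < (fst y)\<^sup>2 * ((norm (snd z))\<^sup>2 - (fst z)\<^sup>2)" using * by (smt (verit) norm_eq_zero zero_less_power2)
  then have "0 < (norm (snd z))\<^sup>2 - (fst z)\<^sup>2" using y0 by (simp add: zero_less_mult_iff)
  then show ?thesis using True by (simp add: Q_form_def power2_eq_square[of "fst z"] power2_norm_eq_inner)
qed

lemma ambient_space_Q:
  assumes "\<epsilon> \<in> {-1, 0, 1}"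
  shows "ambient_space (Q \<epsilon> :: (real \<times> (real^'n)) ambient)"
proof -
  interpret b: symmetric_form "Q_form \<epsilon> :: real \<times> (real^'n) \<Rightarrow> _"
    by (simp add: symmetric_form_def Q_form_bilinear Q_form_sym)
  show ?thesis
  proof (intro ambient_space.intro ambient_space_axioms.intro symmetric_form.intro)
    show "bounded_bilinear (form (Q \<epsilon> :: (real \<times> (real^'n)) ambient))" by (simp add: Q_simps Q_form_bilinear)
    show "form (Q \<epsilon>) y z = form (Q \<epsilon>) z y" for y z :: "real \<times> (real^'n)" by (simp add: Q_simps Q_form_sym)
    show "subspace (tangent (Q \<epsilon>) y)" for y :: "real \<times> (real^'n)"
      by (auto simp: Q_simps subspace_def b.simps)
    show "0 < form (Q \<epsilon>) z z" if "y \<in> locus (Q \<epsilon>)" "z \<in> tangent (Q \<epsilon>) y" "z \<noteq> 0" for y z :: "real \<times> (real^'n)"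
      using Q_form_pos[OF assms that] by (simp add: Q_simps)
  qed
qed

lemma ambient_space_QxR:
  assumes "\<epsilon> \<in> {-1, 0, 1}"
  shows "ambient_space (QxR \<epsilon> :: ((real \<times> (real^'n)) \<times> real) ambient)"
proof -
  interpret q: ambient_space "Q \<epsilon> :: (real \<times> (real^'n)) ambient" by (rule ambient_space_Q[OF assms])
  show ?thesis
  proof (intro ambient_space.intro ambient_space_axioms.intro symmetric_form.intro)
    have 1: "bounded_bilinear (\<lambda>a b :: (real \<times> (real^'n)) \<times> real. Q_form \<epsilon> (fst a) (fst b))"
      by (rule bounded_bilinear.comp[OF Q_form_bilinear bounded_linear_fst bounded_linear_fst])
    have 2: "bounded_bilinear (\<lambda>a b :: (real \<times> (real^'n)) \<times> real. snd a * snd b)"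
      by (rule bounded_bilinear.comp[OF bounded_bilinear_mult bounded_linear_snd bounded_linear_snd])
    show "bounded_bilinear (form (QxR \<epsilon> :: ((real \<times> (real^'n)) \<times> real) ambient))"
      using bounded_bilinear_plus[OF 1 2] by (simp add: Q_simps[abs_def])
    show "form (QxR \<epsilon>) y z = form (QxR \<epsilon>) z y" for y z :: "(real \<times> (real^'n)) \<times> real"
      by (simp add: Q_simps Q_form_sym mult.commute)
    show "subspace (tangent (QxR \<epsilon>) y)" if "y \<in> locus (QxR \<epsilon>)" for y :: "(real \<times> (real^'n)) \<times> real"
      using q.tangent_subspace[of "fst y"] that by (auto simp: Q_simps(3,5) intro: subspace_Times)
    show "0 < form (QxR \<epsilon>) z z" if y: "y \<in> locus (QxR \<epsilon>)" and z: "z \<in> tangent (QxR \<epsilon>) y" "z \<noteq> 0"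
      for y z :: "(real \<times> (real^'n)) \<times> real"
    proof -
      have l: "fst y \<in> locus (Q \<epsilon>)" "fst z \<in> tangent (Q \<epsilon>) (fst y)"
        using y z(1) by (auto simp: Q_simps(3,5))
      show ?thesis
      proof (cases "fst z = 0")
        case True
        then have "snd z \<noteq> 0" using z(2) by (simp add: prod_eq_iff)
        then show ?thesis using True q.zero_left by (simp add: Q_simps(1,4) flip: power2_eq_square)
      next
        case False
        then show ?thesis using Q_form_pos[OF assms l] by (simp add: Q_simps(4) add_pos_nonneg)
      qed
    qed
  qed
qed

lemma ddt_tangent: "y \<in> locus (QxR \<epsilon>) \<Longrightarrow> ddt \<in> tangent (QxR \<epsilon>) y"
  by (auto simp: ddt_def Q_simps Q_form_def)

lemma form_ddt: "form (QxR \<epsilon>) z ddt = snd z"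
  by (simp add: ddt_def Q_simps Q_form_def)

text \<open>Differentiate the equation that cuts out the locus: constancy of
  \<open>Q_form \<epsilon> y y\<close>, or of the first coordinate for \<epsilon> = 0.\<close>

lemma derivative_in_tangent_Q:
  assumes e: "\<epsilon> \<in> {-1, 0, 1}" and u: "(u has_derivative u') (at x)" and S: "open S" "x \<in> S"
    and l: "\<And>y. y \<in> S \<Longrightarrow> u y \<in> locus (Q \<epsilon>)"
  shows "u' v \<in> tangent (Q \<epsilon>) (u x)"
proof (cases "\<epsilon> = 0")
  case True
  have "((\<lambda>y. fst (u y)) has_derivative (\<lambda>v. fst (u' v))) (at x)"
    by (rule bounded_linear.has_derivative[OF bounded_linear_fst u])
  then have "((\<lambda>y. 0) has_derivative (\<lambda>v. fst (u' v))) (at x)"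
    by (rule has_derivative_transform_within_open[OF _ S]) (use l True in \<open>auto simp: Q_def\<close>)
  then have "(\<lambda>v. fst (u' v)) = (\<lambda>v. 0)" using has_derivative_unique has_derivative_const by blast
  then show ?thesis using True by (auto simp: Q_simps dest: fun_cong)
next
  case False
  have "((\<lambda>y. Q_form \<epsilon> (u y) (u y)) has_derivative (\<lambda>v. Q_form \<epsilon> (u x) (u' v) + Q_form \<epsilon> (u' v) (u x))) (at x)"
    by (rule bounded_bilinear.FDERIV[OF Q_form_bilinear u u])
  then have "((\<lambda>y. \<epsilon>) has_derivative (\<lambda>v. Q_form \<epsilon> (u x) (u' v) + Q_form \<epsilon> (u' v) (u x))) (at x)"
    by (rule has_derivative_transform_within_open[OF _ S]) (simp add: locus_Q_form[OF e False l])
  then have "(\<lambda>v. Q_form \<epsilon> (u x) (u' v) + Q_form \<epsilon> (u' v) (u x)) = (\<lambda>v. 0)"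
    using has_derivative_unique has_derivative_const by blast
  from fun_cong[OF this, of v] show ?thesis using False by (simp add: Q_simps Q_form_sym[of _ "u' v"])
qed

lemma derivative_in_tangent_QxR:
  assumes e: "\<epsilon> \<in> {-1, 0, 1}" and u: "(u has_derivative u') (at x)" and S: "open S" "x \<in> S"
    and l: "\<And>y. y \<in> S \<Longrightarrow> u y \<in> locus (QxR \<epsilon>)"
  shows "u' v \<in> tangent (QxR \<epsilon>) (u x)"
proof -
  have "((\<lambda>y. fst (u y)) has_derivative (\<lambda>v. fst (u' v))) (at x)"
    by (rule bounded_linear.has_derivative[OF bounded_linear_fst u])
  from derivative_in_tangent_Q[OF e this S, of v] l show ?thesis
    by (auto simp: Q_simps(3,5) mem_Times_iff)
qed

text \<open>Pairing with \<open>ddt\<close> reads off the height component, so the difference of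
  \<open>ddt\<close> and f_* v is normal exactly when f_* v has product dh(w) with every f_* w. In
  other words, T is the gradient of the height function for the induced metric.\<close>

lemma T_field_eqI:
  fixes f :: "'a \<Rightarrow> (real \<times> (real^'n)) \<times> real"
  assumes e: "\<epsilon> \<in> {-1, 0, 1}" and p: "f p \<in> locus (QxR \<epsilon>)"
    and L: "linear (differential c f p)" "inj (differential c f p)"
    and tan: "range (differential c f p) \<subseteq> tangent (QxR \<epsilon>) (f p)"
    and v: "\<And>w. form (QxR \<epsilon>) (differential c f p w) (differential c f p v) = snd (differential c f p w)"
  shows "T_field \<epsilon> c f p = v"
proof -
  interpret ambient_space "QxR \<epsilon> :: ((real \<times> (real^'n)) \<times> real) ambient" by (rule ambient_space_QxR[OF e])
  show ?thesis unfolding T_field_def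
  proof (rule the_equality)
    have "ddt - differential c f p v \<in> normal_space (QxR \<epsilon>) c f p"
      using subspace_diff[OF tangent_subspace[OF p] ddt_tangent[OF p], of "differential c f p v"] tan v
      by (auto simp: normal_space_def diff_right form_ddt)
    then show "\<exists>\<eta>\<in>normal_space (QxR \<epsilon>) c f p. ddt = differential c f p v + \<eta>"
      by (metis add_diff_cancel_left' diff_add_cancel add.commute)
  next
    fix v' assume "\<exists>\<eta>\<in>normal_space (QxR \<epsilon>) c f p. ddt = differential c f p v' + \<eta>"
    then obtain \<eta> where \<eta>: "\<eta> \<in> normal_space (QxR \<epsilon>) c f p" "ddt = differential c f p v' + \<eta>" by blast
    have "form (QxR \<epsilon>) (differential c f p w) (differential c f p v') = snd (differential c f p w)" for w
      using form_ddt[of \<epsilon> "differential c f p w"] \<eta>(1) normal_spaceD(1)[OF \<eta>(1), of w] by (simp add: \<eta>(2) add_right)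
    then have "form (QxR \<epsilon>) (differential c f p (v' - v)) (differential c f p (v' - v)) = 0"
      using v by (simp add: linear_diff[OF L(1)] diff_right diff_left)
    then have "differential c f p (v' - v) = 0" using form_eq_0D[OF p subsetD[OF tan rangeI]] by blast
    then show "v' = v" using injD[OF L(2), of "v' - v" 0] linear_0[OF L(1)] by simp
  qed
qed

lemma T_field:
  fixes f :: "'a \<Rightarrow> (real \<times> (real^'n)) \<times> real"
  assumes e: "\<epsilon> \<in> {-1, 0, 1}" and p: "f p \<in> locus (QxR \<epsilon>)"
    and L: "linear (differential c f p)" "inj (differential c f p)"
    and tan: "range (differential c f p) \<subseteq> tangent (QxR \<epsilon>) (f p)"
  shows "form (QxR \<epsilon>) (differential c f p w) (differential c f p (T_field \<epsilon> c f p)) = snd (differential c f p w)"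
proof -
  interpret ambient_space "QxR \<epsilon> :: ((real \<times> (real^'n)) \<times> real) ambient" by (rule ambient_space_QxR[OF e])
  have l: "linear (\<lambda>w. snd (differential c f p w))"
    by (rule linearI) (simp_all add: linear_add[OF L(1)] linear_scale[OF L(1)])
  have "\<exists>u. \<forall>w. form (QxR \<epsilon>) (differential c f p u) (differential c f p w) = snd (differential c f p w)"
    by (rule representation_exists[OF L l]) (rule form_pos[OF p subsetD[OF tan]])
  then obtain u where u: "\<And>w. form (QxR \<epsilon>) (differential c f p u) (differential c f p w) = snd (differential c f p w)"
    by blast
  have "T_field \<epsilon> c f p = u"
    by (rule T_field_eqI[OF e p L tan]) (use u sym in metis)
  then show ?thesis using u sym by metis
qed

section \<open>Manifolds\<close>

lemma smooth_manifold_chart: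
  assumes M: "smooth_manifold m M" and c: "c \<in> atlas M"
  shows "openin (points M) (fst c)" "open (snd c ` fst c)"
    "homeomorphic_map (subtopology (points M) (fst c)) (top_of_set (snd c ` fst c)) (snd c)"
    "inj_on (snd c) (fst c)" "fst c \<subseteq> topspace (points M)"
proof -
  have "case c of (U, \<phi>) \<Rightarrow> openin (points M) U \<and> open (\<phi> ` U) \<and>
      homeomorphic_map (subtopology (points M) U) (top_of_set (\<phi> ` U)) \<phi>"
    using M c unfolding smooth_manifold_def by blast
  then show 1: "openin (points M) (fst c)" "open (snd c ` fst c)"
    "homeomorphic_map (subtopology (points M) (fst c)) (top_of_set (snd c ` fst c)) (snd c)"
    by (auto simp: case_prod_beta)
  show 2: "fst c \<subseteq> topspace (points M)" using 1(1) by (rule openin_subset)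
  have "inj_on (snd c) (topspace (points M) \<inter> fst c)"
    using homeomorphic_imp_injective_map[OF 1(3)] by simp
  then show "inj_on (snd c) (fst c)" using 2 by (simp add: Int_absorb1)
qed

lemma in_coords_apply: "inj_on (snd c) (fst c) \<Longrightarrow> p \<in> fst c \<Longrightarrow> in_coords c f (snd c p) = f p"
  by (simp add: in_coords_def)

lemma smooth_manifold_open_image:
  assumes M: "smooth_manifold m M" "c \<in> atlas M" and W: "openin (points M) W"
  shows "open (snd c ` (fst c \<inter> W))"
proof -
  note c = smooth_manifold_chart[OF M]
  have "openin (subtopology (points M) (fst c)) (fst c \<inter> W)"
    using W openin_subtopology_Int2[of "points M" W "fst c"] by simp
  then have "openin (top_of_set (snd c ` fst c)) (snd c ` (fst c \<inter> W))"
    using homeomorphic_imp_open_map[OF c(3)] by (simp add: open_map_def)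
  then show ?thesis using c(2) openin_open_trans by blast
qed

lemma smooth_manifold_open_preimage:
  assumes M: "smooth_manifold m M" "c \<in> atlas M" and O: "open O'"
  shows "openin (points M) {p \<in> fst c. snd c p \<in> O'}"
proof -
  note c = smooth_manifold_chart[OF M]
  have "continuous_map (subtopology (points M) (fst c)) (top_of_set (snd c ` fst c)) (snd c)"
    by (rule homeomorphic_imp_continuous_map[OF c(3)])
  then have "openin (subtopology (points M) (fst c))
      {p \<in> topspace (subtopology (points M) (fst c)). snd c p \<in> snd c ` fst c \<inter> O'}"
    by (rule openin_continuous_map_preimage) (simp add: O openin_open_Int)
  moreover have "{p \<in> topspace (subtopology (points M) (fst c)). snd c p \<in> snd c ` fst c \<inter> O'}
      = {p \<in> fst c. snd c p \<in> O'}" using c(5) by auto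
  ultimately show ?thesis using c(1) openin_trans_full by metis
qed

lemma smooth_manifold_transition:
  assumes M: "smooth_manifold m M" "c \<in> atlas M" "d \<in> atlas M"
  shows "smooth_on (snd c ` (fst c \<inter> fst d)) (in_coords c (snd d))" "open (snd c ` (fst c \<inter> fst d))"
proof -
  have "case c of (U, \<phi>) \<Rightarrow> case d of (V, \<psi>) \<Rightarrow> smooth_on (\<phi> ` (U \<inter> V)) (in_coords (U, \<phi>) \<psi>)"
    using M unfolding smooth_manifold_def by blast
  then show "smooth_on (snd c ` (fst c \<inter> fst d)) (in_coords c (snd d))" by (simp add: case_prod_beta)
  show "open (snd c ` (fst c \<inter> fst d))"
    by (rule smooth_manifold_open_image[OF M(1,2) smooth_manifold_chart(1)[OF M(1,3)]])
qed

lemma chart_change: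
  assumes M: "smooth_manifold m M" "c \<in> atlas M" "d \<in> atlas M"
    and p: "p \<in> fst c" "p \<in> fst d" and f: "in_coords d f differentiable (at (snd d p))"
  shows "differential c f p v = differential d f p (differential c (snd d) p v)"
proof -
  note c = smooth_manifold_chart[OF M(1,2)] and d = smooth_manifold_chart[OF M(1,3)]
  note t = smooth_manifold_transition[OF M]
  have pin: "snd c p \<in> snd c ` (fst c \<inter> fst d)" using p by blast
  have tp: "in_coords c (snd d) (snd c p) = snd d p" using in_coords_apply[OF c(4) p(1)] .
  have 1: "(in_coords c (snd d) has_derivative fD (in_coords c (snd d)) (snd c p)) (at (snd c p))"
    by (rule smooth_on_has_derivative[OF t(1) pin])
  have 2: "(in_coords d f has_derivative fD (in_coords d f) (snd d p)) (at (in_coords c (snd d) (snd c p)))"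
    unfolding tp by (rule has_derivative_fD[OF f])
  have 3: "in_coords d f (in_coords c (snd d) y) = in_coords c f y" if "y \<in> snd c ` (fst c \<inter> fst d)" for y
    using that by (auto simp: in_coords_apply[OF c(4)] in_coords_apply[OF d(4)])
  have "(in_coords c f has_derivative (\<lambda>v. fD (in_coords d f) (snd d p) (fD (in_coords c (snd d)) (snd c p) v)))
      (at (snd c p))"
    by (rule has_derivative_transform_within_open[OF has_derivative_compose[OF 1 2] t(2) pin 3])
  from fD_eqI[OF this] show ?thesis unfolding differential_def by simp
qed

lemma differential_self:
  assumes M: "smooth_manifold m M" "c \<in> atlas M" and p: "p \<in> fst c"
  shows "differential c (snd c) p v = v"
proof -
  note c = smooth_manifold_chart[OF M]
  have "fD (in_coords c (snd c)) (snd c p) = fD (\<lambda>y. y) (snd c p)"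
    by (rule fD_cong_open[OF c(2)]) (use p in \<open>auto simp: in_coords_apply[OF c(4)]\<close>)
  then show ?thesis by (simp add: differential_def)
qed

lemma transition_inverse:
  assumes M: "smooth_manifold m M" "c \<in> atlas M" "d \<in> atlas M" and p: "p \<in> fst c" "p \<in> fst d"
  shows "differential d (snd c) p (differential c (snd d) p v) = v"
proof -
  have "snd d p \<in> snd d ` (fst d \<inter> fst c)" using p by blast
  then have "in_coords d (snd c) differentiable (at (snd d p))"
    by (rule smooth_on_differentiable[OF smooth_manifold_transition(1)[OF M(1,3,2)]])
  from chart_change[OF M p this] show ?thesis using differential_self[OF M(1,2) p(1)] by simp
qed

lemma smooth_map_on_in_coords:
  "smooth_map_on M R f \<Longrightarrow> c \<in> atlas M \<Longrightarrow> smooth_on (snd c ` (fst c \<inter> R)) (in_coords c f)"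
  by (simp add: smooth_map_on_def)

lemma smooth_map_on_has_derivative:
  assumes "smooth_map_on M R f" "c \<in> atlas M" "p \<in> fst c" "p \<in> R"
  shows "(in_coords c f has_derivative differential c f p) (at (snd c p))"
  unfolding differential_def
  by (rule smooth_on_has_derivative[OF smooth_map_on_in_coords[OF assms(1,2)]]) (use assms in blast)

lemma smooth_map_on_differentiable:
  "smooth_map_on M R f \<Longrightarrow> c \<in> atlas M \<Longrightarrow> p \<in> fst c \<Longrightarrow> p \<in> R \<Longrightarrow> in_coords c f differentiable (at (snd c p))"
  unfolding differentiable_def by (intro exI) (rule smooth_map_on_has_derivative)

lemma smooth_map_on_linear_differential:
  "smooth_map_on M R f \<Longrightarrow> c \<in> atlas M \<Longrightarrow> p \<in> fst c \<Longrightarrow> p \<in> R \<Longrightarrow> linear (differential c f p)"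
  by (rule has_derivative_linear[OF smooth_map_on_has_derivative])

lemma smooth_map_on_subset: "smooth_map_on M R f \<Longrightarrow> R' \<subseteq> R \<Longrightarrow> smooth_map_on M R' f"
  unfolding smooth_map_on_def by (blast intro: smooth_on_subset)

lemma inj_differential_chart_change:
  assumes M: "smooth_manifold m M" "c \<in> atlas M" "d \<in> atlas M" and p: "p \<in> fst c" "p \<in> fst d" "p \<in> R"
    and f: "smooth_map_on M R f" and inj: "inj (differential d f p)"
  shows "inj (differential c f p)"
proof (rule injI)
  fix v w assume "differential c f p v = differential c f p w"
  then have "differential c (snd d) p v = differential c (snd d) p w"
    using chart_change[OF M p(1,2) smooth_map_on_differentiable[OF f M(3) p(2,3)]] injD[OF inj] by simp
  then show "v = w" using transition_inverse[OF M p(1,2)] by metis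
qed

text \<open>In one chart injectivity of the differential is an open condition. The definition asks
  for it in every chart, which the chain rule for chart changes deduces from a single one.\<close>

lemma openin_regular_points:
  fixes f :: "'a \<Rightarrow> 'v::euclidean_space" and M :: "('a, 'b::real_normed_vector) manifold"
  assumes M: "smooth_manifold m M" and f: "smooth_map_on M (topspace (points M)) f"
  shows "openin (points M) (regular_points M f)"
proof -
  obtain B :: "'b set" where B: "finite B" "independent B" "span B = UNIV"
    using M unfolding smooth_manifold_def by blast
  define O' where "O' c = {y \<in> snd c ` fst c. inj (fD (in_coords c f) y)}" for c :: "('a, 'b) chart"
  have "regular_points M f = (\<Union>c\<in>atlas M. {p \<in> fst c. snd c p \<in> O' c})"
  proof (intro equalityI subsetI)
    fix p assume p: "p \<in> regular_points M f"
    then have "p \<in> \<Union>(fst ` atlas M)" using M by (simp add: regular_points_def smooth_manifold_def)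
    then obtain c where c: "c \<in> atlas M" "p \<in> fst c" by blast
    then have "inj (differential c f p)" using p by (simp add: regular_points_def)
    then have "snd c p \<in> O' c" unfolding O'_def differential_def[abs_def] using c(2) by simp
    with c show "p \<in> (\<Union>c\<in>atlas M. {p \<in> fst c. snd c p \<in> O' c})" by blast
  next
    fix p assume "p \<in> (\<Union>c\<in>atlas M. {p \<in> fst c. snd c p \<in> O' c})"
    then obtain c where c: "c \<in> atlas M" "p \<in> fst c" "inj (differential c f p)"
      unfolding O'_def differential_def[abs_def] by blast
    then have "p \<in> topspace (points M)" using smooth_manifold_chart(5)[OF M c(1)] by blast
    moreover have "inj (differential d f p)" if "d \<in> atlas M" "p \<in> fst d" for d
      by (rule inj_differential_chart_change[OF M that(1) c(1) that(2) c(2) calculation f c(3)])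
    ultimately show "p \<in> regular_points M f" by (simp add: regular_points_def)
  qed
  moreover have "openin (points M) {p \<in> fst c. snd c p \<in> O' c}" if c: "c \<in> atlas M" for c
  proof (rule smooth_manifold_open_preimage[OF M c])
    have "fst c \<inter> topspace (points M) = fst c" using smooth_manifold_chart(5)[OF M c] by blast
    then have s: "smooth_on (snd c ` fst c) (in_coords c f)"
      using smooth_map_on_in_coords[OF f c] by simp
    show "open (O' c)" unfolding O'_def
      by (rule open_Collect_inj_family[OF smooth_manifold_chart(2)[OF M c] B smooth_on_linear_fD[OF s]
            smooth_on_continuous[OF smooth_on_fD[OF s]]])
  qed
  ultimately show ?thesis by auto
qed

text \<open>Compatibility between charts is the chain rule, and definiteness comes from injectivity
  of the differential together with positivity on tangent spaces.\<close>

lemma (in ambient_space) isometric_immersion_on_induced_metric: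
  fixes f :: "'a \<Rightarrow> 'v" and M :: "('a, 'e::real_normed_vector) manifold"
  assumes M: "smooth_manifold m M" and R: "openin (points M) R" and f: "smooth_map_on M R f"
    and l: "f ` R \<subseteq> locus S"
    and tan: "\<And>c p. c \<in> atlas M \<Longrightarrow> p \<in> fst c \<inter> R \<Longrightarrow> range (differential c f p) \<subseteq> tangent S (f p)"
    and inj: "\<And>c p. c \<in> atlas M \<Longrightarrow> p \<in> fst c \<inter> R \<Longrightarrow> inj (differential c f p)"
  shows "isometric_immersion_on M R (induced_metric S f) S f"
proof -
  have lin: "linear (differential c f p)" if "c \<in> atlas M" "p \<in> fst c \<inter> R" for c p
    using smooth_map_on_linear_differential[OF f] that by blast
  have "riemannian_metric_on M R (induced_metric S f)"
    unfolding riemannian_metric_on_def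
  proof (intro conjI ballI allI impI)
    fix c v w assume c: "c \<in> atlas M"
    note cc = smooth_manifold_chart[OF M c] and s = smooth_map_on_in_coords[OF f c]
    have o: "open (snd c ` (fst c \<inter> R))" by (rule smooth_manifold_open_image[OF M c R])
    show "smooth_on (snd c ` (fst c \<inter> R)) (in_coords c (\<lambda>p. induced_metric S f c p v w))"
    proof (rule smooth_on_cong[OF o _ smooth_on_bilinear[OF o bounded smooth_on_fD[OF s, of v] smooth_on_fD[OF s, of w]]])
      fix y assume "y \<in> snd c ` (fst c \<inter> R)"
      then show "form S (fD (in_coords c f) y v) (fD (in_coords c f) y w)
          = in_coords c (\<lambda>p. induced_metric S f c p v w) y"
        by (auto simp: in_coords_apply[OF cc(4)] induced_metric_def differential_def)
    qed
  next
    fix c p assume c: "c \<in> atlas M" and p: "p \<in> fst c \<inter> R"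
    note L = lin[OF c p]
    show "bilinear (induced_metric S f c p)"
      unfolding bilinear_def induced_metric_def
      by (auto intro!: linearI simp: linear_add[OF L] linear_scale[OF L] simps)
    fix v w
    show "induced_metric S f c p v w = induced_metric S f c p w v"
      by (simp add: induced_metric_def sym)
  next
    fix c p v assume c: "c \<in> atlas M" and p: "p \<in> fst c \<inter> R" and v: "v \<noteq> (0::'e)"
    have "differential c f p v \<noteq> 0"
      using injD[OF inj[OF c p], of v 0] linear_0[OF lin[OF c p]] v by auto
    moreover have "f p \<in> locus S" using p l by blast
    ultimately show "induced_metric S f c p v v > 0"
      unfolding induced_metric_def using form_pos[OF _ subsetD[OF tan[OF c p] rangeI]] by blast
  next
    fix c d p v w assume c: "c \<in> atlas M" "d \<in> atlas M" and p: "p \<in> fst c \<inter> fst d \<inter> R"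
    have "in_coords d f differentiable (at (snd d p))"
      using smooth_map_on_differentiable[OF f c(2)] p by blast
    note chart_change[OF M c _ _ this]
    then show "induced_metric S f c p v w
        = induced_metric S f d p (differential c (snd d) p v) (differential c (snd d) p w)"
      unfolding induced_metric_def using p by simp
  qed
  then show ?thesis
    using R l f inj unfolding isometric_immersion_on_def by (simp add: induced_metric_def)
qed

lemma tangent_QxR_differential:
  assumes e: "\<epsilon> \<in> {-1, 0, 1}" and M: "smooth_manifold m M" "c \<in> atlas M" and R: "openin (points M) R"
    and f: "smooth_map_on M R f" and l: "f ` R \<subseteq> locus (QxR \<epsilon>)" and p: "p \<in> fst c \<inter> R"
  shows "range (differential c f p) \<subseteq> tangent (QxR \<epsilon>) (f p)"
proof -
  note cc = smooth_manifold_chart[OF M]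
  have "differential c f p v \<in> tangent (QxR \<epsilon>) (in_coords c f (snd c p))" for v
    by (rule derivative_in_tangent_QxR[OF e smooth_map_on_has_derivative[OF f M(2)] smooth_manifold_open_image[OF M R]])
      (use p l in \<open>auto simp: in_coords_apply[OF cc(4)]\<close>)
  moreover have "in_coords c f (snd c p) = f p" using in_coords_apply[OF cc(4)] p by blast
  ultimately show ?thesis by (simp add: image_subset_iff)
qed

lemma tangent_Q_differential:
  assumes e: "\<epsilon> \<in> {-1, 0, 1}" and M: "smooth_manifold m M" "c \<in> atlas M" and R: "openin (points M) R"
    and f: "smooth_map_on M R f" and l: "f ` R \<subseteq> locus (Q \<epsilon>)" and p: "p \<in> fst c \<inter> R"
  shows "range (differential c f p) \<subseteq> tangent (Q \<epsilon>) (f p)"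
proof -
  note cc = smooth_manifold_chart[OF M]
  have "differential c f p v \<in> tangent (Q \<epsilon>) (in_coords c f (snd c p))" for v
    by (rule derivative_in_tangent_Q[OF e smooth_map_on_has_derivative[OF f M(2)] smooth_manifold_open_image[OF M R]])
      (use p l in \<open>auto simp: in_coords_apply[OF cc(4)]\<close>)
  moreover have "in_coords c f (snd c p) = f p" using in_coords_apply[OF cc(4)] p by blast
  ultimately show ?thesis by (simp add: image_subset_iff)
qed

subsection \<open>The product of a manifold with an interval\<close>

lemma second_countable_prod_topology:
  assumes "second_countable X" "second_countable Y"
  shows "second_countable (prod_topology X Y)"
proof -
  obtain A B where A: "countable A" "\<And>V. V \<in> A \<Longrightarrow> openin X V"
    "\<And>U x. openin X U \<Longrightarrow> x \<in> U \<Longrightarrow> \<exists>V\<in>A. x \<in> V \<and> V \<subseteq> U"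
    and B: "countable B" "\<And>V. V \<in> B \<Longrightarrow> openin Y V"
    "\<And>U x. openin Y U \<Longrightarrow> x \<in> U \<Longrightarrow> \<exists>V\<in>B. x \<in> V \<and> V \<subseteq> U"
    using assms unfolding second_countable_def by metis
  show ?thesis unfolding second_countable_def
  proof (intro exI[of _ "(\<lambda>(U, V). U \<times> V) ` (A \<times> B)"] conjI ballI allI impI)
    show "countable ((\<lambda>(U, V). U \<times> V) ` (A \<times> B))" using A(1) B(1) by simp
    show "openin (prod_topology X Y) V" if "V \<in> (\<lambda>(U, V). U \<times> V) ` (A \<times> B)" for V
      using that A(2) B(2) by (auto simp: openin_prod_Times_iff)
    fix W z assume "openin (prod_topology X Y) W \<and> z \<in> W"
    then obtain U V where UV: "openin X U" "openin Y V" "fst z \<in> U" "snd z \<in> V" "U \<times> V \<subseteq> W"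
      unfolding openin_prod_topology_alt by (metis prod.collapse)
    obtain U' V' where "U' \<in> A" "fst z \<in> U'" "U' \<subseteq> U" "V' \<in> B" "snd z \<in> V'" "V' \<subseteq> V"
      using A(3)[OF UV(1,3)] B(3)[OF UV(2,4)] by blast
    then show "\<exists>V\<in>(\<lambda>(U, V). U \<times> V) ` (A \<times> B). z \<in> V \<and> V \<subseteq> W"
      using UV(5) by (intro bexI[of _ "U' \<times> V'"]) (auto simp: mem_Times_iff)
  qed
qed

lemma second_countable_top_of_set: "second_countable (top_of_set (S :: 'a::second_countable_topology set))"
proof (rule second_countable_subtopology)
  obtain B :: "'a set set" where B: "countable B" "topological_basis B"
    using ex_countable_basis by blast
  show "second_countable (euclidean :: 'a topology)"
    unfolding second_countable_def
  proof (intro exI[of _ B] conjI ballI allI impI)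
    show "countable B" by (rule B)
    show "openin euclidean V" if "V \<in> B" for V using topological_basis_open[OF B(2) that] by simp
    fix U x assume "openin euclidean U \<and> x \<in> (U :: 'a set)"
    then have U: "open U" "x \<in> U" by auto
    obtain V where "V \<in> B" "x \<in> V" "V \<subseteq> U" by (rule topological_basisE[OF B(2) U])
    then show "\<exists>V\<in>B. x \<in> V \<and> V \<subseteq> U" by blast
  qed
qed

lemma in_coords_product_chart:
  assumes "inj_on \<phi> U" "y \<in> \<phi> ` U" "t \<in> I"
  shows "in_coords (U \<times> I, map_prod \<phi> id) f (y, t) = f (inv_into U \<phi> y, t)"
proof -
  have inj: "inj_on (map_prod \<phi> id) (U \<times> I)" using assms(1) by (simp add: map_prod_inj_on)
  have "map_prod \<phi> id (inv_into U \<phi> y, t) = (y, t)" using assms(2) by (simp add: f_inv_into_f)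
  moreover have "(inv_into U \<phi> y, t) \<in> U \<times> I" using assms(2,3) by (auto intro: inv_into_into)
  ultimately show ?thesis using in_coords_apply[of "(U \<times> I, map_prod \<phi> id)" "(inv_into U \<phi> y, t)" f] inj by simp
qed

lemma smooth_manifold_product_interval:
  fixes N :: "('a, 'd::real_normed_vector) manifold"
  assumes N: "smooth_manifold d N" and I: "open_interval I"
  shows "smooth_manifold (Suc d) (product_interval N I)"
  unfolding smooth_manifold_def
proof (intro conjI)
  have oI: "open I" using I by (simp add: open_interval_def)
  obtain B :: "'d set" where B: "finite B" "independent B" "span B = UNIV" "card B = d"
    using N unfolding smooth_manifold_def by blast
  define e where "e = (\<lambda>b::'d. (b, 0::real))"
  have le: "linear e" by (rule linearI) (auto simp: e_def)
  have ie: "inj e" by (auto simp: e_def inj_def)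
  have sp: "span (e ` B) = range e" using linear_span_image[OF le, of B] B(3) by simp
  have nin: "(0, 1) \<notin> span (e ` B)" unfolding sp by (auto simp: e_def)
  show "\<exists>B::('d \<times> real) set. finite B \<and> independent B \<and> span B = UNIV \<and> card B = Suc d"
  proof (intro exI[of _ "insert (0, 1) (e ` B)"] conjI)
    show "finite (insert (0, 1) (e ` B))" using B by simp
    have "independent (e ` B)"
      by (rule linear_independent_injective_image[OF le B(2)]) (rule inj_on_subset[OF ie], simp)
    then show "independent (insert (0, 1) (e ` B))" using nin by (rule independent_insertI[rotated])
    show "span (insert (0, 1) (e ` B)) = UNIV"
    proof (intro equalityI subsetI)
      fix z :: "'d \<times> real"
      have "z - snd z *\<^sub>R (0, 1) \<in> span (e ` B)" unfolding sp by (auto simp: e_def prod_eq_iff image_iff)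
      then show "z \<in> span (insert (0, 1) (e ` B))" unfolding span_insert by blast
    qed simp
    have "(0, 1) \<notin> e ` B" by (auto simp: e_def)
    then show "card (insert (0, 1) (e ` B)) = Suc d"
      using B card_image[OF inj_on_subset[OF ie], of B] by simp
  qed
  show "Hausdorff_space (points (product_interval N I))"
    using N by (simp add: product_interval_def smooth_manifold_def Hausdorff_space_prod_topology Hausdorff_space_subtopology)
  show "second_countable (points (product_interval N I))"
    using N by (simp add: product_interval_def smooth_manifold_def second_countable_prod_topology second_countable_top_of_set)
  have "\<Union>(fst ` atlas N) = topspace (points N)" using N by (simp add: smooth_manifold_def)
  then show "\<Union>(fst ` atlas (product_interval N I)) = topspace (points (product_interval N I))"
    by (force simp: product_interval_def)
  show "\<forall>(U, \<phi>)\<in>atlas (product_interval N I). openin (points (product_interval N I)) U \<and> open (\<phi> ` U) \<and>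
        homeomorphic_map (subtopology (points (product_interval N I)) U) (top_of_set (\<phi> ` U)) \<phi>"
  proof (clarsimp simp: product_interval_def)
    fix U \<phi> assume "(U, \<phi>) \<in> atlas N"
    note c = smooth_manifold_chart[OF N this, simplified]
    have "map_prod \<phi> id ` (U \<times> I) = \<phi> ` U \<times> I" by (rule map_prod_surj_on) simp_all
    moreover have "homeomorphic_map (prod_topology (subtopology (points N) U) (top_of_set I))
        (prod_topology (top_of_set (\<phi> ` U)) (top_of_set I)) (map_prod \<phi> id)"
    proof -
      obtain \<psi> where "homeomorphic_maps (subtopology (points N) U) (top_of_set (\<phi> ` U)) \<phi> \<psi>"
        using c(3) homeomorphic_map_maps by blast
      moreover have "homeomorphic_maps (top_of_set I) (top_of_set I) id id"
        by (simp add: homeomorphic_maps_id)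
      ultimately have "homeomorphic_maps (prod_topology (subtopology (points N) U) (top_of_set I))
        (prod_topology (top_of_set (\<phi> ` U)) (top_of_set I)) (\<lambda>(x, y). (\<phi> x, id y)) (\<lambda>(x, y). (\<psi> x, id y))"
        unfolding homeomorphic_maps_prod by blast
      then show ?thesis unfolding map_prod_def using homeomorphic_map_maps by blast
    qed
    moreover have "subtopology (prod_topology (points N) (top_of_set I)) (U \<times> I)
        = prod_topology (subtopology (points N) U) (top_of_set I)"
      by (simp add: subtopology_Times subtopology_subtopology)
    moreover have "prod_topology (top_of_set (\<phi> ` U)) (top_of_set I) = top_of_set (\<phi> ` U \<times> I)"
      using subtopology_Times[of euclidean euclidean "\<phi> ` U" I] by (simp only: prod_topology_euclidean)
    ultimately show "openin (prod_topology (points N) (top_of_set I)) (U \<times> I) \<and> open (map_prod \<phi> id ` (U \<times> I)) \<and>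
        homeomorphic_map (subtopology (prod_topology (points N) (top_of_set I)) (U \<times> I))
          (top_of_set (map_prod \<phi> id ` (U \<times> I))) (map_prod \<phi> id)"
      using c oI by (simp add: openin_prod_Times_iff open_Times)
  qed
  show "\<forall>(U, \<phi>)\<in>atlas (product_interval N I). \<forall>(V, \<psi>)\<in>atlas (product_interval N I).
      smooth_on (\<phi> ` (U \<inter> V)) (in_coords (U, \<phi>) \<psi>)"
  proof (clarsimp simp: product_interval_def)
    fix U \<phi> V \<psi> assume c: "(U, \<phi>) \<in> atlas N" and d: "(V, \<psi>) \<in> atlas N"
    note cU = smooth_manifold_chart[OF N c, simplified]
    note t = smooth_manifold_transition[OF N c d, simplified]
    let ?S = "\<phi> ` (U \<inter> V)"
    have "U \<times> I \<inter> V \<times> I = (U \<inter> V) \<times> I" by auto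
    then have eq: "map_prod \<phi> id ` (U \<times> I \<inter> V \<times> I) = ?S \<times> I" by (simp add: map_prod_surj_on)
    have oS: "open (?S \<times> I)" using t(2) oI by (rule open_Times)
    have "smooth_on (?S \<times> I) (\<lambda>z. (in_coords (U, \<phi>) \<psi> (fst z), snd z))"
      by (intro smooth_on_Pair[OF oS] smooth_on_linear[OF bounded_linear_snd]
          smooth_on_compose_linear[OF oS t(2) bounded_linear_fst _ t(1)]) auto
    then show "smooth_on (map_prod \<phi> id ` (U \<times> I \<inter> V \<times> I)) (in_coords (U \<times> I, map_prod \<phi> id) (map_prod \<psi> id))"
      unfolding eq
    proof (rule smooth_on_cong[OF oS, rotated])
      fix z assume z: "z \<in> ?S \<times> I"
      then have "in_coords (U \<times> I, map_prod \<phi> id) (map_prod \<psi> id) (fst z, snd z) = map_prod \<psi> id (inv_into U \<phi> (fst z), snd z)"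
        by (intro in_coords_product_chart cU) auto
      then show "(in_coords (U, \<phi>) \<psi> (fst z), snd z) = in_coords (U \<times> I, map_prod \<phi> id) (map_prod \<psi> id) z"
        by (simp add: in_coords_def)
    qed
  qed
qed

section \<open>The constructed map is in class A\<close>

text \<open>Both ranges have dimension \<open>card B\<close>. This upgrades an inclusion between two
  injective images of the model space to equality.\<close>

lemma finite_basis_range_eq:
  fixes L K :: "'d::real_vector \<Rightarrow> 'c::euclidean_space" and B :: "'d set"
  assumes B: "finite B" "independent B" "span B = UNIV" and L: "linear L" "inj L" and K: "linear K" "inj K"
    and sub: "range L \<subseteq> range K"
  shows "range L = range K"
proof -
  have dim: "dim (range L) = card B" if L: "linear L" "inj L" for L :: "'d \<Rightarrow> 'c"
  proof -
    have "range L = span (L ` B)" using linear_span_image[OF L(1), of B] B(3) by simp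
    moreover have "independent (L ` B)"
      by (rule linear_independent_injective_image[OF L(1) B(2)]) (rule inj_on_subset[OF L(2)], simp)
    moreover have "card (L ` B) = card B" by (rule card_image) (rule inj_on_subset[OF L(2)], simp)
    ultimately show ?thesis by (simp add: dim_eq_card_independent)
  qed
  show ?thesis
    by (rule subspace_dim_equal[OF linear_subspace_image[OF L(1) subspace_UNIV] linear_subspace_image[OF K(1) subspace_UNIV] sub])
      (simp add: dim[OF L] dim[OF K])
qed

section \<open>The two sheets of the hyperboloid\<close>

lemma hyperboloid_norm:
  assumes "Q_form (-1) y y = -1"
  shows "norm (snd y) < \<bar>fst y\<bar>"
proof -
  have "(norm (snd y))\<^sup>2 < (fst y)\<^sup>2"
    using assms by (simp add: Q_form_def power2_eq_square[of "fst y"] power2_norm_eq_inner)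
  then show ?thesis by (intro power_less_imp_less_base[of "norm (snd y)" 2]) simp_all
qed

text \<open>At each of the two points the time component strictly dominates the norm of the space
  component, so Cauchy-Schwarz bounds the spatial part of the product strictly by its temporal
  part.\<close>

lemma hyperboloid_product_neg:
  assumes "Q_form (-1) y y = -1" "fst y > 0" "Q_form (-1) z z = -1" "fst z > 0"
  shows "Q_form (-1) y z < 0"
proof -
  have "snd y \<bullet> snd z \<le> norm (snd y) * norm (snd z)" by (rule norm_cauchy_schwarz)
  also have "\<dots> < fst y * fst z"
    using hyperboloid_norm[OF assms(1)] hyperboloid_norm[OF assms(3)] assms(2,4)
    by (intro mult_strict_mono) auto
  finally show ?thesis by (simp add: Q_form_def)
qed

text \<open>Otherwise \<open>- z\<close> would lie on the upper sheet, and its product with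
  \<open>y\<close> would be negative as well.\<close>

lemma hyperboloid_future:
  assumes "Q_form (-1) y y = -1" "fst y > 0" "Q_form (-1) z z = -1" "Q_form (-1) y z < 0"
  shows "fst z > 0"
proof (rule ccontr)
  assume "\<not> fst z > 0"
  moreover have "fst z \<noteq> 0" using hyperboloid_norm[OF assms(3)] norm_ge_zero[of "snd z"] by force
  ultimately have "fst (- z) > 0" by simp
  moreover have "Q_form (-1) (- z) (- z) = -1" using assms(3) by (simp add: Q_form_def)
  ultimately have "Q_form (-1) y (- z) < 0" by (intro hyperboloid_product_neg assms)
  then show False using assms(4) by (simp add: Q_form_def)
qed

lemma linear_fD_fD:
  assumes S: "open S" and f: "smooth_on S f" and q: "q \<in> S"
  shows "linear (\<lambda>w. fD (\<lambda>y. fD f y w) q u)"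
proof (rule linearI)
  have d: "((\<lambda>y. fD f y v) has_derivative fD (\<lambda>y. fD f y v) q) (at q)" for v
    by (rule smooth_on_has_derivative[OF smooth_on_fD[OF f] q])
  fix v w r
  have "((\<lambda>y. fD f y (v + w)) has_derivative (\<lambda>u. fD (\<lambda>y. fD f y v) q u + fD (\<lambda>y. fD f y w) q u)) (at q)"
    by (rule has_derivative_transform_within_open[OF has_derivative_add[OF d d] S q])
      (simp add: linear_add[OF smooth_on_linear_fD[OF f]])
  from fD_eqI[OF this]
  show "fD (\<lambda>y. fD f y (v + w)) q u = fD (\<lambda>y. fD f y v) q u + fD (\<lambda>y. fD f y w) q u" by simp
  have "((\<lambda>y. fD f y (r *\<^sub>R v)) has_derivative (\<lambda>u. r *\<^sub>R fD (\<lambda>y. fD f y v) q u)) (at q)"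
    by (rule has_derivative_transform_within_open[OF has_derivative_scaleR_right[OF d] S q])
      (simp add: linear_scale[OF smooth_on_linear_fD[OF f]])
  from fD_eqI[OF this]
  show "fD (\<lambda>y. fD f y (r *\<^sub>R v)) q u = r *\<^sub>R fD (\<lambda>y. fD f y v) q u" by simp
qed

lemma has_derivative_separated_sum:
  assumes A: "\<And>i. i \<in> K \<Longrightarrow> (A i has_derivative A' i) (at y)"
    and b: "\<And>i. i \<in> K \<Longrightarrow> (b i has_real_derivative b' i) (at t)"
  shows "((\<lambda>z. \<Sum>i\<in>K. b i (snd z) *\<^sub>R A i (fst z)) has_derivative
    (\<lambda>w. \<Sum>i\<in>K. b i t *\<^sub>R A' i (fst w) + (snd w * b' i) *\<^sub>R A i y)) (at (y, t))"
proof (rule has_derivative_sum)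
  fix i assume i: "i \<in> K"
  have "(b i has_derivative (\<lambda>h. h * b' i)) (at (snd (y, t)))"
    using b[OF i] by (simp add: has_field_derivative_def mult_commute_abs)
  from has_derivative_compose[OF has_derivative_snd[OF has_derivative_ident] this]
  have 1: "((\<lambda>z. b i (snd z)) has_derivative (\<lambda>w. snd w * b' i)) (at (y, t))" by simp
  have "(A i has_derivative A' i) (at (fst (y, t)))" using A[OF i] by simp
  from has_derivative_compose[OF has_derivative_fst[OF has_derivative_ident] this]
  have 2: "((\<lambda>z. A i (fst z)) has_derivative (\<lambda>w. A' i (fst w))) (at (y, t))" by simp
  from has_derivative_scaleR[OF 1 2]
  show "((\<lambda>z. b i (snd z) *\<^sub>R A i (fst z)) has_derivative
      (\<lambda>w. b i t *\<^sub>R A' i (fst w) + (snd w * b' i) *\<^sub>R A i y)) (at (y, t))" by simp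
qed

text \<open>Parallelism removes the normal component of the flat derivative, and tangency to
  \<open>S\<close> then leaves only the image of the differential.\<close>

lemma (in ambient_space) parallel_derivative_in_range:
  fixes f :: "'a \<Rightarrow> 'v"
  assumes M: "smooth_manifold m M" "c \<in> atlas M" and f: "smooth_map_on M (topspace (points M)) f"
    and p: "p \<in> fst c" "f p \<in> locus S" and tan: "range (differential c f p) \<subseteq> tangent S (f p)"
    and par: "normal_derivative S c f \<xi> p v = 0" and dt: "differential c \<xi> p v \<in> tangent S (f p)"
  shows "differential c \<xi> p v \<in> range (differential c f p)"
proof (rule double_orthogonal_in_range[OF p(2) _ tan dt])
  show "linear (differential c f p)"
    using smooth_map_on_linear_differential[OF f M(2) p(1)] smooth_manifold_chart(5)[OF M] p by blast
  fix \<zeta> assume "\<zeta> \<in> tangent S (f p)" "\<And>v. form S (differential c f p v) \<zeta> = 0"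
  then have "\<zeta> \<in> normal_space S c f p" by (simp add: normal_space_def)
  then show "form S (differential c \<xi> p v) \<zeta> = 0"
    using par normal_part_eq_0_iff[of f p c, OF p(2)] unfolding normal_derivative_def by blast
qed

text \<open>For \<epsilon> \<noteq> 0 the field \<open>\<xi>\<close> is orthogonal to the position
  vector \<open>g\<close>. Differentiating this yields the product of \<open>g\<close> with the
  derivative of \<open>\<xi>\<close>, since the other term, the product of \<open>\<xi>\<close> with
  a derivative of \<open>g\<close>, vanishes by normality. For \<epsilon> = 0 the field takes values
  in a fixed linear subspace, and so do its derivatives.\<close>

lemma normal_field_derivative_tangent:
  fixes g :: "'a \<Rightarrow> real \<times> (real^'n)" and \<xi> :: "'a \<Rightarrow> real \<times> (real^'n)"
  assumes e: "\<epsilon> \<in> {-1, 0, 1}" and M: "smooth_manifold m M" "c \<in> atlas M"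
    and g: "smooth_map_on M (topspace (points M)) g" "g ` topspace (points M) \<subseteq> locus (Q \<epsilon>)"
    and x: "smooth_map_on M (topspace (points M)) \<xi>"
      "\<And>q. q \<in> fst c \<Longrightarrow> \<xi> q \<in> normal_space (Q \<epsilon>) c g q" and p: "p \<in> fst c"
  shows "differential c \<xi> p v \<in> tangent (Q \<epsilon>) (g p)"
proof -
  interpret ambient_space "Q \<epsilon> :: (real \<times> (real^'n)) ambient" by (rule ambient_space_Q[OF e])
  note cc = smooth_manifold_chart[OF M]
  have pt: "p \<in> topspace (points M)" using p cc(5) by blast
  have dx: "(in_coords c \<xi> has_derivative differential c \<xi> p) (at (snd c p))"
    by (rule smooth_map_on_has_derivative[OF x(1) M(2) p pt])
  have dg: "(in_coords c g has_derivative differential c g p) (at (snd c p))"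
    by (rule smooth_map_on_has_derivative[OF g(1) M(2) p pt])
  have S: "open (snd c ` fst c)" "snd c p \<in> snd c ` fst c" using cc(2) p by auto
  have tang: "\<xi> q \<in> tangent (Q \<epsilon>) (g q)" if "q \<in> fst c" for q using normal_spaceD(2)[OF x(2)[OF that]] .
  show ?thesis
  proof (cases "\<epsilon> = 0")
    case True
    have "(in_coords c \<xi> y) \<in> locus (Q 0)" if "y \<in> snd c ` fst c" for y
      using that tang True by (auto simp: in_coords_apply[OF cc(4)] Q_def)
    then have "differential c \<xi> p v \<in> tangent (Q 0) (in_coords c \<xi> (snd c p))"
      by (intro derivative_in_tangent_Q[OF _ dx S]) auto
    then show ?thesis using True by (simp add: Q_simps)
  next
    case False
    have "((\<lambda>y. Q_form \<epsilon> (in_coords c g y) (in_coords c \<xi> y)) has_derivative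
        (\<lambda>v. Q_form \<epsilon> (in_coords c g (snd c p)) (differential c \<xi> p v)
          + Q_form \<epsilon> (differential c g p v) (in_coords c \<xi> (snd c p)))) (at (snd c p))"
      by (rule bounded_bilinear.FDERIV[OF Q_form_bilinear dg dx])
    then have "((\<lambda>y. 0) has_derivative (\<lambda>v. Q_form \<epsilon> (in_coords c g (snd c p)) (differential c \<xi> p v)
          + Q_form \<epsilon> (differential c g p v) (in_coords c \<xi> (snd c p)))) (at (snd c p))"
      by (rule has_derivative_transform_within_open[OF _ S])
        (use tang False in \<open>auto simp: in_coords_apply[OF cc(4)] Q_simps\<close>)
    from has_derivative_unique[OF this has_derivative_const]
    have "Q_form \<epsilon> (in_coords c g (snd c p)) (differential c \<xi> p v)
          + Q_form \<epsilon> (differential c g p v) (in_coords c \<xi> (snd c p)) = 0" by (rule fun_cong)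
    moreover have "Q_form \<epsilon> (differential c g p v) (\<xi> p) = 0"
      using normal_spaceD(1)[OF x(2)[OF p]] by (simp add: Q_simps)
    ultimately show ?thesis using False by (simp add: in_coords_apply[OF cc(4) p] Q_simps)
  qed
qed

section \<open>The constructed map in product charts\<close>

locale construction =
  fixes \<epsilon> :: real and d :: nat and N :: "('a, 'd::real_normed_vector) manifold" and H :: "('a, 'd) metric"
    and g :: "'a \<Rightarrow> real \<times> (real^'n)" and k :: nat and \<xi> :: "nat \<Rightarrow> 'a \<Rightarrow> real \<times> (real^'n)"
    and I :: "real set" and \<alpha> :: "nat \<Rightarrow> real \<Rightarrow> real"
  assumes eps: "\<epsilon> \<in> {-1, 0, 1}" and data: "construction_data \<epsilon> d N H g k \<xi> I \<alpha>"
begin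

sublocale Q: ambient_space "Q \<epsilon> :: (real \<times> (real^'n)) ambient" by (rule ambient_space_Q[OF eps])
sublocale QxR: ambient_space "QxR \<epsilon> :: ((real \<times> (real^'n)) \<times> real) ambient" by (rule ambient_space_QxR[OF eps])

text \<open>The immersion \<open>g\<close> counts as the field with index 0, and \<open>a 0\<close>
  is the constant 1 for \<epsilon> = 0. With this convention the horizontal part of the map is the
  sum of the terms \<open>a i s *\<^sub>R X i x\<close> for all three curvatures.\<close>

definition X :: "nat \<Rightarrow> 'a \<Rightarrow> real \<times> (real^'n)" where "X i = (if i = 0 then g else \<xi> i)"

definition a :: "nat \<Rightarrow> real \<Rightarrow> real" where "a i = (if i = 0 \<and> \<epsilon> = 0 then (\<lambda>s. 1) else \<alpha> i)"

abbreviation F where "F \<equiv> constructed_map \<epsilon> g k \<xi> \<alpha>"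

definition pc :: "('a, 'd) chart \<Rightarrow> ('a \<times> real, 'd \<times> real) chart" where
  "pc c = (fst c \<times> I, map_prod (snd c) id)"

lemma base_manifold: "smooth_manifold d N" and open_I: "open I" and interval_I: "open_interval I"
  and immersion_g: "isometric_immersion_on N (topspace (points N)) H (Q \<epsilon>) g"
  and normal_fields: "orthonormal_parallel_normal_fields N (Q \<epsilon>) g k \<xi>"
  and admissible: "admissible_curve \<epsilon> k I \<alpha>"
  using data by (auto simp: construction_data_def open_interval_def)

lemma g_smooth: "smooth_map_on N (topspace (points N)) g"
  and g_locus: "g ` topspace (points N) \<subseteq> locus (Q \<epsilon>)"
  and g_inj: "c \<in> atlas N \<Longrightarrow> x \<in> fst c \<Longrightarrow> inj (differential c g x)"
  using immersion_g smooth_manifold_chart(5)[OF base_manifold] unfolding isometric_immersion_on_def by blast+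

lemma F_eq: "F (x, s) = (\<Sum>i=0..k. a i s *\<^sub>R X i x, \<alpha> (k+1) s)"
proof -
  have k: "kappa (\<Sum>i\<in>A. c i *\<^sub>R v i) = (\<Sum>i\<in>A. c i *\<^sub>R kappa (v i))" for A c and v :: "nat \<Rightarrow> real \<times> (real^'n)"
    by (simp add: kappa_def prod_eq_iff fst_sum snd_sum)
  have split: "(\<Sum>i=0..k. b i) = b 0 + (\<Sum>i=1..k. b i)" for b :: "nat \<Rightarrow> 'z::comm_monoid_add"
    by (simp add: sum.atLeast_Suc_atMost)
  have "(\<Sum>i=1..k. a i s *\<^sub>R X i x) = (\<Sum>i=1..k. \<alpha> i s *\<^sub>R \<xi> i x)"
    by (rule sum.cong) (auto simp: a_def X_def)
  then have r: "(\<Sum>i=0..k. a i s *\<^sub>R X i x, \<alpha> (k+1) s) = kappa (a 0 s *\<^sub>R g x) + kappa (\<Sum>i=1..k. \<alpha> i s *\<^sub>R \<xi> i x) + \<alpha> (k+1) s *\<^sub>R ddt"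
    unfolding split by (simp add: kappa_def ddt_def X_def)
  show ?thesis
  proof (cases "\<epsilon> = 0")
    case True
    then have a0: "a 0 s = 1" unfolding a_def by simp
    show ?thesis unfolding r k a0 using True by (simp add: constructed_map_def)
  next
    case False
    have "(\<Sum>i=0..k+1. \<alpha> i s *\<^sub>R xi_tilde g k \<xi> i x)
      = \<alpha> 0 s *\<^sub>R kappa (g x) + (\<Sum>i=1..k. \<alpha> i s *\<^sub>R xi_tilde g k \<xi> i x) + \<alpha> (k+1) s *\<^sub>R ddt"
      using split[of "\<lambda>i. \<alpha> i s *\<^sub>R xi_tilde g k \<xi> i x"] by (simp add: xi_tilde_def)
    also have "(\<Sum>i=1..k. \<alpha> i s *\<^sub>R xi_tilde g k \<xi> i x) = (\<Sum>i=1..k. \<alpha> i s *\<^sub>R kappa (\<xi> i x))"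
      by (rule sum.cong) (auto simp: xi_tilde_def)
    finally show ?thesis using False unfolding r k by (simp add: constructed_map_def a_def kappa_def)
  qed
qed

lemma X_smooth: "i \<le> k \<Longrightarrow> smooth_map_on N (topspace (points N)) (X i)"
  using normal_fields g_smooth by (auto simp: X_def orthonormal_parallel_normal_fields_def)

lemma alpha_smooth: "smooth_on I (\<alpha> (k + 1))"
  using admissible by (auto simp: admissible_curve_def Let_def split: if_splits)

lemma a_smooth: "i \<le> k \<Longrightarrow> smooth_on I (a i)"
  using admissible by (auto simp: a_def smooth_on_const admissible_curve_def Let_def split: if_splits)

lemma smooth_real_derivative: "smooth_on I b \<Longrightarrow> s \<in> I \<Longrightarrow> (b has_real_derivative deriv b s) (at s)"
  using smooth_on_differentiable[of I b s] by (simp add: DERIV_deriv_iff_real_differentiable)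

lemma atlas_P: "atlas (product_interval N I) = pc ` atlas N"
  by (auto simp: product_interval_def pc_def case_prod_beta image_iff)

lemma topspace_P: "topspace (points (product_interval N I)) = topspace (points N) \<times> I"
  by (simp add: product_interval_def)

lemma product_manifold: "smooth_manifold (Suc d) (product_interval N I)"
  by (rule smooth_manifold_product_interval[OF base_manifold interval_I])

lemma in_coords_F:
  assumes c: "c \<in> atlas N" and y: "y \<in> snd c ` fst c" and t: "t \<in> I"
  shows "in_coords (pc c) F (y, t) = (\<Sum>i=0..k. a i t *\<^sub>R in_coords c (X i) y, \<alpha> (k+1) t)"
  using in_coords_product_chart[OF smooth_manifold_chart(4)[OF base_manifold c] y t, of F]
  by (simp add: pc_def F_eq in_coords_def)

lemma image_pc: "snd (pc c) ` fst (pc c) = snd c ` fst c \<times> I"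
  by (simp add: pc_def map_prod_surj_on)

lemma X_in_coords_smooth: "c \<in> atlas N \<Longrightarrow> i \<le> k \<Longrightarrow> smooth_on (snd c ` fst c) (in_coords c (X i))"
  using smooth_map_on_in_coords[OF X_smooth, of i c] smooth_manifold_chart(5)[OF base_manifold, of c]
  by (simp add: Int_absorb2)

lemma F_smooth: "smooth_map_on (product_interval N I) (topspace (points (product_interval N I))) F"
  unfolding smooth_map_on_def atlas_P
proof
  fix C assume "C \<in> pc ` atlas N"
  then obtain c where c: "c \<in> atlas N" and C: "C = pc c" by blast
  note cc = smooth_manifold_chart[OF base_manifold c]
  let ?S = "snd c ` fst c \<times> I"
  have oS: "open ?S" using cc(2) open_I by (rule open_Times)
  have "smooth_on ?S (\<lambda>z. (\<Sum>i=0..k. a i (snd z) *\<^sub>R in_coords c (X i) (fst z), \<alpha> (k+1) (snd z)))"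
  proof (intro smooth_on_Pair[OF oS] smooth_on_sum[OF oS] smooth_on_scaleR[OF oS])
    show "smooth_on ?S (\<lambda>z. \<alpha> (k+1) (snd z))"
      by (rule smooth_on_compose_linear[OF oS open_I bounded_linear_snd _ alpha_smooth]) auto
    fix i assume "i \<in> {0..k}"
    then have i: "i \<le> k" by simp
    show "smooth_on ?S (\<lambda>z. a i (snd z))"
      by (rule smooth_on_compose_linear[OF oS open_I bounded_linear_snd _ a_smooth[OF i]]) auto
    show "smooth_on ?S (\<lambda>z. in_coords c (X i) (fst z))"
      by (rule smooth_on_compose_linear[OF oS cc(2) bounded_linear_fst _ X_in_coords_smooth[OF c i]]) auto
  qed
  then have "smooth_on ?S (in_coords (pc c) F)"
    by (rule smooth_on_cong[OF oS, rotated]) (auto simp: in_coords_F[OF c])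
  then show "smooth_on (snd C ` (fst C \<inter> topspace (points (product_interval N I)))) (in_coords C F)"
    unfolding C by (rule smooth_on_subset) (auto simp: image_pc[symmetric])
qed

text \<open>For \<epsilon> \<noteq> 0 the position vector \<open>g x\<close> has square \<epsilon>
  and is orthogonal to its tangent space, which contains the fields \<open>\<xi>\<close>. For
  \<epsilon> = 0 the entry with index 0 is a point in no particular relation to the fields, hence
  the restriction on the indices.\<close>

lemma form_X:
  assumes x: "x \<in> topspace (points N)" and i: "i \<le> k" "j \<le> k" and ij: "\<epsilon> = 0 \<longrightarrow> i \<noteq> 0 \<and> j \<noteq> 0"
  shows "Q_form \<epsilon> (X i x) (X j x) = (if i = j then (if i = 0 then \<epsilon> else 1) else 0)"
proof -
  obtain c where c: "c \<in> atlas N" "x \<in> fst c" using x base_manifold unfolding smooth_manifold_def by blast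
  have n: "\<xi> i x \<in> normal_space (Q \<epsilon>) c g x" if "i \<in> {1..k}" for i
    using normal_fields that c unfolding orthonormal_parallel_normal_fields_def by blast
  have o: "Q_form \<epsilon> (\<xi> i x) (\<xi> j x) = (if i = j then 1 else 0)" if "i \<in> {1..k}" "j \<in> {1..k}" for i j
    using normal_fields that x unfolding orthonormal_parallel_normal_fields_def Q_simps by blast
  have gx: "g x \<in> locus (Q \<epsilon>)" using g_locus x by blast
  have g\<xi>: "Q_form \<epsilon> (g x) (\<xi> i x) = 0" if "\<epsilon> \<noteq> 0" "i \<in> {1..k}" for i
    using Q.normal_spaceD(2)[OF n[OF that(2)]] that(1) by (simp add: Q_simps)
  consider "i = 0" "j = 0" | "i = 0" "j \<in> {1..k}" | "i \<in> {1..k}" "j = 0" | "i \<in> {1..k}" "j \<in> {1..k}"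
    using i by fastforce
  then show ?thesis
  proof cases
    case 1
    then show ?thesis using locus_Q_form[OF eps _ gx] ij by (simp add: X_def)
  next
    case 2
    then show ?thesis using g\<xi>[of j] ij by (simp add: X_def)
  next
    case 3
    then show ?thesis using g\<xi>[of i] ij Q_form_sym[of \<epsilon> "g x"] by (simp add: X_def)
  next
    case 4
    then show ?thesis using o[of i j] by (simp add: X_def)
  qed
qed

lemma F_locus: "F ` topspace (points (product_interval N I)) \<subseteq> locus (QxR \<epsilon>)"
proof (clarsimp simp: topspace_P)
  fix x s assume x: "x \<in> topspace (points N)" and s: "s \<in> I"
  obtain c where c: "c \<in> atlas N" "x \<in> fst c" using x base_manifold unfolding smooth_manifold_def by blast
  define y where "y = (\<Sum>i=0..k. a i s *\<^sub>R X i x)"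
  have gx: "g x \<in> locus (Q \<epsilon>)" using g_locus x by blast
  have "y \<in> locus (Q \<epsilon>)"
  proof (cases "\<epsilon> = 0")
    case True
    have "fst (X i x) = 0" if "i \<le> k" for i
    proof (cases "i = 0")
      case False
      then have "\<xi> i x \<in> normal_space (Q \<epsilon>) c g x"
        using normal_fields that c unfolding orthonormal_parallel_normal_fields_def by force
      from Q.normal_spaceD(2)[OF this] show ?thesis using False True by (simp add: X_def Q_simps)
    qed (use gx True in \<open>simp add: X_def Q_def\<close>)
    then show ?thesis using True by (simp add: y_def Q_def fst_sum)
  next
    case False
    have yX: "Q_form \<epsilon> (X j x) y = a j s * (if j = 0 then \<epsilon> else 1)" if "j \<le> k" for j
    proof -
      have "Q_form \<epsilon> (X j x) y = (\<Sum>i=0..k. a i s * Q_form \<epsilon> (X j x) (X i x))"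
        unfolding y_def by (simp add: Q.simps[unfolded Q_simps])
      also have "\<dots> = (\<Sum>i=0..k. if i = j then a i s * (if j = 0 then \<epsilon> else 1) else 0)"
        using False that by (intro sum.cong) (auto simp: form_X[OF x])
      finally show ?thesis using that by simp
    qed
    have "Q_form \<epsilon> y y = (\<Sum>j=0..k. a j s * Q_form \<epsilon> (X j x) y)"
      by (subst (1) y_def) (simp add: Q.simps[unfolded Q_simps])
    also have "\<dots> = (\<Sum>j=0..k. a j s * (a j s * (if j = 0 then \<epsilon> else 1)))"
      by (intro sum.cong) (auto simp: yX)
    also have "\<dots> = \<epsilon> * (\<alpha> 0 s)\<^sup>2 + (\<Sum>j=1..k. (\<alpha> j s)\<^sup>2)"
      using False by (simp add: sum.atLeast_Suc_atMost a_def power2_eq_square mult_ac)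
    also have "\<dots> = \<epsilon>" using admissible False s by (simp add: admissible_curve_def)
    finally have yy: "Q_form \<epsilon> y y = \<epsilon>" .
    show ?thesis
    proof (cases "\<epsilon> = -1")
      case True
      \<comment> \<open>The quadratic equation leaves open which sheet \<open>y\<close> lies on.
        This is decided by its product with \<open>g x\<close>, which is minus the positive number
        \<open>\<alpha> 0 s\<close>.\<close>
      have a0: "a 0 s = \<alpha> 0 s" unfolding a_def using True by simp
      have "\<alpha> 0 s > 0" using admissible True s by (simp add: admissible_curve_def)
      then have "Q_form \<epsilon> (g x) y < 0" using yX[OF le0] True unfolding X_def a0 by simp
      then have 1: "Q_form (-1) (g x) y < 0" unfolding True .
      have 2: "Q_form (-1) (g x) (g x) = -1" and 3: "fst (g x) > 0" using gx True by (auto simp: Q_def)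
      have 4: "Q_form (-1) y y = -1" using yy unfolding True .
      have "fst y > 0" by (rule hyperboloid_future[OF 2 3 4 1])
      then show ?thesis using 4 True by (simp add: Q_def)
    next
      case 2: False
      then show ?thesis using False eps yy by (simp add: Q_def)
    qed
  qed
  then show "F (x, s) \<in> locus (QxR \<epsilon>)" by (simp add: F_eq Q_simps y_def)
qed

lemma DF:
  assumes c: "c \<in> atlas N" and y: "y \<in> snd c ` fst c" and t: "t \<in> I"
  shows "fD (in_coords (pc c) F) (y, t) w =
    (\<Sum>i=0..k. a i t *\<^sub>R fD (in_coords c (X i)) y (fst w) + (snd w * deriv (a i) t) *\<^sub>R in_coords c (X i) y,
     snd w * deriv (\<alpha> (k+1)) t)"
proof -
  let ?S = "snd c ` fst c \<times> I"
  have oS: "open ?S" using smooth_manifold_chart(2)[OF base_manifold c] open_I by (rule open_Times)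
  have in_S: "(y, t) \<in> ?S" using y t by simp
  have "((\<lambda>z. \<Sum>i=0..k. a i (snd z) *\<^sub>R in_coords c (X i) (fst z)) has_derivative
    (\<lambda>w. \<Sum>i=0..k. a i t *\<^sub>R fD (in_coords c (X i)) y (fst w) + (snd w * deriv (a i) t) *\<^sub>R in_coords c (X i) y)) (at (y, t))"
    by (rule has_derivative_separated_sum)
      (use smooth_on_has_derivative[OF X_in_coords_smooth[OF c] y] smooth_real_derivative[OF a_smooth t] in auto)
  moreover have "((\<lambda>z. \<alpha> (k+1) (snd z)) has_derivative (\<lambda>w. snd w * deriv (\<alpha> (k+1)) t)) (at (y, t))"
  proof -
    have "(\<alpha> (k+1) has_derivative (\<lambda>h. h * deriv (\<alpha> (k+1)) t)) (at (snd (y, t)))"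
      using smooth_real_derivative[OF alpha_smooth t] by (simp add: has_field_derivative_def mult_commute_abs)
    from has_derivative_compose[OF has_derivative_snd[OF has_derivative_ident] this]
    show ?thesis by simp
  qed
  ultimately have "((\<lambda>z. (\<Sum>i=0..k. a i (snd z) *\<^sub>R in_coords c (X i) (fst z), \<alpha> (k+1) (snd z))) has_derivative
    (\<lambda>w. (\<Sum>i=0..k. a i t *\<^sub>R fD (in_coords c (X i)) y (fst w) + (snd w * deriv (a i) t) *\<^sub>R in_coords c (X i) y,
     snd w * deriv (\<alpha> (k+1)) t))) (at (y, t))"
    by (rule has_derivative_Pair)
  then have "(in_coords (pc c) F has_derivative
    (\<lambda>w. (\<Sum>i=0..k. a i t *\<^sub>R fD (in_coords c (X i)) y (fst w) + (snd w * deriv (a i) t) *\<^sub>R in_coords c (X i) y,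
     snd w * deriv (\<alpha> (k+1)) t))) (at (y, t))"
    by (rule has_derivative_transform_within_open[OF _ oS in_S]) (auto simp: in_coords_F[OF c])
  then show ?thesis by (simp add: fD_eqI)
qed

text \<open>The outer direction (0, r) only differentiates the coefficients \<open>a i\<close>. No
  second derivative of a field remains, so the mixed derivative is again a combination of first
  derivatives of the fields along N.\<close>

lemma D2F:
  assumes c: "c \<in> atlas N" and y: "y \<in> snd c ` fst c" and t: "t \<in> I"
  shows "fD (\<lambda>z. fD (in_coords (pc c) F) z (v, 0)) (y, t) (0, r) =
    (\<Sum>i=0..k. (r * deriv (a i) t) *\<^sub>R fD (in_coords c (X i)) y v, 0)"
proof -
  let ?S = "snd c ` fst c \<times> I"
  have oS: "open ?S" using smooth_manifold_chart(2)[OF base_manifold c] open_I by (rule open_Times)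
  have in_S: "(y, t) \<in> ?S" using y t by simp
  let ?A = "\<lambda>i y. fD (in_coords c (X i)) y v"
  have l: "fD (?A i) y 0 = 0" if "i \<le> k" for i
    by (rule linear_0[OF smooth_on_linear_fD[OF smooth_on_fD[OF X_in_coords_smooth[OF c that]] y]])
  have "((\<lambda>z. \<Sum>i=0..k. a i (snd z) *\<^sub>R ?A i (fst z)) has_derivative
    (\<lambda>w. \<Sum>i=0..k. a i t *\<^sub>R fD (?A i) y (fst w) + (snd w * deriv (a i) t) *\<^sub>R ?A i y)) (at (y, t))"
    by (rule has_derivative_separated_sum)
      (use smooth_on_has_derivative[OF smooth_on_fD[OF X_in_coords_smooth[OF c]] y] smooth_real_derivative[OF a_smooth t] in auto)
  from has_derivative_Pair[OF this has_derivative_const[of 0]]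
  have "((\<lambda>z. fD (in_coords (pc c) F) z (v, 0)) has_derivative
    (\<lambda>w. (\<Sum>i=0..k. a i t *\<^sub>R fD (?A i) y (fst w) + (snd w * deriv (a i) t) *\<^sub>R ?A i y, 0))) (at (y, t))"
    by (rule has_derivative_transform_within_open[OF _ oS in_S]) (auto simp: DF[OF c])
  then show ?thesis by (simp add: fD_eqI l)
qed

lemma class_A:
  "class_A_on \<epsilon> (product_interval N I) (regular_points (product_interval N I) F) (induced_metric (QxR \<epsilon>) F) F"
proof -
  let ?P = "product_interval N I" and ?R = "regular_points (product_interval N I) F"
  let ?G = "induced_metric (QxR \<epsilon>) F"
  have R: "openin (points ?P) ?R" by (rule openin_regular_points[OF product_manifold F_smooth])
  have Rsub: "?R \<subseteq> topspace (points ?P)" by (rule openin_subset[OF R])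
  have Fs: "smooth_map_on ?P ?R F" by (rule smooth_map_on_subset[OF F_smooth Rsub])
  have Fl: "F ` ?R \<subseteq> locus (QxR \<epsilon>)" using F_locus Rsub by blast
  have tan: "range (differential C F p) \<subseteq> tangent (QxR \<epsilon>) (F p)" if "C \<in> atlas ?P" "p \<in> fst C \<inter> ?R" for C p
    by (rule tangent_QxR_differential[OF eps product_manifold that(1) R Fs Fl that(2)])
  have inj: "inj (differential C F p)" if "C \<in> atlas ?P" "p \<in> fst C \<inter> ?R" for C p
    using that by (simp add: regular_points_def)
  have "isometric_immersion_on ?P ?R ?G (QxR \<epsilon>) F"
    by (rule QxR.isometric_immersion_on_induced_metric[OF product_manifold R Fs Fl tan inj])
  moreover have "eigenvector (shape_operator (QxR \<epsilon>) ?G C F p \<zeta>) (T_field \<epsilon> C F p)"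
    if C: "C \<in> atlas ?P" and p: "p \<in> fst C \<inter> ?R" and \<zeta>: "\<zeta> \<in> normal_space (QxR \<epsilon>) C F p" for C p \<zeta>
  proof -
    obtain c where c: "c \<in> atlas N" and Cc: "C = pc c" using C atlas_P by blast
    note cc = smooth_manifold_chart[OF base_manifold c]
    obtain x t where pxt: "p = (x, t)" and x: "x \<in> fst c" and t: "t \<in> I"
      using p by (auto simp: Cc pc_def)
    define y where "y = snd c x"
    have y: "y \<in> snd c ` fst c" using x by (simp add: y_def)
    have xt: "x \<in> topspace (points N)" using x cc(5) by blast
    have snd_p: "snd C p = (y, t)" by (simp add: Cc pc_def pxt y_def)
    have Xy: "in_coords c f y = f x" for f :: "'a \<Rightarrow> real \<times> (real^'n)"
      unfolding y_def by (rule in_coords_apply[OF cc(4) x])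
    have Fp: "F p \<in> locus (QxR \<epsilon>)" using Fl p by blast
    have lin: "linear (differential C F p)"
      using smooth_map_on_linear_differential[OF Fs C] p by blast
    define L where "L i = differential c (X i) x" for i
    have L_eq: "fD (in_coords c (X i)) y = L i" for i by (simp add: L_def differential_def[abs_def] y_def)
    have L_lin: "linear (L i)" if "i \<le> k" for i
      unfolding L_def by (rule smooth_map_on_linear_differential[OF X_smooth[OF that] c x xt])
    define dg where "dg = differential c g x"
    have dg_lin: "linear dg" and dg_inj: "inj dg"
      unfolding dg_def by (rule smooth_map_on_linear_differential[OF g_smooth c x xt], rule g_inj[OF c x])
    have gx: "g x \<in> locus (Q \<epsilon>)" using g_locus xt by blast
    have tan_g: "range dg \<subseteq> tangent (Q \<epsilon>) (g x)" unfolding dg_def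
      by (rule tangent_Q_differential[OF eps base_manifold c _ g_smooth g_locus]) (use x xt in auto)
    \<comment> \<open>For \<open>i = 0\<close> this is the differential of \<open>g\<close> itself;
      for the other fields it is parallelism, read in the surrounding vector space.\<close>
    have L_range: "L i v \<in> range dg" if i: "i \<le> k" for i v
    proof (cases "i = 0")
      case False
      then have i1: "i \<in> {1..k}" using i by simp
      have n: "\<xi> i q \<in> normal_space (Q \<epsilon>) c g q" "normal_derivative (Q \<epsilon>) c g (\<xi> i) q v = 0" if "q \<in> fst c" for q v
        using normal_fields that c i1 unfolding orthonormal_parallel_normal_fields_def by blast+
      have sm: "smooth_map_on N (topspace (points N)) (\<xi> i)"
        using normal_fields i1 unfolding orthonormal_parallel_normal_fields_def by blast
      have "differential c (\<xi> i) x v \<in> range (differential c g x)"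
        by (rule Q.parallel_derivative_in_range[OF base_manifold c g_smooth x gx tan_g[unfolded dg_def] n(2)[OF x]
            normal_field_derivative_tangent[OF eps base_manifold c g_smooth g_locus sm n(1) x]])
      then show ?thesis using False by (simp add: L_def X_def dg_def)
    qed (simp add: L_def X_def dg_def)
    define A where "A v = (\<Sum>i=0..k. a i t *\<^sub>R L i v)" for v
    define p' where "p' = (\<Sum>i=0..k. deriv (a i) t *\<^sub>R X i x)"
    define \<alpha>' where "\<alpha>' = deriv (\<alpha> (k+1)) t"
    have \<alpha>': "\<alpha>' \<noteq> 0" using admissible t by (simp add: \<alpha>'_def admissible_curve_def)
    have D: "differential C F p w = (A (fst w) + snd w *\<^sub>R p', snd w * \<alpha>')" for w
      unfolding differential_def snd_p unfolding Cc DF[OF c y t]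
      by (simp add: L_eq Xy A_def p'_def \<alpha>'_def sum.distrib scaleR_sum_right)
    have A_lin: "linear A" unfolding A_def by (intro linear_compose_sum ballI linear_compose_scale_right L_lin) auto
    have A_range: "range A \<subseteq> range dg"
      unfolding A_def using L_range
      by (auto intro!: subspace_sum subspace_scale linear_subspace_image[OF dg_lin] simp: image_subset_iff)
    have A_inj: "inj A"
    proof (rule injI)
      fix v w assume "A v = A w"
      then have "differential C F p (v, 0) = differential C F p (w, 0)" by (simp add: D)
      then have "(v, 0::real) = (w, 0)" by (rule injD[OF inj[OF C p]])
      then show "v = w" by simp
    qed
    \<comment> \<open>This is where regularity is used: it makes \<open>A\<close> injective, and an
      injective linear map into the range of \<open>dg\<close> fills it for reasons of dimension.
      From here on every vector in the range of \<open>dg\<close> is tangent to the constructed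
      map.\<close>
    have A_surj: "range A = range dg"
    proof -
      obtain B :: "'d set" where B: "finite B" "independent B" "span B = UNIV"
        using base_manifold unfolding smooth_manifold_def by blast
      show ?thesis by (rule finite_basis_range_eq[OF B A_lin A_inj dg_lin dg_inj A_range])
    qed
    \<comment> \<open>The vector \<open>p'\<close> is the horizontal part of the derivative in s.
      Its term along \<open>g x\<close> is harmless for \<epsilon> \<noteq> 0 because position
      vectors are orthogonal to tangent vectors, and for \<epsilon> = 0 because the coefficient 1
      has derivative 0.\<close>
    have dgp: "Q_form \<epsilon> (dg v) p' = 0" for v
    proof -
      have "deriv (a i) t * Q_form \<epsilon> (dg v) (X i x) = 0" if i: "i \<le> k" for i
      proof (cases "i = 0")
        case True
        show ?thesis
        proof (cases "\<epsilon> = 0")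
          case True
          then have "a i = (\<lambda>s. 1)" unfolding a_def using \<open>i = 0\<close> by simp
          then show ?thesis by simp
        next
          case False
          have "dg v \<in> tangent (Q \<epsilon>) (g x)" using tan_g by blast
          then show ?thesis using False True Q_form_sym[of \<epsilon> "dg v"] by (simp add: Q_simps X_def)
        qed
      next
        case False
        then have "\<xi> i x \<in> normal_space (Q \<epsilon>) c g x"
          using normal_fields i c x unfolding orthonormal_parallel_normal_fields_def by force
        from Q.normal_spaceD(1)[OF this, of v] show ?thesis using False by (simp add: Q_simps X_def dg_def)
      qed
      then have "(\<Sum>i=0..k. deriv (a i) t * Q_form \<epsilon> (dg v) (X i x)) = 0"
        by (intro sum.neutral) auto
      then show ?thesis unfolding p'_def by (simp add: Q.simps[unfolded Q_simps])
    qed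
    define \<rho> where "\<rho> = form (QxR \<epsilon>) (p', \<alpha>') (p', \<alpha>')"
    have "differential C F p (0, 1) = (p', \<alpha>')" by (simp add: D linear_0[OF A_lin])
    then have "(p', \<alpha>') \<in> tangent (QxR \<epsilon>) (F p)" using tan[OF C p] by (metis rangeI subsetD)
    then have \<rho>: "\<rho> > 0" unfolding \<rho>_def
      using \<alpha>' by (intro QxR.form_pos[OF Fp]) (auto simp: prod_eq_iff)
    \<comment> \<open>If T is \<tau> times the s-direction, its product with that direction is
      \<open>\<tau> * \<rho>\<close> and has to be the height derivative \<open>\<alpha>'\<close>.
      The value is nonzero because \<open>\<alpha>'\<close> is.\<close>
    define \<tau> where "\<tau> = \<alpha>' / \<rho>"
    have \<tau>: "\<tau> \<noteq> 0" "\<tau> * \<rho> = \<alpha>'" using \<alpha>' \<rho> by (simp_all add: \<tau>_def)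
    have formT: "form (QxR \<epsilon>) (differential C F p w) (differential C F p (0, \<tau>)) = snd (differential C F p w)" for w
    proof -
      obtain v where v: "A (fst w) = dg v" using A_range by blast
      have "form (QxR \<epsilon>) (differential C F p w) (differential C F p (0, \<tau>))
          = \<tau> * Q_form \<epsilon> (dg v) p' + snd w * (\<tau> * \<rho>)"
        by (simp add: D v linear_0[OF A_lin] Q_simps Q.simps[unfolded Q_simps] \<rho>_def algebra_simps)
      then show ?thesis by (simp add: dgp \<tau> D)
    qed
    have T: "T_field \<epsilon> C F p = (0, \<tau>)"
      by (rule T_field_eqI[OF eps Fp lin inj[OF C p] tan[OF C p] formT])
    \<comment> \<open>The value that the eigenvalue equation forces when it is tested against T
      itself: the square of T is dh(T) = \<open>\<tau> * \<alpha>'\<close>.\<close>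
    define \<mu> where "\<mu> = form (QxR \<epsilon>) (second_differential C F p (0, \<tau>) (0, \<tau>)) \<zeta> / (\<tau> * \<alpha>')"
    have "shape_operator (QxR \<epsilon>) ?G C F p \<zeta> (0, \<tau>) = \<mu> *\<^sub>R (0, \<tau>)"
    proof (rule QxR.shape_operator_eqI[of F p, OF Fp lin inj[OF C p] tan[OF C p] _ \<zeta>])
      show "?G C p v w = form (QxR \<epsilon>) (differential C F p v) (differential C F p w)" for v w
        by (simp add: induced_metric_def)
      fix w :: "'d \<times> real"
      have sF: "smooth_on (snd C ` (fst C \<inter> ?R)) (in_coords C F)" by (rule smooth_map_on_in_coords[OF Fs C])
      have oC: "open (snd C ` (fst C \<inter> ?R))" by (rule smooth_manifold_open_image[OF product_manifold C R])
      have pC: "snd C p \<in> snd C ` (fst C \<inter> ?R)" using p by blast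
      have D2_lin: "linear (\<lambda>w. second_differential C F p u w)" for u
        unfolding second_differential_def by (rule linear_fD_fD[OF oC sF pC])
      \<comment> \<open>The mixed derivative lies in the range of \<open>dg\<close>, which is the
        range of \<open>A\<close>, so it is tangent to the constructed map and orthogonal to
        \<open>\<zeta>\<close>.\<close>
      have tang: "form (QxR \<epsilon>) (second_differential C F p (0, \<tau>) (v, 0)) \<zeta> = 0" for v
      proof -
        have "second_differential C F p (0, \<tau>) (v, 0) = (\<Sum>i=0..k. (\<tau> * deriv (a i) t) *\<^sub>R L i v, 0)"
          unfolding second_differential_def snd_p unfolding Cc D2F[OF c y t] L_eq ..
        moreover have "(\<Sum>i=0..k. (\<tau> * deriv (a i) t) *\<^sub>R L i v) \<in> range dg"
          using L_range by (auto intro!: subspace_sum subspace_scale linear_subspace_image[OF dg_lin])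
        then obtain v' where "(\<Sum>i=0..k. (\<tau> * deriv (a i) t) *\<^sub>R L i v) = A v'" using A_surj by blast
        ultimately have "second_differential C F p (0, \<tau>) (v, 0) = differential C F p (v', 0)" by (simp add: D)
        then show ?thesis using QxR.normal_spaceD(1)[OF \<zeta>] by simp
      qed
      have w: "w = (fst w, 0) + (snd w / \<tau>) *\<^sub>R (0, \<tau>)" using \<tau> by (simp add: prod_eq_iff)
      have "form (QxR \<epsilon>) (second_differential C F p (0, \<tau>) w) \<zeta>
        = (snd w / \<tau>) * form (QxR \<epsilon>) (second_differential C F p (0, \<tau>) (0, \<tau>)) \<zeta>"
        by (subst w) (simp add: linear_add[OF D2_lin] linear_scale[OF D2_lin] QxR.simps tang del: scaleR_Pair)
      also have "\<dots> = \<mu> * (snd w * \<alpha>')" using \<tau> \<alpha>' by (simp add: \<mu>_def)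
      also have "\<dots> = \<mu> * form (QxR \<epsilon>) (differential C F p w) (differential C F p (0, \<tau>))"
        unfolding formT by (simp add: D)
      also have "\<dots> = ?G C p (\<mu> *\<^sub>R (0, \<tau>)) w"
        unfolding induced_metric_def linear_scale[OF lin] QxR.scaleR_left
        by (simp add: QxR.sym[of "differential C F p w"])
      finally show "?G C p (\<mu> *\<^sub>R (0, \<tau>)) w = form (QxR \<epsilon>) (second_differential C F p (0, \<tau>) w) \<zeta>" ..
    qed
    then show ?thesis unfolding eigenvector_def T using \<tau>(1) by (auto simp: zero_prod_def)
  qed
  ultimately show ?thesis unfolding class_A_on_def by blast
qed

end

section \<open>Product coordinates on an immersion in class A\<close>

lemma has_derivative_directional_zero:
  assumes "(f has_derivative f') (at x)" "open S" "x \<in> S" "\<And>y. y \<in> S \<Longrightarrow> f y = c"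
  shows "f' v = 0"
proof -
  have "((\<lambda>y. c) has_derivative f') (at x)"
    by (rule has_derivative_transform_within_open[OF assms(1-3)]) (simp add: assms(4))
  from has_derivative_unique[OF this has_derivative_const] show ?thesis by simp
qed

text \<open>An immersion in class A read in a chart. Since \<open>\<langle>w, T\<rangle> = dh w\<close>, the last assumption, \<open>II(T, w) = 0\<close> for
  \<open>w \<bottom> T\<close>, is the eigenvector condition.\<close>

locale class_A_coords =
  fixes \<epsilon> :: real and \<Omega> :: "'m::euclidean_space set" and f :: "'m \<Rightarrow> (real \<times> (real^'n)) \<times> real" and T :: "'m \<Rightarrow> 'm"
  assumes eps: "\<epsilon> \<in> {-1, 0, 1}" and open_\<Omega>: "open \<Omega>" and smooth_f: "smooth_on \<Omega> f"
    and f_locus: "\<And>q. q \<in> \<Omega> \<Longrightarrow> f q \<in> locus (QxR \<epsilon>)" and inj_Df: "\<And>q. q \<in> \<Omega> \<Longrightarrow> inj (fD f q)"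
    and form_T: "\<And>q v. q \<in> \<Omega> \<Longrightarrow> form (QxR \<epsilon>) (fD f q v) (fD f q (T q)) = snd (fD f q v)"
    and T_nonzero: "\<And>q. q \<in> \<Omega> \<Longrightarrow> T q \<noteq> 0"
    and II_T: "\<And>q w \<zeta>. q \<in> \<Omega> \<Longrightarrow> snd (fD f q w) = 0 \<Longrightarrow> \<zeta> \<in> tangent (QxR \<epsilon>) (f q) \<Longrightarrow>
      (\<And>v. form (QxR \<epsilon>) (fD f q v) \<zeta> = 0) \<Longrightarrow> form (QxR \<epsilon>) (fD (\<lambda>x. fD f x w) q (T q)) \<zeta> = 0"
begin

sublocale QxR: ambient_space "QxR \<epsilon> :: ((real \<times> (real^'n)) \<times> real) ambient" by (rule ambient_space_QxR[OF eps])

abbreviation b where "b \<equiv> form (QxR \<epsilon> :: ((real \<times> (real^'n)) \<times> real) ambient)"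

abbreviation Df where "Df q v \<equiv> fD f q v"

abbreviation dh where "dh q v \<equiv> snd (fD f q v)"

lemma Df: "q \<in> \<Omega> \<Longrightarrow> (f has_derivative fD f q) (at q)"
  by (rule smooth_on_has_derivative[OF smooth_f])

lemma linear_Df: "q \<in> \<Omega> \<Longrightarrow> linear (fD f q)"
  by (rule smooth_on_linear_fD[OF smooth_f])

lemma Df_simps:
  assumes "q \<in> \<Omega>"
  shows "Df q (u + v) = Df q u + Df q v" "Df q (u - v) = Df q u - Df q v" "Df q (r *\<^sub>R u) = r *\<^sub>R Df q u" "Df q 0 = 0"
  using linear_add linear_diff linear_scale linear_0 linear_Df[OF assms] by blast+

lemma Df_tangent: "q \<in> \<Omega> \<Longrightarrow> Df q v \<in> tangent (QxR \<epsilon>) (f q)"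
  by (rule derivative_in_tangent_QxR[OF eps Df open_\<Omega>]) (auto simp: f_locus)

lemma Df_eq_0: "q \<in> \<Omega> \<Longrightarrow> Df q v = 0 \<Longrightarrow> v = 0"
  using injD[OF inj_Df, of q v 0] Df_simps(4) by simp

lemma b_pos: "q \<in> \<Omega> \<Longrightarrow> v \<noteq> 0 \<Longrightarrow> b (Df q v) (Df q v) > 0"
  using QxR.form_pos[OF f_locus Df_tangent] Df_eq_0 by blast

lemma dh_T_pos: "q \<in> \<Omega> \<Longrightarrow> dh q (T q) > 0"
  using b_pos[OF _ T_nonzero] form_T by force

end

section \<open>A frame of the orthogonal complement of T that is constant along T\<close>

locale class_A_frame = class_A_coords \<epsilon> \<Omega> f T
  for \<epsilon> :: real and \<Omega> :: "'m::euclidean_space set" and f :: "'m \<Rightarrow> (real \<times> (real^'n)) \<times> real" and T :: "'m \<Rightarrow> 'm" +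
  fixes y0 :: 'm and J :: "'p::euclidean_space \<Rightarrow> 'm"
  assumes y0: "y0 \<in> \<Omega>" and linear_J: "linear J" and inj_J: "inj J" and range_J: "range J = {u. dh y0 u = 0}"
begin

definition v0 where "v0 = T y0"

text \<open>The projection of \<open>J a\<close> to ker dh along \<open>v0\<close>, multiplied by
  \<open>dh q v0\<close> so that no quotient occurs. As \<open>J\<close> identifies
  \<open>'p\<close> with ker dh at \<open>y0\<close>, the frame is a linear map from
  \<open>'p\<close> rather than a list of vectors.\<close>

definition e where "e q a = dh q v0 *\<^sub>R J a - dh q (J a) *\<^sub>R v0"

definition w where "w q a = dh q v0 *\<^sub>R Df q (J a) - dh q (J a) *\<^sub>R Df q v0"

lemma dh_v0: "dh y0 v0 > 0"
  unfolding v0_def by (rule dh_T_pos[OF y0])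

lemma decomposition: obtains a r where "u = J a + r *\<^sub>R v0"
proof -
  define r where "r = dh y0 u / dh y0 v0"
  have "dh y0 (u - r *\<^sub>R v0) = 0" using dh_v0 by (simp add: Df_simps[OF y0] r_def)
  then obtain a where "u - r *\<^sub>R v0 = J a" using range_J by blast
  then show ?thesis using that[of a r] by (simp add: algebra_simps)
qed

lemma w_eq: "q \<in> \<Omega> \<Longrightarrow> w q a = Df q (e q a)"
  by (simp add: w_def e_def Df_simps)

lemma snd_w: "snd (w q a) = 0"
  by (simp add: w_def)

lemma linear_e: assumes "q \<in> \<Omega>" shows "linear (e q)"
  by (rule linearI) (simp_all add: e_def linear_add[OF linear_J] linear_scale[OF linear_J] Df_simps[OF assms] algebra_simps)

lemma linear_w: assumes "q \<in> \<Omega>" shows "linear (w q)"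
  by (rule linearI) (simp_all add: w_eq[OF assms] linear_add[OF linear_e[OF assms]] linear_scale[OF linear_e[OF assms]] Df_simps[OF assms])

lemma kernel_dh:
  assumes q: "q \<in> \<Omega>" "dh q v0 \<noteq> 0" and u: "dh q u = 0"
  obtains a where "u = e q a"
proof -
  obtain a r where u': "u = J a + r *\<^sub>R v0" by (rule decomposition)
  then have "dh q (J a) + r * dh q v0 = 0" using u by (simp add: Df_simps[OF q(1)])
  then have r: "r = - (dh q (J a) / dh q v0)" using q(2) by (simp add: field_simps)
  have "e q (a /\<^sub>R dh q v0) = u"
    using q(2) by (simp add: e_def u' r linear_scale[OF linear_J] Df_simps[OF q(1)] field_simps)
  then show ?thesis using that by blast
qed

lemma smooth_dh: "smooth_on \<Omega> (\<lambda>q. dh q v)"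
  by (rule smooth_on_linear_compose[OF open_\<Omega> bounded_linear_snd smooth_on_fD[OF smooth_f]])

lemma smooth_w: "smooth_on \<Omega> (\<lambda>q. w q a)"
  unfolding w_def
  by (intro smooth_on_diff[OF open_\<Omega>] smooth_on_scaleR[OF open_\<Omega>] smooth_dh smooth_on_fD[OF smooth_f])

lemma smooth_e: "smooth_on \<Omega> (\<lambda>q. e q a)"
  unfolding e_def
  by (intro smooth_on_diff[OF open_\<Omega>] smooth_on_scaleR[OF open_\<Omega>] smooth_dh smooth_on_const)

text \<open>The matrix of products of the frame \<open>w q\<close> with the fixed frame
  \<open>w y0\<close>, encoded as a linear map of \<open>'p\<close>. At \<open>y0\<close> it is the
  Gram matrix of independent vectors in a positive subspace, hence invertible there and
  nearby.\<close>

definition Gr where "Gr q a = (\<Sum>c\<in>Basis. b (w q a) (w y0 c) *\<^sub>R c)"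

lemma Gr_inner: "Gr q a \<bullet> c = b (w q a) (w y0 c)"
proof -
  have l: "linear (\<lambda>c. b (w q a) (w y0 c))"
    using linear_compose[OF linear_w[OF y0] QxR.linear_right] by (simp add: o_def)
  have "Gr q a \<bullet> c = (\<Sum>i\<in>Basis. (c \<bullet> i) * b (w q a) (w y0 i))"
    unfolding Gr_def inner_sum_left by (intro sum.cong) (simp_all add: inner_commute[of c])
  also have "\<dots> = b (w q a) (w y0 c)" using linear_basis_expansion[OF l, of c] by simp
  finally show ?thesis .
qed

lemma linear_Gr: assumes "q \<in> \<Omega>" shows "linear (Gr q)"
  by (rule linearI) (simp_all add: Gr_def linear_add[OF linear_w[OF assms]] linear_scale[OF linear_w[OF assms]]
      QxR.simps scaleR_add_left sum.distrib scaleR_sum_right)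

lemma e_y0: "e y0 a = dh y0 v0 *\<^sub>R J a"
proof -
  have "dh y0 (J a) = 0" using range_J by blast
  then show ?thesis by (simp add: e_def)
qed

lemma inj_Gr_y0: "inj (Gr y0)"
  unfolding linear_injective_0[OF linear_Gr[OF y0]]
proof (intro allI impI)
  fix a assume "Gr y0 a = 0"
  then have "b (Df y0 (e y0 a)) (Df y0 (e y0 a)) = 0" using Gr_inner[of y0 a a] by (simp add: w_eq[OF y0])
  then have "e y0 a = 0" using b_pos[OF y0, of "e y0 a"] by force
  then have "J a = 0" using dh_v0 by (simp add: e_y0)
  then show "a = 0" using injD[OF inj_J, of a 0] linear_0[OF linear_J] by simp
qed

text \<open>The first condition keeps \<open>v0\<close> transverse to ker dh, so that
  \<open>e q\<close> parametrizes this kernel; the second allows the frame to be normalized.\<close>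

definition \<Omega>1 where "\<Omega>1 = {q \<in> {q \<in> \<Omega>. dh q v0 > 0}. inj (Gr q)}"

lemma \<Omega>1: "open \<Omega>1" "\<Omega>1 \<subseteq> \<Omega>" "y0 \<in> \<Omega>1"
proof -
  have "open (\<Omega> \<inter> (\<lambda>q. dh q v0) -` {0<..})"
    by (rule continuous_open_preimage[OF smooth_on_continuous[OF smooth_dh] open_\<Omega> open_greaterThan])
  moreover have "\<Omega> \<inter> (\<lambda>q. dh q v0) -` {0<..} = {q \<in> \<Omega>. dh q v0 > 0}" by auto
  ultimately have o: "open {q \<in> \<Omega>. dh q v0 > 0}" by simp
  have "continuous_on {q \<in> \<Omega>. dh q v0 > 0} (\<lambda>q. Gr q v)" for v
    unfolding Gr_def
    by (intro continuous_on_sum continuous_on_scaleR continuous_on_const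
        bounded_bilinear.continuous_on[OF QxR.bounded] continuous_on_subset[OF smooth_on_continuous[OF smooth_w]]) auto
  then show "open \<Omega>1" unfolding \<Omega>1_def
    by (intro open_Collect_inj_family[OF o finite_Basis independent_Basis]) (auto simp: linear_Gr)
  show "\<Omega>1 \<subseteq> \<Omega>" by (auto simp: \<Omega>1_def)
  show "y0 \<in> \<Omega>1" using y0 dh_v0 inj_Gr_y0 by (simp add: \<Omega>1_def)
qed

lemma \<Omega>1D: assumes "q \<in> \<Omega>1" shows "q \<in> \<Omega>" "dh q v0 \<noteq> 0" "inj (Gr q)"
  using assms by (auto simp: \<Omega>1_def)

definition Gi where "Gi q = inv (Gr q)"

lemma Gi:
  assumes "q \<in> \<Omega>1"
  shows "Gr q (Gi q a) = a" "Gi q (Gr q a) = a" "linear (Gi q)"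
proof -
  note q = \<Omega>1D[OF assms]
  have "surj (Gr q)" by (rule linear_injective_imp_surjective[OF linear_Gr[OF q(1)] q(3) refl])
  then show "Gr q (Gi q a) = a" unfolding Gi_def by (rule surj_f_inv_f)
  show "Gi q (Gr q a) = a" unfolding Gi_def by (rule inv_f_f[OF q(3)])
  show "linear (Gi q)" unfolding Gi_def by (rule inj_linear_imp_inv_linear[OF linear_Gr[OF q(1)] q(3)])
qed

lemma smooth_Gr: "smooth_on \<Omega> (\<lambda>q. Gr q a)"
  unfolding Gr_def
  by (intro smooth_on_sum[OF open_\<Omega>] smooth_on_scaleR[OF open_\<Omega>] smooth_on_const
      smooth_on_bilinear[OF open_\<Omega> QxR.bounded] smooth_w)

lemma smooth_Gi: "smooth_on \<Omega>1 (\<lambda>q. Gi q a)"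
  by (rule smooth_on_inverse_family[OF \<Omega>1(1), where L = Gr])
    (use linear_Gr \<Omega>1D Gi smooth_on_subset[OF smooth_Gr \<Omega>1(2)] in auto)

text \<open>The frame of \<open>T\<^sup>\<bottom>\<close> dual to \<open>w y0\<close>. Along \<open>T\<close> the space \<open>f\<^sub>* T\<^sup>\<bottom>\<close> does not change, so this
  normalized frame is constant along \<open>T\<close>.\<close>

definition et where "et q a = e q (Gi q a)"

definition wt where "wt q a = w q (Gi q a)"

lemma wt_eq: "q \<in> \<Omega>1 \<Longrightarrow> wt q a = Df q (et q a)"
  by (simp add: wt_def et_def w_eq \<Omega>1D)

lemma dh_et: assumes "q \<in> \<Omega>1" shows "dh q (et q a) = 0"
  unfolding wt_eq[OF assms, symmetric] by (simp add: wt_def snd_w)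

lemma wt_dual: "q \<in> \<Omega>1 \<Longrightarrow> b (wt q a) (w y0 c) = a \<bullet> c"
  using Gr_inner[of q "Gi q a" c] Gi(1)[of q a] by (simp add: wt_def)

lemma smooth_wt: "smooth_on \<Omega>1 (\<lambda>q. wt q a)"
  unfolding wt_def
  by (rule smooth_on_linear_family_apply[OF \<Omega>1(1), where L = w])
    (use linear_w \<Omega>1D smooth_Gi smooth_on_subset[OF smooth_w \<Omega>1(2)] in auto)

lemma smooth_et: "smooth_on \<Omega>1 (\<lambda>q. et q a)"
  unfolding et_def
  by (rule smooth_on_linear_family_apply[OF \<Omega>1(1), where L = e])
    (use linear_e \<Omega>1D smooth_Gi smooth_on_subset[OF smooth_e \<Omega>1(2)] in auto)

text \<open>As \<open>wt\<close> is the image of \<open>et\<close> under Df, its derivative along T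
  is D^2 f(T, et) plus the image under Df of the derivative of \<open>et\<close>. The second term is
  tangent to f, and the first has no normal component by \<open>II_T\<close>, because
  \<open>et\<close> lies in ker dh.\<close>

lemma derivative_wt_normal:
  assumes q: "q \<in> \<Omega>1" and \<zeta>: "\<zeta> \<in> tangent (QxR \<epsilon>) (f q)" "\<And>v. b (Df q v) \<zeta> = 0"
  shows "b (fD (\<lambda>q. wt q a) q (T q)) \<zeta> = 0"
proof -
  note q' = \<Omega>1D[OF q]
  let ?u = "\<lambda>q. et q a"
  have 1: "((\<lambda>q. ?u q \<bullet> i) has_derivative (\<lambda>v. fD ?u q v \<bullet> i)) (at q)" for i
    by (rule has_derivative_inner_left[OF smooth_on_has_derivative[OF smooth_et q]])
  have 2: "((\<lambda>q. Df q i) has_derivative fD (\<lambda>q. Df q i) q) (at q)" for i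
    by (rule smooth_on_has_derivative[OF smooth_on_fD[OF smooth_f] q'(1)])
  have "((\<lambda>q. \<Sum>i\<in>Basis. (?u q \<bullet> i) *\<^sub>R Df q i) has_derivative
      (\<lambda>v. \<Sum>i\<in>Basis. (?u q \<bullet> i) *\<^sub>R fD (\<lambda>q. Df q i) q v + (fD ?u q v \<bullet> i) *\<^sub>R Df q i)) (at q)"
    by (intro has_derivative_sum has_derivative_scaleR 1 2)
  then have "((\<lambda>q. wt q a) has_derivative
      (\<lambda>v. \<Sum>i\<in>Basis. (?u q \<bullet> i) *\<^sub>R fD (\<lambda>q. Df q i) q v + (fD ?u q v \<bullet> i) *\<^sub>R Df q i)) (at q)"
    by (rule has_derivative_transform_within_open[OF _ \<Omega>1(1) q])
      (simp add: wt_eq linear_basis_expansion[OF linear_Df[OF \<Omega>1D(1)], symmetric])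
  then have "fD (\<lambda>q. wt q a) q (T q)
      = (\<Sum>i\<in>Basis. (?u q \<bullet> i) *\<^sub>R fD (\<lambda>q. Df q i) q (T q)) + (\<Sum>i\<in>Basis. (fD ?u q (T q) \<bullet> i) *\<^sub>R Df q i)"
    by (simp add: fD_eqI sum.distrib)
  also have "(\<Sum>i\<in>Basis. (?u q \<bullet> i) *\<^sub>R fD (\<lambda>q. Df q i) q (T q)) = fD (\<lambda>x. Df x (?u q)) q (T q)"
    by (rule linear_basis_expansion[OF linear_fD_fD[OF open_\<Omega> smooth_f q'(1)], symmetric])
  finally show ?thesis
    using II_T[OF q'(1) dh_et[OF q] \<zeta>] by (simp add: QxR.simps \<zeta>(2))
qed

text \<open>For \<epsilon> \<noteq> 0, differentiating the orthogonality of \<open>wt\<close> and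
  the position vector along T leaves the product of \<open>wt\<close> with the horizontal part of
  f_* T. This is their full product, as \<open>wt\<close> has no height component, and it vanishes
  because \<open>wt\<close> is orthogonal to T. For \<epsilon> = 0 the first coordinate of
  \<open>wt\<close> vanishes identically.\<close>

lemma derivative_wt_tangent:
  assumes q: "q \<in> \<Omega>1"
  shows "fD (\<lambda>q. wt q a) q (T q) \<in> tangent (QxR \<epsilon>) (f q)"
proof -
  note q' = \<Omega>1D[OF q]
  let ?z = "fD (\<lambda>q. wt q a) q"
  have dw: "((\<lambda>q. fst (wt q a)) has_derivative (\<lambda>v. fst (?z v))) (at q)"
    by (rule has_derivative_fst[OF smooth_on_has_derivative[OF smooth_wt q]])
  have df: "((\<lambda>q. fst (f q)) has_derivative (\<lambda>v. fst (Df q v))) (at q)"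
    by (rule has_derivative_fst[OF Df[OF q'(1)]])
  have tan: "fst (wt q a) \<in> tangent (Q \<epsilon>) (fst (f q))" if "q \<in> \<Omega>1" for q
    using Df_tangent[OF \<Omega>1D(1)[OF that], of "et q a"] wt_eq[OF that, of a] by (auto simp: Q_simps(5) mem_Times_iff)
  show ?thesis
  proof (cases "\<epsilon> = 0")
    case True
    have "((\<lambda>q. fst (fst (wt q a))) has_derivative (\<lambda>v. fst (fst (?z v)))) (at q)"
      by (rule has_derivative_fst[OF dw])
    then have "fst (fst (?z (T q))) = 0"
      by (rule has_derivative_directional_zero[OF _ \<Omega>1(1) q]) (use tan True in \<open>auto simp: Q_simps\<close>)
    then show ?thesis using True by (simp add: Q_simps mem_Times_iff)
  next
    case False
    have "((\<lambda>q. Q_form \<epsilon> (fst (f q)) (fst (wt q a))) has_derivative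
        (\<lambda>v. Q_form \<epsilon> (fst (f q)) (fst (?z v)) + Q_form \<epsilon> (fst (Df q v)) (fst (wt q a)))) (at q)"
      by (rule bounded_bilinear.FDERIV[OF Q_form_bilinear df dw])
    then have "Q_form \<epsilon> (fst (f q)) (fst (?z (T q))) + Q_form \<epsilon> (fst (Df q (T q))) (fst (wt q a)) = 0"
      by (rule has_derivative_directional_zero[OF _ \<Omega>1(1) q]) (use tan False in \<open>auto simp: Q_simps\<close>)
    moreover have "Q_form \<epsilon> (fst (Df q (T q))) (fst (wt q a)) = 0"
    proof -
      have "b (Df q (et q a)) (Df q (T q)) = 0" using form_T[OF q'(1)] dh_et[OF q] by simp
      then have "b (wt q a) (Df q (T q)) = 0" by (simp add: wt_eq[OF q])
      moreover have "snd (wt q a) = 0" by (simp add: wt_def snd_w)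
      ultimately show ?thesis by (simp add: Q_simps Q_form_sym[of _ "fst (wt q a)"])
    qed
    ultimately show ?thesis using False by (simp add: Q_simps mem_Times_iff)
  qed
qed

text \<open>The derivative is tangent to f and has no height component, so it equals
  \<open>w q c\<close> for some \<open>c\<close>. Its products with the fixed frame
  \<open>w y0\<close> are derivatives of constants by \<open>wt_dual\<close>, whence
  \<open>Gr q c = 0\<close> and \<open>c = 0\<close>.\<close>

lemma derivative_wt_T:
  assumes q: "q \<in> \<Omega>1"
  shows "fD (\<lambda>q. wt q a) q (T q) = 0"
proof -
  note q' = \<Omega>1D[OF q]
  let ?z = "fD (\<lambda>q. wt q a) q"
  have dz: "((\<lambda>q. wt q a) has_derivative ?z) (at q)" by (rule smooth_on_has_derivative[OF smooth_wt q])
  have "?z (T q) \<in> range (fD f q)"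
    by (rule QxR.double_orthogonal_in_range[OF f_locus[OF q'(1)] linear_Df[OF q'(1)] _ derivative_wt_tangent[OF q]
          derivative_wt_normal[OF q]]) (use Df_tangent[OF q'(1)] in auto)
  then obtain u where u: "?z (T q) = Df q u" by blast
  have "snd (?z (T q)) = 0"
    by (rule has_derivative_directional_zero[OF has_derivative_snd[OF dz] \<Omega>1(1) q, of 0]) (simp add: wt_def snd_w)
  then obtain c where c: "u = e q c" using kernel_dh[OF q'(1,2), of u] u by auto
  have "Gr q c \<bullet> i = 0" for i
  proof -
    have "((\<lambda>q. b (wt q a) (w y0 i)) has_derivative (\<lambda>v. b (?z v) (w y0 i))) (at q)"
      using bounded_bilinear.FDERIV[OF QxR.bounded dz has_derivative_const[of "w y0 i"]] by (simp add: QxR.zero_right)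
    then have "b (?z (T q)) (w y0 i) = 0"
      by (rule has_derivative_directional_zero[OF _ \<Omega>1(1) q]) (rule wt_dual)
    then show ?thesis by (simp add: Gr_inner u c w_eq[OF q'(1)])
  qed
  then have "Gr q c = 0" by (metis inner_eq_zero_iff)
  then have "c = 0" using injD[OF q'(3), of c 0] linear_0[OF linear_Gr[OF q'(1)]] by simp
  then show ?thesis using u c linear_0[OF linear_e[OF q'(1)]] by (simp add: Df_simps[OF q'(1)])
qed

text \<open>Coordinates of the point in which the affine space through \<open>f q\<close> orthogonal to \<open>f\<^sub>* T\<^sup>\<bottom>\<close> meets the
  affine space through \<open>f y0\<close> spanned by \<open>w y0\<close>.\<close>

definition x where "x q = (\<Sum>c\<in>Basis. b (f q - f y0) (wt q c) *\<^sub>R c)"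

lemma smooth_x: "smooth_on \<Omega>1 x"
  unfolding x_def
  by (intro smooth_on_sum[OF \<Omega>1(1)] smooth_on_scaleR[OF \<Omega>1(1)] smooth_on_const
      smooth_on_bilinear[OF \<Omega>1(1) QxR.bounded] smooth_wt smooth_on_diff[OF \<Omega>1(1)] smooth_on_subset[OF smooth_f \<Omega>1(2)])

lemma Dx:
  assumes q: "q \<in> \<Omega>1"
  shows "fD x q v = (\<Sum>c\<in>Basis. (b (f q - f y0) (fD (\<lambda>q. wt q c) q v) + b (Df q v) (wt q c)) *\<^sub>R c)"
proof -
  note q' = \<Omega>1D[OF q]
  have "((\<lambda>q. f q - f y0) has_derivative fD f q) (at q)"
    using has_derivative_diff[OF Df[OF q'(1)] has_derivative_const[of "f y0"]] by simp
  from bounded_bilinear.FDERIV[OF QxR.bounded this smooth_on_has_derivative[OF smooth_wt q]]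
  have "((\<lambda>q. b (f q - f y0) (wt q c)) has_derivative
      (\<lambda>v. b (f q - f y0) (fD (\<lambda>q. wt q c) q v) + b (Df q v) (wt q c))) (at q)" for c .
  then have "(x has_derivative (\<lambda>v. \<Sum>c\<in>Basis. (b (f q - f y0) (fD (\<lambda>q. wt q c) q v) + b (Df q v) (wt q c)) *\<^sub>R c)) (at q)"
    unfolding x_def by (intro has_derivative_sum has_derivative_scaleR_left)
  then show ?thesis by (simp add: fD_eqI)
qed

text \<open>Neither factor of \<open>b (f q - f y0) (wt q c)\<close> contributes along T:
  \<open>wt\<close> is constant, and f_* T is orthogonal to \<open>wt\<close>.\<close>

lemma Dx_T: assumes q: "q \<in> \<Omega>1" shows "fD x q (T q) = 0"
proof -
  have "b (Df q (T q)) (wt q c) = 0" for c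
    using form_T[OF \<Omega>1D(1)[OF q], of "et q c"] dh_et[OF q, of c] QxR.sym by (simp add: wt_eq[OF q])
  then show ?thesis by (simp add: Dx[OF q] derivative_wt_T[OF q] QxR.simps)
qed

definition Xi where "Xi q = (x q, snd (f q))"

lemma smooth_Xi: "smooth_on \<Omega>1 Xi"
  unfolding Xi_def
  by (intro smooth_on_Pair[OF \<Omega>1(1)] smooth_x smooth_on_linear_compose[OF \<Omega>1(1) bounded_linear_snd]
      smooth_on_subset[OF smooth_f \<Omega>1(2)])

lemma DXi: assumes q: "q \<in> \<Omega>1" shows "fD Xi q v = (fD x q v, dh q v)"
proof -
  have "(Xi has_derivative (\<lambda>v. (fD x q v, dh q v))) (at q)"
    unfolding Xi_def
    by (intro has_derivative_Pair smooth_on_has_derivative[OF smooth_x q] has_derivative_snd Df \<Omega>1D(1)[OF q])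
  then show ?thesis by (simp add: fD_eqI)
qed

text \<open>At \<open>y0\<close> the factor \<open>f q - f y0\<close> vanishes, so only products
  with \<open>wt y0 c\<close> remain, and by duality the derivative of \<open>x\<close> in direction
  \<open>e y0 a\<close> is \<open>a\<close>. These directions exhaust ker dh, which is where the
  height component leaves the kernel of the differential.\<close>

lemma inj_DXi: "inj (fD Xi y0)"
  unfolding linear_injective_0[OF smooth_on_linear_fD[OF smooth_Xi \<Omega>1(3)]]
proof (intro allI impI)
  fix v assume "fD Xi y0 v = 0"
  then have v: "fD x y0 v = 0" "dh y0 v = 0" by (simp_all add: DXi[OF \<Omega>1(3)] zero_prod_def)
  obtain a where a: "v = e y0 a" using kernel_dh[OF y0 _ v(2)] dh_v0 by auto
  have "fD x y0 v = (\<Sum>c\<in>Basis. (a \<bullet> c) *\<^sub>R c)"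
    unfolding Dx[OF \<Omega>1(3)]
    using wt_dual[OF \<Omega>1(3)] QxR.sym[of "Df y0 v"] by (simp add: QxR.simps a flip: w_eq[OF y0]) (simp add: QxR.sym[of "w y0 a"] inner_commute)
  then have "a = 0" using v(1) by (simp add: euclidean_representation)
  then show "v = 0" using a linear_0[OF linear_e[OF y0]] by simp
qed

text \<open>The neighbourhood is cut down to a product of a ball and an interval: vanishing
  derivatives are to imply constancy, in \<open>D\<close> as well as in \<open>I\<close>.\<close>

lemma local_coordinates:
  assumes dim: "DIM('m) = DIM('p) + 1"
  obtains U D I \<Theta> where "open U" "y0 \<in> U" "U \<subseteq> \<Omega>1" "open D" "convex D" "D \<noteq> {}" "open_interval I" "Xi ` U = D \<times> I"
    "\<And>q. q \<in> U \<Longrightarrow> \<Theta> (Xi q) = q" "\<And>z. z \<in> D \<times> I \<Longrightarrow> \<Theta> z \<in> U \<and> Xi (\<Theta> z) = z" "smooth_on (D \<times> I) \<Theta>"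
proof -
  have dim': "DIM('m) = DIM('p \<times> real)" using dim by simp
  obtain U V \<Theta> where U: "open U" "y0 \<in> U" "U \<subseteq> \<Omega>1" and V: "open V" "Xi ` U = V"
    and \<Theta>: "\<And>q. q \<in> U \<Longrightarrow> \<Theta> (Xi q) = q" "\<And>z. z \<in> V \<Longrightarrow> \<Theta> z \<in> U \<and> Xi (\<Theta> z) = z" "smooth_on V \<Theta>"
    by (rule smooth_inverse_function[OF \<Omega>1(1) smooth_Xi \<Omega>1(3) inj_DXi dim']) blast
  have "Xi y0 \<in> V" using U V by blast
  then obtain A C where AC: "open A" "open C" "Xi y0 \<in> A \<times> C" "A \<times> C \<subseteq> V"
    using open_prod_elim[OF V(1)] by metis
  obtain r where r: "r > 0" "ball (fst (Xi y0)) r \<subseteq> A"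
    using AC(1,3) by (auto simp: mem_Times_iff open_contains_ball)
  obtain s where s: "s > 0" "ball (snd (Xi y0)) s \<subseteq> C"
    using AC(2,3) by (auto simp: mem_Times_iff open_contains_ball)
  define D where "D = ball (fst (Xi y0)) r"
  define I where "I = ball (snd (Xi y0)) s"
  have DI: "D \<times> I \<subseteq> V" using r s AC(4) by (auto simp: D_def I_def)
  define U' where "U' = U \<inter> Xi -` (D \<times> I)"
  show ?thesis
  proof (rule that)
    show "open U'" unfolding U'_def
      by (rule continuous_open_preimage[OF continuous_on_subset[OF smooth_on_continuous[OF smooth_Xi] U(3)] U(1)])
        (auto simp: D_def I_def intro: open_Times)
    show "y0 \<in> U'" using U(2) r s by (simp add: U'_def D_def I_def mem_Times_iff)
    show "U' \<subseteq> \<Omega>1" using U(3) by (auto simp: U'_def)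
    show "open D" "convex D" "D \<noteq> {}" using r by (simp_all add: D_def)
    show "open_interval I" using s
      by (auto simp: open_interval_def I_def is_interval_convex_1)
    show "Xi ` U' = D \<times> I"
    proof (intro equalityI subsetI)
      fix z assume z: "z \<in> D \<times> I"
      then have "z \<in> Xi ` U" using DI V(2) by auto
      then obtain u where "u \<in> U" "z = Xi u" by (rule imageE)
      then show "z \<in> Xi ` U'" using z by (simp add: U'_def)
    qed (auto simp: U'_def)
    show "\<Theta> (Xi q) = q" if "q \<in> U'" for q using \<Theta>(1) that by (simp add: U'_def)
    show "\<Theta> z \<in> U' \<and> Xi (\<Theta> z) = z" if "z \<in> D \<times> I" for z
      using \<Theta>(2)[of z] that DI by (auto simp: U'_def)
    show "smooth_on (D \<times> I) \<Theta>" using \<Theta>(3) DI by (rule smooth_on_subset)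
  qed
qed

end

section \<open>The immersion in product coordinates\<close>

locale class_A_product = class_A_frame \<epsilon> \<Omega> f T y0 J
  for \<epsilon> :: real and \<Omega> :: "'m::euclidean_space set" and f :: "'m \<Rightarrow> (real \<times> (real^'n)) \<times> real" and T :: "'m \<Rightarrow> 'm"
    and y0 :: 'm and J :: "'p::euclidean_space \<Rightarrow> 'm" +
  fixes U D I and \<Theta> :: "'p \<times> real \<Rightarrow> 'm"
  assumes U: "open U" "U \<subseteq> \<Omega>1" and D: "open D" and I: "open_interval I" and Xi_image: "Xi ` U = D \<times> I"
    and \<Theta>_Xi: "\<And>q. q \<in> U \<Longrightarrow> \<Theta> (Xi q) = q" and \<Theta>: "\<And>z. z \<in> D \<times> I \<Longrightarrow> \<Theta> z \<in> U" "\<And>z. z \<in> D \<times> I \<Longrightarrow> Xi (\<Theta> z) = z"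
    and smooth_\<Theta>: "smooth_on (D \<times> I) \<Theta>"
begin

lemma open_DI: "open (D \<times> I)"
  using D I by (simp add: open_Times open_interval_def)

lemma D\<Theta>: "z \<in> D \<times> I \<Longrightarrow> (\<Theta> has_derivative fD \<Theta> z) (at z)"
  by (rule smooth_on_has_derivative[OF smooth_\<Theta>])

lemma DXi_D\<Theta>:
  assumes z: "z \<in> D \<times> I"
  shows "fD Xi (\<Theta> z) (fD \<Theta> z v) = v" "fD \<Theta> z (fD Xi (\<Theta> z) u) = u"
proof -
  have q: "\<Theta> z \<in> U" "\<Theta> z \<in> \<Omega>1" using \<Theta>(1)[OF z] U(2) by auto
  have dXi: "(Xi has_derivative fD Xi (\<Theta> z)) (at (\<Theta> z))"
    by (rule smooth_on_has_derivative[OF smooth_Xi q(2)])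
  have "((\<lambda>z. Xi (\<Theta> z)) has_derivative (\<lambda>v. fD Xi (\<Theta> z) (fD \<Theta> z v))) (at z)"
    by (rule has_derivative_compose[OF D\<Theta>[OF z] dXi])
  then have "((\<lambda>z. z) has_derivative (\<lambda>v. fD Xi (\<Theta> z) (fD \<Theta> z v))) (at z)"
    by (rule has_derivative_transform_within_open[OF _ open_DI z]) (simp add: \<Theta>)
  from has_derivative_unique[OF this has_derivative_ident]
  show "fD Xi (\<Theta> z) (fD \<Theta> z v) = v" by (rule fun_cong)
  have "(\<Theta> has_derivative fD \<Theta> z) (at (Xi (\<Theta> z)))" using D\<Theta>[OF z] by (simp add: \<Theta>(2)[OF z])
  from has_derivative_compose[OF dXi this]
  have "((\<lambda>q. \<Theta> (Xi q)) has_derivative (\<lambda>u. fD \<Theta> z (fD Xi (\<Theta> z) u))) (at (\<Theta> z))" .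
  then have "((\<lambda>q. q) has_derivative (\<lambda>u. fD \<Theta> z (fD Xi (\<Theta> z) u))) (at (\<Theta> z))"
    by (rule has_derivative_transform_within_open[OF _ U(1) q(1)]) (simp add: \<Theta>_Xi)
  from has_derivative_unique[OF this has_derivative_ident]
  show "fD \<Theta> z (fD Xi (\<Theta> z) u) = u" by (rule fun_cong)
qed

definition F where "F z = f (\<Theta> z)"

lemma \<Theta>_\<Omega>: assumes "z \<in> D \<times> I" shows "\<Theta> z \<in> \<Omega>1" "\<Theta> z \<in> \<Omega>"
  using \<Theta>(1)[OF assms] U(2) \<Omega>1(2) by auto

lemma smooth_F: "smooth_on (D \<times> I) F"
  unfolding F_def using \<Theta>_\<Omega>(2) by (intro smooth_on_compose[OF open_DI open_\<Omega> smooth_\<Theta> _ smooth_f]) auto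

lemma DF: assumes z: "z \<in> D \<times> I" shows "fD F z v = Df (\<Theta> z) (fD \<Theta> z v)"
proof -
  have "(F has_derivative (\<lambda>v. Df (\<Theta> z) (fD \<Theta> z v))) (at z)"
    unfolding F_def by (rule has_derivative_compose[OF D\<Theta>[OF z] Df[OF \<Theta>_\<Omega>(2)[OF z]]])
  then show ?thesis by (simp add: fD_eqI)
qed

lemma snd_F: "z \<in> D \<times> I \<Longrightarrow> snd (F z) = snd z"
  using \<Theta>(2)[of z] unfolding Xi_def F_def by (metis snd_conv)

lemma dh_D\<Theta>: "z \<in> D \<times> I \<Longrightarrow> dh (\<Theta> z) (fD \<Theta> z v) = snd v"
  using DXi_D\<Theta>(1)[of z v] DXi[OF \<Theta>_\<Omega>(1), of z "fD \<Theta> z v"] by (metis snd_conv)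

lemma inj_DF: assumes z: "z \<in> D \<times> I" shows "inj (fD F z)"
proof (rule injI)
  fix u v assume "fD F z u = fD F z v"
  then have "fD \<Theta> z u = fD \<Theta> z v" using injD[OF inj_Df[OF \<Theta>_\<Omega>(2)[OF z]]] by (simp add: DF[OF z])
  then show "u = v" using DXi_D\<Theta>(1)[OF z] by metis
qed

text \<open>Along T the coordinate \<open>x\<close> is constant and the height grows at the rate
  dh(T) > 0, so the differential of \<open>Xi\<close> sends T, divided by this rate, to (0,
  1).\<close>

lemma D\<Theta>_last: assumes z: "z \<in> D \<times> I" shows "fD \<Theta> z (0, 1) = T (\<Theta> z) /\<^sub>R dh (\<Theta> z) (T (\<Theta> z))"
proof -
  let ?q = "\<Theta> z"
  note q = \<Theta>_\<Omega>[OF z]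
  have "fD Xi ?q (T ?q /\<^sub>R dh ?q (T ?q)) = fD Xi ?q (T ?q) /\<^sub>R dh ?q (T ?q)"
    by (rule linear_scale[OF smooth_on_linear_fD[OF smooth_Xi q(1)]])
  also have "\<dots> = (0, 1)" using dh_T_pos[OF q(2)] by (simp add: DXi[OF q(1)] Dx_T[OF q(1)])
  finally show ?thesis using DXi_D\<Theta>(2)[OF z, of "T ?q /\<^sub>R dh ?q (T ?q)"] by simp
qed

lemma orthogonal_DF: assumes z: "z \<in> D \<times> I" shows "b (fD F z (0, 1)) (fD F z (a, 0)) = 0"
proof -
  note q = \<Theta>_\<Omega>[OF z]
  have "b (Df (\<Theta> z) (fD \<Theta> z (a, 0))) (Df (\<Theta> z) (T (\<Theta> z))) = 0"
    using form_T[OF q(2), of "fD \<Theta> z (a, 0)"] dh_D\<Theta>[OF z, of "(a, 0)"] by simp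
  then show ?thesis
    by (simp add: DF[OF z] D\<Theta>_last[OF z] Df_simps[OF q(2)] QxR.scaleR_left QxR.sym[of "Df (\<Theta> z) (T (\<Theta> z))"])
qed

text \<open>A line with fixed \<open>y\<close> runs along T, where \<open>wt\<close> has derivative
  0, and the heights fill an interval.\<close>

lemma wt_constant:
  assumes y: "y \<in> D" and st: "s \<in> I" "t \<in> I"
  shows "wt (\<Theta> (y, s)) a = wt (\<Theta> (y, t)) a"
proof (rule has_derivative_zero_unique[of I])
  show "convex I" using I by (simp add: open_interval_def is_interval_convex)
  fix s assume s: "s \<in> I"
  have z: "(y, s) \<in> D \<times> I" using y s by simp
  note q = \<Theta>_\<Omega>[OF z]
  have "((\<lambda>s. (y, s)) has_derivative (\<lambda>r. (0, r))) (at s)"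
    by (intro has_derivative_Pair has_derivative_const has_derivative_ident)
  from has_derivative_compose[OF has_derivative_compose[OF this D\<Theta>[OF z]] smooth_on_has_derivative[OF smooth_wt q(1)]]
  have 1: "((\<lambda>s. wt (\<Theta> (y, s)) a) has_derivative (\<lambda>r. fD (\<lambda>q. wt q a) (\<Theta> (y, s)) (fD \<Theta> (y, s) (0, r)))) (at s)" .
  have "fD (\<lambda>q. wt q a) (\<Theta> (y, s)) (fD \<Theta> (y, s) (0, r)) = 0" for r
  proof -
    have "fD \<Theta> (y, s) (0, r) = r *\<^sub>R fD \<Theta> (y, s) (0, 1)"
      using linear_scale[OF smooth_on_linear_fD[OF smooth_\<Theta> z], of r "(0, 1)"] by simp
    then show ?thesis
      by (simp add: D\<Theta>_last[OF z] linear_scale[OF smooth_on_linear_fD[OF smooth_wt q(1)]] derivative_wt_T[OF q(1)])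
  qed
  with 1 show "((\<lambda>s. wt (\<Theta> (y, s)) a) has_derivative (\<lambda>h. 0)) (at s within I)"
    using has_derivative_at_withinI by fastforce
qed (use st in auto)

text \<open>Because the last coordinate is the height, the differential of \<open>\<Theta>\<close>
  identifies the directions (a, 0) with ker dh. The tangent space of a slice is therefore the space
  spanned by the normalized frame.\<close>

lemma DF_slice:
  assumes z: "z \<in> D \<times> I"
  shows "\<exists>c. fD F z (a, 0) = wt (\<Theta> z) c" "\<exists>a. wt (\<Theta> z) c = fD F z (a, 0)"
proof -
  note q = \<Theta>_\<Omega>[OF z] and q1 = \<Omega>1D[OF \<Theta>_\<Omega>(1)[OF z]]
  obtain a' where "fD \<Theta> z (a, 0) = e (\<Theta> z) a'"
    using kernel_dh[OF q1(1,2), of "fD \<Theta> z (a, 0)"] dh_D\<Theta>[OF z, of "(a, 0)"] by auto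
  then have "fD F z (a, 0) = wt (\<Theta> z) (Gr (\<Theta> z) a')"
    by (simp add: DF[OF z] wt_def Gi[OF q(1)] w_eq[OF q(2)])
  then show "\<exists>c. fD F z (a, 0) = wt (\<Theta> z) c" by blast
  let ?u = "et (\<Theta> z) c"
  have "fD Xi (\<Theta> z) ?u = (fD x (\<Theta> z) ?u, 0)" by (simp add: DXi[OF q(1)] dh_et[OF q(1)])
  then have "?u = fD \<Theta> z (fD x (\<Theta> z) ?u, 0)" using DXi_D\<Theta>(2)[OF z, of ?u] by simp
  then have "wt (\<Theta> z) c = fD F z (fD x (\<Theta> z) ?u, 0)" unfolding DF[OF z] wt_eq[OF q(1)] by simp
  then show "\<exists>a. wt (\<Theta> z) c = fD F z (a, 0)" by blast
qed

text \<open>The vectors \<open>wt (\<Theta> (y, s)) c\<close> fill the tangent space of the slice at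
  height \<open>s\<close> and do not depend on \<open>s\<close>.\<close>

lemma DF_slice_parallel:
  assumes y: "y \<in> D" and st: "s \<in> I" "t \<in> I"
  shows "\<exists>a'. fD F (y, s) (a, 0) = fD F (y, t) (a', 0)"
proof -
  obtain c where "fD F (y, s) (a, 0) = wt (\<Theta> (y, s)) c" using DF_slice(1)[of "(y, s)"] y st by auto
  then show ?thesis using DF_slice(2)[of "(y, t)" c] y st wt_constant[OF y st] by auto
qed

end

section \<open>Parallel normal fields\<close>

definition domain_manifold :: "'p set \<Rightarrow> ('p::euclidean_space, 'p) manifold" where
  "domain_manifold D = \<lparr>points = top_of_set D, atlas = {(D, id)}\<rparr>"

lemma domain_manifold_simps: "points (domain_manifold D) = top_of_set D" "atlas (domain_manifold D) = {(D, id)}"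
  by (simp_all add: domain_manifold_def)

lemma in_coords_domain: "y \<in> D \<Longrightarrow> in_coords (D, id) f y = f y"
  using in_coords_apply[of "(D, id)" y f] by simp

lemma differential_domain: "open D \<Longrightarrow> y \<in> D \<Longrightarrow> differential (D, id) f y = fD f y"
  unfolding differential_def[abs_def] by simp (rule fD_cong_open, auto simp: in_coords_domain)

lemma smooth_manifold_domain:
  assumes "open (D :: 'p::euclidean_space set)"
  shows "smooth_manifold DIM('p) (domain_manifold D)"
  unfolding smooth_manifold_def domain_manifold_simps
proof (intro conjI)
  show "\<exists>B::'p set. finite B \<and> independent B \<and> span B = UNIV \<and> card B = DIM('p)"
    by (intro exI[of _ Basis]) (simp add: independent_Basis)
  show "Hausdorff_space (top_of_set D)" by (simp add: Hausdorff_space_subtopology)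
  show "second_countable (top_of_set D)" by (rule second_countable_top_of_set)
  show "\<forall>(U, \<phi>)\<in>{(D, id)}. \<forall>(V, \<psi>)\<in>{(D, id)}. smooth_on (\<phi> ` (U \<inter> V)) (in_coords (U, \<phi>) \<psi>)"
    using smooth_on_cong[OF assms _ smooth_on_ident, of "in_coords (D, id) id"]
    by (simp add: in_coords_domain)
qed (use assms in \<open>simp_all add: subtopology_subtopology\<close>)

lemma smooth_map_domain: "open D \<Longrightarrow> smooth_map_on (domain_manifold D) D f \<longleftrightarrow> smooth_on D f"
  unfolding smooth_map_on_def domain_manifold_simps
  using smooth_on_cong[of D f "in_coords (D, id) f"] smooth_on_cong[of D "in_coords (D, id) f" f]
  by (auto simp: in_coords_domain)

section \<open>Parallel normal fields along an immersion of a convex domain\<close>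

locale immersed_domain =
  fixes \<epsilon> :: real and D :: "'p::euclidean_space set" and g :: "'p \<Rightarrow> real \<times> (real^'n)"
  assumes eps: "\<epsilon> \<in> {-1, 0, 1}" and D: "open D" "convex D" "D \<noteq> {}" and smooth_g: "smooth_on D g"
    and g_locus: "\<And>x. x \<in> D \<Longrightarrow> g x \<in> locus (Q \<epsilon>)" and inj_Dg: "\<And>x. x \<in> D \<Longrightarrow> inj (fD g x)"
begin

sublocale Q: ambient_space "Q \<epsilon> :: (real \<times> (real^'n)) ambient" by (rule ambient_space_Q[OF eps])

lemmas Q_form_simps = Q.simps[unfolded Q_simps]

lemma Dg: "x \<in> D \<Longrightarrow> (g has_derivative fD g x) (at x)"
  by (rule smooth_on_has_derivative[OF smooth_g])

lemma linear_Dg: "x \<in> D \<Longrightarrow> linear (fD g x)"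
  by (rule smooth_on_linear_fD[OF smooth_g])

lemma range_Dg_subspace: "x \<in> D \<Longrightarrow> subspace (range (fD g x))"
  by (rule linear_subspace_image[OF linear_Dg subspace_UNIV])

lemma Dg_tangent: "x \<in> D \<Longrightarrow> fD g x v \<in> tangent (Q \<epsilon>) (g x)"
  by (rule derivative_in_tangent_Q[OF eps Dg D(1)]) (auto simp: g_locus)

text \<open>The flat derivative of a normal field is already tangent to \<open>Q \<epsilon>\<close>,
  so parallelism in the normal connection means that it lies in the image of the differential of
  \<open>g\<close>. In this form the condition is free of projections and visibly linear in the
  field.\<close>

definition parallel :: "('p \<Rightarrow> real \<times> (real^'n)) \<Rightarrow> bool" where
  "parallel \<xi> \<longleftrightarrow> smooth_on D \<xi> \<and> (\<forall>x\<in>D. \<xi> x \<in> tangent (Q \<epsilon>) (g x) \<and>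
     (\<forall>v. Q_form \<epsilon> (fD g x v) (\<xi> x) = 0) \<and> (\<forall>v. fD \<xi> x v \<in> range (fD g x)))"

lemma parallelD:
  assumes "parallel \<xi>"
  shows "smooth_on D \<xi>" "x \<in> D \<Longrightarrow> \<xi> x \<in> tangent (Q \<epsilon>) (g x)" "x \<in> D \<Longrightarrow> Q_form \<epsilon> (fD g x v) (\<xi> x) = 0"
    "x \<in> D \<Longrightarrow> fD \<xi> x v \<in> range (fD g x)"
  using assms unfolding parallel_def by blast+

lemma parallel_zero: "parallel (\<lambda>x. 0)"
  unfolding parallel_def
  using range_Dg_subspace Q.tangent_subspace[OF g_locus] by (auto simp: smooth_on_const Q_form_simps subspace_0)

lemma parallel_scaleR:
  assumes "parallel \<xi>" shows "parallel (\<lambda>x. r *\<^sub>R \<xi> x)"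
proof -
  note p = parallelD[OF assms]
  have "smooth_on D (\<lambda>x. r *\<^sub>R \<xi> x)" by (intro smooth_on_scaleR[OF D(1)] smooth_on_const p(1))
  moreover have "fD (\<lambda>x. r *\<^sub>R \<xi> x) x v = r *\<^sub>R fD \<xi> x v" if "x \<in> D" for x v
    using fD_eqI[OF has_derivative_scaleR_right[OF smooth_on_has_derivative[OF p(1) that]]] by simp
  ultimately show ?thesis
    unfolding parallel_def using p subspace_scale[OF range_Dg_subspace] subspace_scale[OF Q.tangent_subspace[OF g_locus]]
    by (simp add: Q_form_simps)
qed

lemma parallel_add:
  assumes "parallel \<xi>" "parallel \<eta>" shows "parallel (\<lambda>x. \<xi> x + \<eta> x)"
proof -
  note p = parallelD[OF assms(1)] and q = parallelD[OF assms(2)]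
  have "smooth_on D (\<lambda>x. \<xi> x + \<eta> x)" by (intro smooth_on_add[OF D(1)] p(1) q(1))
  moreover have "fD (\<lambda>x. \<xi> x + \<eta> x) x v = fD \<xi> x v + fD \<eta> x v" if "x \<in> D" for x v
    using fD_eqI[OF has_derivative_add[OF smooth_on_has_derivative[OF p(1) that] smooth_on_has_derivative[OF q(1) that]]] by simp
  ultimately show ?thesis
    unfolding parallel_def using p q subspace_add[OF range_Dg_subspace] subspace_add[OF Q.tangent_subspace[OF g_locus]]
    by (simp add: Q_form_simps)
qed

lemma parallel_sum: "(\<And>i. i \<in> A \<Longrightarrow> parallel (\<xi> i)) \<Longrightarrow> parallel (\<lambda>x. \<Sum>i\<in>A. \<xi> i x)"
  by (induction A rule: infinite_finite_induct) (simp_all add: parallel_zero parallel_add)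

lemma constant_if_derivative_zero:
  fixes u :: "'p \<Rightarrow> 'z::real_normed_vector"
  assumes "\<And>x. x \<in> D \<Longrightarrow> (u has_derivative u' x) (at x)" "\<And>x v. x \<in> D \<Longrightarrow> u' x v = 0" "x \<in> D" "y \<in> D"
  shows "u x = u y"
proof (rule has_derivative_zero_unique[OF D(2) _ assms(3,4)])
  fix x assume x: "x \<in> D"
  have "u' x = (\<lambda>v. 0)" using assms(2)[OF x] by blast
  then show "(u has_derivative (\<lambda>h. 0)) (at x within D)"
    using has_derivative_at_withinI[OF assms(1)[OF x]] by simp
qed

text \<open>In the derivative of the product each term pairs a normal vector with a vector in the
  image of the differential of \<open>g\<close>.\<close>

lemma parallel_product_constant:
  assumes "parallel \<xi>" "parallel \<eta>" "x \<in> D" "y \<in> D"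
  shows "Q_form \<epsilon> (\<xi> x) (\<eta> x) = Q_form \<epsilon> (\<xi> y) (\<eta> y)"
proof (rule constant_if_derivative_zero[OF _ _ assms(3,4)])
  note p = parallelD[OF assms(1)] and q = parallelD[OF assms(2)]
  fix x assume x: "x \<in> D"
  show "((\<lambda>x. Q_form \<epsilon> (\<xi> x) (\<eta> x)) has_derivative
      (\<lambda>v. Q_form \<epsilon> (\<xi> x) (fD \<eta> x v) + Q_form \<epsilon> (fD \<xi> x v) (\<eta> x))) (at x)"
    by (rule bounded_bilinear.FDERIV[OF Q_form_bilinear smooth_on_has_derivative[OF p(1) x] smooth_on_has_derivative[OF q(1) x]])
  fix v
  obtain a b where "fD \<xi> x v = fD g x a" "fD \<eta> x v = fD g x b" using p(4)[OF x, of v] q(4)[OF x, of v] by blast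
  then show "Q_form \<epsilon> (\<xi> x) (fD \<eta> x v) + Q_form \<epsilon> (fD \<xi> x v) (\<eta> x) = 0"
    using p(3)[OF x] q(3)[OF x] by (simp add: Q_form_sym[of _ "\<xi> x"])
qed

text \<open>A maximal orthonormal family of parallel normal fields spans all parallel normal fields
  with constant coefficients: a nonzero remainder would have constant length, so that it could be
  normalized and added to the family.\<close>

lemma maximal_parallel_frame:
  obtains k :: nat and \<xi> where "\<And>i. i \<in> {1..k} \<Longrightarrow> parallel (\<xi> i)"
    "\<And>i j x. i \<in> {1..k} \<Longrightarrow> j \<in> {1..k} \<Longrightarrow> x \<in> D \<Longrightarrow> Q_form \<epsilon> (\<xi> i x) (\<xi> j x) = (if i = j then 1 else 0)"
    "\<And>\<psi> x y. parallel \<psi> \<Longrightarrow> x \<in> D \<Longrightarrow> y \<in> D \<Longrightarrow> \<psi> x = (\<Sum>i=1..k. Q_form \<epsilon> (\<psi> y) (\<xi> i y) *\<^sub>R \<xi> i x)"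
proof -
  define P where "P k \<longleftrightarrow> (\<exists>\<xi>. (\<forall>i\<in>{1..k::nat}. parallel (\<xi> i)) \<and> (\<forall>x\<in>D. Q.orthonormal {1..k} (\<lambda>i. \<xi> i x)))" for k
  obtain x0 where x0: "x0 \<in> D" using D(3) by blast
  have bound: "k \<le> DIM(real \<times> (real^'n))" if "P k" for k
  proof -
    obtain \<xi> :: "nat \<Rightarrow> 'p \<Rightarrow> real \<times> (real^'n)" where "Q.orthonormal {1..k} (\<lambda>i. \<xi> i x0)"
      using \<open>P k\<close> x0 unfolding P_def by blast
    from Q.orthonormal_card_le[OF _ this] show ?thesis by simp
  qed
  have "P 0" unfolding P_def Q.orthonormal_def by simp
  then obtain k where k: "P k" "\<And>l. P l \<Longrightarrow> l \<le> k"
    using Nat.ex_has_greatest_nat[of P 0 "DIM(real \<times> (real^'n))"] bound by blast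
  then obtain \<xi> where \<xi>: "\<And>i. i \<in> {1..k} \<Longrightarrow> parallel (\<xi> i)" "\<And>x. x \<in> D \<Longrightarrow> Q.orthonormal {1..k} (\<lambda>i. \<xi> i x)"
    unfolding P_def by blast
  have o: "Q_form \<epsilon> (\<xi> i x) (\<xi> j x) = (if i = j then 1 else 0)" if "i \<in> {1..k}" "j \<in> {1..k}" "x \<in> D" for i j x
    using \<xi>(2)[OF that(3)] that(1,2) unfolding Q.orthonormal_def unfolding Q_simps by blast
  have "\<psi> x = (\<Sum>i=1..k. Q_form \<epsilon> (\<psi> y) (\<xi> i y) *\<^sub>R \<xi> i x)" if \<psi>: "parallel \<psi>" and x: "x \<in> D" and y: "y \<in> D" for \<psi> x y
  proof (rule ccontr)
    define c where "c i = Q_form \<epsilon> (\<psi> y) (\<xi> i y)" for i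
    define r where "r x = \<psi> x + (-1) *\<^sub>R (\<Sum>i=1..k. c i *\<^sub>R \<xi> i x)" for x
    assume "\<psi> x \<noteq> (\<Sum>i=1..k. Q_form \<epsilon> (\<psi> y) (\<xi> i y) *\<^sub>R \<xi> i x)"
    then have rx: "r x \<noteq> 0" by (simp add: r_def c_def)
    have r: "parallel r" unfolding r_def
      using \<xi>(1) by (intro parallel_add \<psi> parallel_scaleR parallel_sum) auto
    have r\<xi>: "Q_form \<epsilon> (r z) (\<xi> j z) = 0" if j: "j \<in> {1..k}" and z: "z \<in> D" for j z
    proof -
      have "form (Q \<epsilon>) (\<Sum>i=1..k. c i *\<^sub>R \<xi> i z) (\<xi> j z) = c j"
        by (rule Q.orthonormal_coefficient[OF _ \<xi>(2)[OF z] j]) simp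
      then have "Q_form \<epsilon> (r z) (\<xi> j z) = Q_form \<epsilon> (\<psi> z) (\<xi> j z) - c j"
        unfolding r_def Q_form_simps(1,7) by (simp add: Q_simps)
      then show ?thesis using parallel_product_constant[OF \<psi> \<xi>(1)[OF j] z y] by (simp add: c_def)
    qed
    define \<rho> where "\<rho> = Q_form \<epsilon> (r x) (r x)"
    have \<rho>: "\<rho> > 0" unfolding \<rho>_def
      using Q.form_pos[OF g_locus[OF x] parallelD(2)[OF r x] rx] by (simp add: Q_simps)
    have rr: "Q_form \<epsilon> (r z) (r z) = \<rho>" if "z \<in> D" for z
      unfolding \<rho>_def by (rule parallel_product_constant[OF r r that x])
    define \<xi>' where "\<xi>' = \<xi>(Suc k := (\<lambda>x. (1 / sqrt \<rho>) *\<^sub>R r x))"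
    have \<xi>'1: "\<xi>' i = \<xi> i" if "i \<in> {1..k}" for i using that by (simp add: \<xi>'_def)
    have \<xi>'2: "\<xi>' (Suc k) z = (1 / sqrt \<rho>) *\<^sub>R r z" for z by (simp add: \<xi>'_def)
    have split: "i \<in> {1..k} \<or> i = Suc k" if "i \<in> {1..Suc k}" for i using that by auto
    have "P (Suc k)" unfolding P_def
    proof (intro exI[of _ \<xi>'] conjI ballI)
      fix i assume "i \<in> {1..Suc k}"
      then show "parallel (\<xi>' i)"
        using split[of i] \<xi>(1) \<xi>'1 parallel_scaleR[OF r] by (auto simp: \<xi>'_def)
    next
      fix z assume z: "z \<in> D"
      show "Q.orthonormal {1..Suc k} (\<lambda>i. \<xi>' i z)"
        unfolding Q.orthonormal_def unfolding Q_simps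
      proof (intro ballI)
        fix i j assume "i \<in> {1..Suc k}" "j \<in> {1..Suc k}"
        then consider "i \<in> {1..k}" "j \<in> {1..k}" | "i = Suc k" "j \<in> {1..k}" | "i \<in> {1..k}" "j = Suc k" | "i = Suc k" "j = Suc k"
          using split by blast
        then show "Q_form \<epsilon> (\<xi>' i z) (\<xi>' j z) = (if i = j then 1 else 0)"
        proof cases
          case 1
          then show ?thesis using o z by (simp add: \<xi>'1)
        next
          case 2
          then show ?thesis using r\<xi> z by (simp add: \<xi>'1 \<xi>'2 Q_form_simps)
        next
          case 3
          then show ?thesis using r\<xi>[OF 3(1) z] Q_form_sym[of \<epsilon> "\<xi> i z" "r z"] by (simp add: \<xi>'1 \<xi>'2 Q_form_simps)
        next
          case 4
          then show ?thesis using rr[OF z] \<rho> by (simp add: \<xi>'2 Q_form_simps)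
        qed
      qed
    qed
    from k(2)[OF this] show False by simp
  qed
  from \<xi>(1) o this show ?thesis by (rule that)
qed

lemma isometric_immersion_g:
  "isometric_immersion_on (domain_manifold D) D (induced_metric (Q \<epsilon>) g) (Q \<epsilon>) g"
proof (rule Q.isometric_immersion_on_induced_metric[OF smooth_manifold_domain[OF D(1)]])
  show "openin (points (domain_manifold D)) D" by (simp add: domain_manifold_simps)
  show "smooth_map_on (domain_manifold D) D g" using smooth_g by (simp add: smooth_map_domain[OF D(1)])
  show "g ` D \<subseteq> locus (Q \<epsilon>)" using g_locus by blast
  fix c x assume "c \<in> atlas (domain_manifold D)" "x \<in> fst c \<inter> D"
  then have c: "c = (D, id)" "x \<in> D" by (auto simp: domain_manifold_simps)
  show "range (differential c g x) \<subseteq> tangent (Q \<epsilon>) (g x)"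
    using Dg_tangent[OF c(2)] by (auto simp: c differential_domain[OF D(1)])
  show "inj (differential c g x)" using inj_Dg[OF c(2)] by (simp add: c differential_domain[OF D(1)])
qed

text \<open>The normal projection annihilates the image of the differential of \<open>g\<close>,
  which contains the derivatives of the fields.\<close>

lemma orthonormal_parallel_normal_fieldsI:
  assumes "\<And>i. i \<in> {1..k} \<Longrightarrow> parallel (\<xi> i)"
    "\<And>i j x. i \<in> {1..k} \<Longrightarrow> j \<in> {1..k} \<Longrightarrow> x \<in> D \<Longrightarrow> Q_form \<epsilon> (\<xi> i x) (\<xi> j x) = (if i = j then 1 else 0)"
  shows "orthonormal_parallel_normal_fields (domain_manifold D) (Q \<epsilon>) g k \<xi>"
proof -
  have ns: "normal_space (Q \<epsilon>) (D, id) g x = {\<zeta> \<in> tangent (Q \<epsilon>) (g x). \<forall>v. Q_form \<epsilon> (fD g x v) \<zeta> = 0}" if "x \<in> D" for x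
    by (simp add: normal_space_def differential_domain[OF D(1) that] Q_simps(1))
  have "normal_derivative (Q \<epsilon>) (D, id) g (\<xi> i) x v = 0" if i: "i \<in> {1..k}" and x: "x \<in> D" for i x v
    unfolding normal_derivative_def differential_domain[OF D(1) x] Q.normal_part_eq_0_iff[of g x, OF g_locus[OF x]]
  proof
    fix \<zeta> assume \<zeta>: "\<zeta> \<in> normal_space (Q \<epsilon>) (D, id) g x"
    obtain a where "fD (\<xi> i) x v = fD g x a" using parallelD(4)[OF assms(1)[OF i] x, of v] by blast
    then show "form (Q \<epsilon>) (fD (\<xi> i) x v) \<zeta> = 0" using \<zeta> by (simp add: ns[OF x] Q_simps(1))
  qed
  then show ?thesis
    unfolding orthonormal_parallel_normal_fields_def domain_manifold_simps
    using assms parallelD(1-3)[OF assms(1)] by (simp add: ns Q_simps(1) smooth_map_domain[OF D(1), unfolded domain_manifold_def] domain_manifold_def)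
qed

end

section \<open>Reconstruction of the data g, \<xi> and \<alpha>\<close>

lemma (in class_A_product) construction_exists:
  assumes cD: "convex D" "D \<noteq> {}"
  obtains H g k \<xi> \<alpha> where "construction_data \<epsilon> DIM('p) (domain_manifold D) H g k \<xi> I \<alpha>"
    "\<And>z. z \<in> D \<times> I \<Longrightarrow> F z = constructed_map \<epsilon> g k \<xi> \<alpha> z"
proof -
  have oI: "open I" "convex I" "I \<noteq> {}" using I by (auto simp: open_interval_def is_interval_convex)
  obtain s0 where s0: "s0 \<in> I" using oI by blast
  obtain x0 where x0: "x0 \<in> D" using cD by blast
  define \<phi> where "\<phi> z = fst (F z)" for z
  define g where "g y = \<phi> (y, s0)" for y
  have smooth_\<phi>: "smooth_on (D \<times> I) \<phi>" unfolding \<phi>_def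
    by (rule smooth_on_linear_compose[OF open_DI bounded_linear_fst smooth_F])
  have smooth_slice: "smooth_on D (\<lambda>y. \<phi> (y, s))" if "s \<in> I" for s
    by (rule smooth_on_compose[OF D open_DI _ _ smooth_\<phi>])
      (use that in \<open>auto intro!: smooth_on_Pair[OF D] smooth_on_const smooth_on_ident\<close>)
  have smooth_curve: "smooth_on I (\<lambda>s. \<phi> (y, s))" if "y \<in> D" for y
    by (rule smooth_on_compose[OF oI(1) open_DI _ _ smooth_\<phi>])
      (use that in \<open>auto intro!: smooth_on_Pair[OF oI(1)] smooth_on_const smooth_on_ident\<close>)
  have DF': "(F has_derivative fD F z) (at z)" if "z \<in> D \<times> I" for z
    by (rule smooth_on_has_derivative[OF smooth_F that])
  have slice: "((\<lambda>y. \<phi> (y, s)) has_derivative (\<lambda>a. fst (fD F (y, s) (a, 0)))) (at y)"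
    and curve: "((\<lambda>s. \<phi> (y, s)) has_derivative (\<lambda>r. fst (fD F (y, s) (0, r)))) (at s)"
    if "y \<in> D" "s \<in> I" for y s
  proof -
    have "(F has_derivative fD F (y, s)) (at (y, s))" using DF' that by simp
    note \<phi> = has_derivative_fst[OF this, folded \<phi>_def]
    have "((\<lambda>y. (y, s)) has_derivative (\<lambda>a. (a, 0))) (at y)"
      by (intro has_derivative_Pair has_derivative_const has_derivative_ident)
    from has_derivative_compose[OF this \<phi>]
    show "((\<lambda>y. \<phi> (y, s)) has_derivative (\<lambda>a. fst (fD F (y, s) (a, 0)))) (at y)" .
    have "((\<lambda>s. (y, s)) has_derivative (\<lambda>r. (0, r))) (at s)"
      by (intro has_derivative_Pair has_derivative_const has_derivative_ident)
    from has_derivative_compose[OF this \<phi>]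
    show "((\<lambda>s. \<phi> (y, s)) has_derivative (\<lambda>r. fst (fD F (y, s) (0, r)))) (at s)" .
  qed
  have Dslice: "fD (\<lambda>y. \<phi> (y, s)) y a = fst (fD F (y, s) (a, 0))" if "y \<in> D" "s \<in> I" for y s a
    using fD_eqI[OF slice[OF that]] by simp
  have Dg_eq: "fD g y a = fst (fD F (y, s0) (a, 0))" if "y \<in> D" for y a
    unfolding g_def by (rule Dslice[OF that s0])
  have snd_slice: "snd (fD F (y, s) (a, 0)) = 0" if "y \<in> D" "s \<in> I" for y s a
    using DF[of "(y, s)" "(a, 0)"] dh_D\<Theta>[of "(y, s)" "(a, 0)"] that by simp
  have F_locus: "\<phi> z \<in> locus (Q \<epsilon>)" if "z \<in> D \<times> I" for z
    using f_locus[OF \<Theta>_\<Omega>(2)[OF that]] by (auto simp: \<phi>_def F_def Q_simps(3))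
  interpret immersed_domain \<epsilon> D g
  proof
    show "\<epsilon> \<in> {-1, 0, 1}" "open D" "convex D" "D \<noteq> {}" by (rule eps D cD)+
    show "smooth_on D g" unfolding g_def by (rule smooth_slice[OF s0])
    show "g y \<in> locus (Q \<epsilon>)" if "y \<in> D" for y unfolding g_def using that s0 by (intro F_locus) simp
    show "inj (fD g y)" if y: "y \<in> D" for y
    proof (rule injI)
      fix u v assume "fD g y u = fD g y v"
      then have "fD F (y, s0) (u, 0) = fD F (y, s0) (v, 0)"
        using snd_slice[OF y s0] by (simp add: Dg_eq[OF y] prod_eq_iff)
      then have "(u, 0::real) = (v, 0)" using y s0 by (intro injD[OF inj_DF[of "(y, s0)"]]) simp_all
      then show "u = v" by simp
    qed
  qed
  \<comment> \<open>At each \<open>y\<close> the horizontal slices at all heights share the tangent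
    space of \<open>g\<close>, in both directions of inclusion. All that follows rests on
    this.\<close>
  have to_g: "\<exists>a'. fD (\<lambda>y. \<phi> (y, s)) y a = fD g y a'" if "y \<in> D" "s \<in> I" for y s a
    using DF_slice_parallel[OF that s0, of a] by (auto simp: Dslice[OF that] Dg_eq[OF that(1)])
  have from_g: "\<exists>a'. fD g y a = fD (\<lambda>y. \<phi> (y, s)) y a'" if "y \<in> D" "s \<in> I" for y s a
    using DF_slice_parallel[OF that(1) s0 that(2), of a] by (auto simp: Dslice[OF that] Dg_eq[OF that(1)])
  \<comment> \<open>The position vector \<open>\<phi> (y, s)\<close> is orthogonal to the tangent
    space of its own slice, which is also that of \<open>g\<close> at \<open>y\<close>.\<close>
  have position: "Q_form \<epsilon> (\<phi> (y, s)) (fD g y a) = 0" if ne: "\<epsilon> \<noteq> 0" and y: "y \<in> D" and s: "s \<in> I" for y s a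
  proof -
    obtain a' where a': "fD g y a = fD (\<lambda>y. \<phi> (y, s)) y a'" using from_g[OF y s] by blast
    have "fst (fD F (y, s) (a', 0)) \<in> tangent (Q \<epsilon>) (\<phi> (y, s))"
      by (rule derivative_in_tangent_Q[OF eps slice[OF y s] D(1) y]) (use F_locus s in simp)
    then show ?thesis using ne by (simp add: a' Dslice[OF y s] Q_simps)
  qed
  \<comment> \<open>For \<epsilon> \<noteq> 0 this is the coefficient along \<open>g\<close>,
    because \<open>g\<close> has square \<epsilon> and \<epsilon>^2 = 1. It may be read off at
    \<open>x0\<close>: both terms in the derivative of the product of \<open>\<phi> (y, s)\<close>
    and \<open>g y\<close> vanish by \<open>position\<close>, at the heights \<open>s\<close> and
    \<open>s0\<close>. For \<epsilon> = 0 only differences of points are vectors, hence the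
    coefficient 1.\<close>
  define \<beta> where "\<beta> s = (if \<epsilon> = 0 then 1 else \<epsilon> * Q_form \<epsilon> (\<phi> (x0, s)) (g x0))" for s
  have \<beta>: "Q_form \<epsilon> (\<phi> (y, s)) (g y) = \<epsilon> * \<beta> s" if ne: "\<epsilon> \<noteq> 0" and y: "y \<in> D" and s: "s \<in> I" for y s
  proof -
    have "Q_form \<epsilon> (\<phi> (y, s)) (g y) = Q_form \<epsilon> (\<phi> (x0, s)) (g x0)"
    proof (rule constant_if_derivative_zero[OF _ _ y x0])
      fix y assume y: "y \<in> D"
      show "((\<lambda>y. Q_form \<epsilon> (\<phi> (y, s)) (g y)) has_derivative
        (\<lambda>v. Q_form \<epsilon> (\<phi> (y, s)) (fD g y v) + Q_form \<epsilon> (fD (\<lambda>y. \<phi> (y, s)) y v) (g y))) (at y)"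
        by (rule bounded_bilinear.FDERIV[OF Q_form_bilinear smooth_on_has_derivative[OF smooth_slice[OF s] y] smooth_on_has_derivative[OF smooth_g y]])
      fix v
      obtain a' where "fD (\<lambda>y. \<phi> (y, s)) y v = fD g y a'" using to_g[OF y s] by blast
      then show "Q_form \<epsilon> (\<phi> (y, s)) (fD g y v) + Q_form \<epsilon> (fD (\<lambda>y. \<phi> (y, s)) y v) (g y) = 0"
        using position[OF ne y s, of v] position[OF ne y s0, of a'] Q_form_sym[of \<epsilon> "g y"] by (simp add: g_def)
    qed
    then show ?thesis using ne eps by (auto simp: \<beta>_def)
  qed
  define \<psi> where "\<psi> s y = \<phi> (y, s) + (- \<beta> s) *\<^sub>R g y" for s y
  have parallel_\<psi>: "parallel (\<psi> s)" if s: "s \<in> I" for s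
    unfolding parallel_def
  proof (intro conjI ballI allI)
    show "smooth_on D (\<psi> s)" unfolding \<psi>_def
      by (intro smooth_on_add[OF D(1)] smooth_slice[OF s] smooth_on_scaleR[OF D(1)] smooth_on_const smooth_g)
    fix y assume y: "y \<in> D"
    show "\<psi> s y \<in> tangent (Q \<epsilon>) (g y)"
    proof (cases "\<epsilon> = 0")
      case True
      then show ?thesis using F_locus[of "(y, s)"] g_locus[OF y] y s by (simp add: Q_def \<psi>_def)
    next
      case False
      then show ?thesis
        using \<beta>[OF False y s] locus_Q_form[OF eps False g_locus[OF y]] Q_form_sym[of \<epsilon> "g y" "\<phi> (y, s)"]
        by (simp add: Q_simps \<psi>_def Q_form_simps)
    qed
    fix v
    show "Q_form \<epsilon> (fD g y v) (\<psi> s y) = 0"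
    proof (cases "\<epsilon> = 0")
      case True
      \<comment> \<open>For \<epsilon> = 0 the position vector carries no information. Instead the
        derivative of \<open>\<phi>\<close> in s is the horizontal part of a multiple of f_* T and
        thus orthogonal to the slice, so the product is constant in s and may be compared with the
        height \<open>s0\<close>, where the slice is \<open>g\<close>.\<close>
      have "Q_form \<epsilon> (fD g y v) (\<phi> (y, s)) = Q_form \<epsilon> (fD g y v) (\<phi> (y, s0))"
      proof (rule has_derivative_zero_unique[OF oI(2) _ s s0])
        fix s assume s: "s \<in> I"
        have "((\<lambda>s. Q_form \<epsilon> (fD g y v) (\<phi> (y, s))) has_derivative
          (\<lambda>r. Q_form \<epsilon> (fD g y v) (fst (fD F (y, s) (0, r))))) (at s)"
          using bounded_bilinear.FDERIV[OF Q_form_bilinear[of \<epsilon>] has_derivative_const[of "fD g y v"] curve[OF y s]]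
          by (simp add: Q_form_simps)
        moreover have "Q_form \<epsilon> (fD g y v) (fst (fD F (y, s) (0, r))) = 0" for r
        proof -
          obtain a' where a': "fD g y v = fD (\<lambda>y. \<phi> (y, s)) y a'" using from_g[OF y s] by blast
          have z: "(y, s) \<in> D \<times> I" using y s by simp
          have "fD F (y, s) (0, r) = r *\<^sub>R fD F (y, s) (0, 1)"
            using linear_scale[OF smooth_on_linear_fD[OF smooth_F z], of r "(0, 1)"] by simp
          then show ?thesis
            using orthogonal_DF[OF z, of a'] snd_slice[OF y s, of a']
              Q_form_sym[of \<epsilon> "fst (fD F (y, s) (a', 0))"]
            by (simp add: a' Dslice[OF y s] Q_simps Q_form_simps)
        qed
        ultimately show "((\<lambda>s. Q_form \<epsilon> (fD g y v) (\<phi> (y, s))) has_derivative (\<lambda>h. 0)) (at s within I)"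
          using has_derivative_at_withinI by fastforce
      qed
      moreover have "\<psi> s y = \<phi> (y, s) - \<phi> (y, s0)" using True by (simp add: \<psi>_def \<beta>_def g_def)
      ultimately show ?thesis by (simp add: Q_form_simps)
    next
      case False
      show ?thesis
        using position[OF False y s, of v] position[OF False y s0, of v] Q_form_sym[of \<epsilon> "fD g y v"]
        by (simp add: \<psi>_def Q_form_simps g_def)
    qed
    have "(\<psi> s has_derivative (\<lambda>v. fD (\<lambda>y. \<phi> (y, s)) y v + (- \<beta> s) *\<^sub>R fD g y v)) (at y)"
      unfolding \<psi>_def
      by (intro has_derivative_add has_derivative_scaleR_right smooth_on_has_derivative[OF smooth_slice[OF s] y]
          smooth_on_has_derivative[OF smooth_g y])
    then have "fD (\<psi> s) y v = fD (\<lambda>y. \<phi> (y, s)) y v + (- \<beta> s) *\<^sub>R fD g y v" by (simp add: fD_eqI)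
    moreover have "fD (\<lambda>y. \<phi> (y, s)) y v \<in> range (fD g y)" using to_g[OF y s, of v] by blast
    ultimately show "fD (\<psi> s) y v \<in> range (fD g y)"
      using range_Dg_subspace[OF y] by (simp only:) (intro subspace_add subspace_scale rangeI)
  qed
  obtain k :: nat and \<xi> where \<xi>: "\<And>i. i \<in> {1..k} \<Longrightarrow> parallel (\<xi> i)"
    "\<And>i j x. i \<in> {1..k} \<Longrightarrow> j \<in> {1..k} \<Longrightarrow> x \<in> D \<Longrightarrow> Q_form \<epsilon> (\<xi> i x) (\<xi> j x) = (if i = j then 1 else 0)"
    and span: "\<And>\<psi> x y. parallel \<psi> \<Longrightarrow> x \<in> D \<Longrightarrow> y \<in> D \<Longrightarrow> \<psi> x = (\<Sum>i=1..k. Q_form \<epsilon> (\<psi> y) (\<xi> i y) *\<^sub>R \<xi> i x)"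
    by (rule maximal_parallel_frame) blast
  \<comment> \<open>The last component is the identity because \<open>I\<close> is parametrized by
    the height. The components from 1 to \<open>k\<close> are the coefficients of
    \<open>\<psi> s\<close> in the maximal frame, evaluated at the base point
    \<open>x0\<close>.\<close>
  define \<alpha> where "\<alpha> i = (if i = 0 then \<beta> else if i \<le> k then (\<lambda>s. Q_form \<epsilon> (\<psi> s x0) (\<xi> i x0)) else (\<lambda>s. s))" for i
  have \<alpha>i: "\<alpha> i s = Q_form \<epsilon> (\<psi> s x0) (\<xi> i x0)" if "i \<in> {1..k}" for i s using that by (auto simp: \<alpha>_def)
  have \<phi>_eq: "\<phi> (y, s) = \<beta> s *\<^sub>R g y + (\<Sum>i=1..k. \<alpha> i s *\<^sub>R \<xi> i y)" if "y \<in> D" "s \<in> I" for y s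
  proof -
    have "\<psi> s y = (\<Sum>i=1..k. Q_form \<epsilon> (\<psi> s x0) (\<xi> i x0) *\<^sub>R \<xi> i y)"
      by (rule span[OF parallel_\<psi>[OF that(2)] that(1) x0])
    also have "\<dots> = (\<Sum>i=1..k. \<alpha> i s *\<^sub>R \<xi> i y)" by (intro sum.cong refl) (simp only: \<alpha>i)
    finally show ?thesis by (simp add: \<psi>_def algebra_simps)
  qed
  have smooth_\<beta>: "smooth_on I \<beta>"
  proof (cases "\<epsilon> = 0")
    case False
    have "smooth_on I (\<lambda>s. \<epsilon> *\<^sub>R Q_form \<epsilon> (\<phi> (x0, s)) (g x0))"
      by (intro smooth_on_scaleR[OF oI(1)] smooth_on_const smooth_on_bilinear[OF oI(1) Q_form_bilinear] smooth_curve x0)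
    then show ?thesis using False by (simp add: \<beta>_def[abs_def])
  qed (simp add: \<beta>_def[abs_def] smooth_on_const)
  have "smooth_on I (\<lambda>s. - \<beta> s)"
    using smooth_\<beta> unfolding smooth_on_def by (intro allI Ck_on_minus[OF oI(1)]) blast
  then have "smooth_on I (\<lambda>s. \<psi> s x0)" unfolding \<psi>_def
    by (intro smooth_on_add[OF oI(1)] smooth_on_scaleR[OF oI(1)] smooth_on_const smooth_curve x0)
  then have smooth_\<alpha>: "smooth_on I (\<alpha> i)" for i
    unfolding \<alpha>_def using smooth_\<beta> smooth_on_ident
    by (auto intro!: smooth_on_bilinear[OF oI(1) Q_form_bilinear] smooth_on_const)
  have deriv: "deriv (\<alpha> (k + 1)) s = 1" for s by (simp add: \<alpha>_def)
  \<comment> \<open>The vectors \<open>g x0\<close> and \<open>\<xi> i x0\<close> are mutually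
    orthogonal with squares \<epsilon> and 1, so the left-hand side is the square of
    \<open>\<phi> (x0, s)\<close>, a point of the quadric.\<close>
  have curve_locus: "\<epsilon> * (\<alpha> 0 s)\<^sup>2 + (\<Sum>i=1..k. (\<alpha> i s)\<^sup>2) = \<epsilon>" if ne: "\<epsilon> \<noteq> 0" and s: "s \<in> I" for s
  proof -
    have \<psi>: "\<psi> s x0 = (\<Sum>i=1..k. Q_form \<epsilon> (\<psi> s x0) (\<xi> i x0) *\<^sub>R \<xi> i x0)"
      by (rule span[OF parallel_\<psi>[OF s] x0 x0])
    have "Q_form \<epsilon> (\<psi> s x0) (\<psi> s x0) = (\<Sum>i=1..k. Q_form \<epsilon> (\<psi> s x0) (\<xi> i x0) * Q_form \<epsilon> (\<psi> s x0) (\<xi> i x0))"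
      by (subst (2) \<psi>) (simp add: Q_form_simps)
    also have "\<dots> = (\<Sum>i=1..k. (\<alpha> i s)\<^sup>2)"
      by (intro sum.cong refl) (simp only: \<alpha>i power2_eq_square)
    finally have 1: "Q_form \<epsilon> (\<psi> s x0) (\<psi> s x0) = (\<Sum>i=1..k. (\<alpha> i s)\<^sup>2)" .
    have 2: "Q_form \<epsilon> (g x0) (\<psi> s x0) = 0"
      using parallelD(2)[OF parallel_\<psi>[OF s] x0] ne by (simp add: Q_simps)
    have 3: "Q_form \<epsilon> (g x0) (g x0) = \<epsilon>" by (rule locus_Q_form[OF eps ne g_locus[OF x0]])
    have "\<phi> (x0, s) = \<beta> s *\<^sub>R g x0 + \<psi> s x0" by (simp add: \<psi>_def)
    then have "Q_form \<epsilon> (\<phi> (x0, s)) (\<phi> (x0, s)) = \<epsilon> * (\<beta> s)\<^sup>2 + (\<Sum>i=1..k. (\<alpha> i s)\<^sup>2)"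
      using 1 2 3 Q_form_sym[of \<epsilon> "\<psi> s x0" "g x0"] by (simp add: Q_form_simps power2_eq_square)
    then show ?thesis using locus_Q_form[OF eps ne F_locus, of "(x0, s)"] x0 s by (simp add: \<alpha>_def)
  qed
  \<comment> \<open>Here \<open>\<beta> s\<close> is minus the product of two points of the upper
    sheet.\<close>
  have future: "\<alpha> 0 s > 0" if e: "\<epsilon> = -1" and s: "s \<in> I" for s
  proof -
    have "\<phi> (x0, s) \<in> locus (Q (-1))" "g x0 \<in> locus (Q (-1))"
      using F_locus[of "(x0, s)"] g_locus[OF x0] x0 s unfolding e by auto
    then have "Q_form (-1) (\<phi> (x0, s)) (g x0) < 0"
      by (intro hyperboloid_product_neg) (auto simp: Q_def)
    then show ?thesis by (simp add: \<alpha>_def \<beta>_def e)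
  qed
  have adm: "admissible_curve \<epsilon> k I \<alpha>"
    unfolding admissible_curve_def Let_def
    using smooth_\<alpha> deriv curve_locus future by (auto intro!: bexI[of _ "k + 1"])
  have data: "construction_data \<epsilon> DIM('p) (domain_manifold D) (induced_metric (Q \<epsilon>) g) g k \<xi> I \<alpha>"
    unfolding construction_data_def
    using smooth_manifold_domain[OF D(1)] isometric_immersion_g orthonormal_parallel_normal_fieldsI[OF \<xi>] I adm
    by (simp add: domain_manifold_simps)
  \<comment> \<open>The data are now known to be admissible, so \<open>c.F_eq\<close> is available
    and presents the constructed map as a pair of horizontal part and height.\<close>
  interpret c: construction \<epsilon> "DIM('p)" "domain_manifold D" "induced_metric (Q \<epsilon>) g" g k \<xi> I \<alpha>
    by unfold_locales (rule eps data)+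
  show ?thesis
  proof (rule that[OF data])
    fix z assume "z \<in> D \<times> I"
    then obtain y s where z: "z = (y, s)" and y: "y \<in> D" and s: "s \<in> I" by blast
    have "c.a 0 s = \<beta> s" unfolding c.a_def \<alpha>_def \<beta>_def by simp
    moreover have "(\<Sum>i=1..k. c.a i s *\<^sub>R c.X i y) = (\<Sum>i=1..k. \<alpha> i s *\<^sub>R \<xi> i y)"
      by (intro sum.cong refl) (auto simp: c.a_def c.X_def)
    ultimately have "(\<Sum>i=0..k. c.a i s *\<^sub>R c.X i y) = \<phi> (y, s)"
      unfolding \<phi>_eq[OF y s] by (simp add: sum.atLeast_Suc_atMost c.X_def)
    moreover have "\<alpha> (k + 1) s = snd (F z)" using snd_F[of z] y s by (simp add: z \<alpha>_def)
    ultimately show "F z = constructed_map \<epsilon> g k \<xi> \<alpha> z"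
      unfolding z c.F_eq by (simp add: \<phi>_def prod_eq_iff z)
  qed
qed

section \<open>The converse\<close>

lemma class_A_coords_chart:
  fixes M :: "('b, 'm::euclidean_space) manifold" and f :: "'b \<Rightarrow> (real \<times> (real^'n)) \<times> real"
  assumes e: "\<epsilon> \<in> {-1, 0, 1}" and M: "smooth_manifold m M" "c \<in> atlas M"
    and A: "class_A_on \<epsilon> M (topspace (points M)) G f"
  shows "class_A_coords \<epsilon> (snd c ` fst c) (in_coords c f) (\<lambda>q. T_field \<epsilon> c f (inv_into (fst c) (snd c) q))"
proof -
  interpret QxR: ambient_space "QxR \<epsilon> :: ((real \<times> (real^'n)) \<times> real) ambient" by (rule ambient_space_QxR[OF e])
  note cc = smooth_manifold_chart[OF M]
  let ?\<Omega> = "snd c ` fst c" and ?T = "\<lambda>q. T_field \<epsilon> c f (inv_into (fst c) (snd c) q)"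
  have imm: "isometric_immersion_on M (topspace (points M)) G (QxR \<epsilon>) f"
    and eig: "\<And>p \<zeta>. p \<in> fst c \<Longrightarrow> \<zeta> \<in> normal_space (QxR \<epsilon>) c f p \<Longrightarrow>
      eigenvector (shape_operator (QxR \<epsilon>) G c f p \<zeta>) (T_field \<epsilon> c f p)"
    using A M(2) cc(5) unfolding class_A_on_def by blast+
  have f: "smooth_map_on M (topspace (points M)) f" and l: "f ` topspace (points M) \<subseteq> locus (QxR \<epsilon>)"
    using imm unfolding isometric_immersion_on_def by blast+
  have inj: "inj (differential c f p)"
    and G: "G c p v w = form (QxR \<epsilon>) (differential c f p v) (differential c f p w)" if "p \<in> fst c" for p v w
    using imm M(2) that cc(5) unfolding isometric_immersion_on_def by fastforce+
  have sf: "smooth_on ?\<Omega> (in_coords c f)"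
    using smooth_map_on_in_coords[OF f M(2)] cc(5) by (simp add: Int_absorb2)
  have tan: "range (differential c f p) \<subseteq> tangent (QxR \<epsilon>) (f p)" if "p \<in> fst c" for p
    by (rule tangent_QxR_differential[OF e M _ f l]) (use that cc(5) in auto)
  have lin: "linear (differential c f p)" if "p \<in> fst c" for p
    using smooth_map_on_linear_differential[OF f M(2) that] that cc(5) by blast
  have fp: "f p \<in> locus (QxR \<epsilon>)" if "p \<in> fst c" for p using that l cc(5) by blast
  have P: "\<exists>p. p \<in> fst c \<and> snd c p = q \<and> inv_into (fst c) (snd c) q = p \<and> in_coords c f q = f p \<and>
      fD (in_coords c f) q = differential c f p" if "q \<in> ?\<Omega>" for q
    using that cc(4) by (auto simp: in_coords_apply[OF cc(4)] differential_def[abs_def])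
  show ?thesis
  proof
    show "\<epsilon> \<in> {-1, 0, 1}" "open ?\<Omega>" "smooth_on ?\<Omega> (in_coords c f)" by (rule e cc(2) sf)+
    fix q assume q: "q \<in> ?\<Omega>"
    obtain p where p: "p \<in> fst c" "snd c p = q" "inv_into (fst c) (snd c) q = p" "in_coords c f q = f p"
      "fD (in_coords c f) q = differential c f p" using P[OF q] by blast
    show "in_coords c f q \<in> locus (QxR \<epsilon>)" using fp[OF p(1)] p(4) by simp
    show "inj (fD (in_coords c f) q)" using inj[OF p(1)] p(5) by simp
    have T: "form (QxR \<epsilon>) (differential c f p v) (differential c f p (T_field \<epsilon> c f p)) = snd (differential c f p v)" for v
      by (rule T_field[OF e fp[OF p(1)] lin[OF p(1)] inj[OF p(1)] tan[OF p(1)]])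
    show "form (QxR \<epsilon>) (fD (in_coords c f) q v) (fD (in_coords c f) q (?T q)) = snd (fD (in_coords c f) q v)" for v
      using T by (simp add: p)
    \<comment> \<open>The zero vector is normal, and being an eigenvector of its shape operator
      includes being nonzero.\<close>
    have "0 \<in> normal_space (QxR \<epsilon>) c f p"
      by (rule subspace_0[OF QxR.normal_space_subspace[of f p, OF fp[OF p(1)]]])
    from eig[OF p(1) this] show "?T q \<noteq> 0" by (simp add: p eigenvector_def)
    fix w \<zeta> assume w: "snd (fD (in_coords c f) q w) = 0" and "\<zeta> \<in> tangent (QxR \<epsilon>) (in_coords c f q)"
      "\<And>v. form (QxR \<epsilon>) (fD (in_coords c f) q v) \<zeta> = 0"
    then have \<zeta>: "\<zeta> \<in> normal_space (QxR \<epsilon>) c f p" by (simp add: p normal_space_def)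
    obtain \<mu> where \<mu>: "shape_operator (QxR \<epsilon>) G c f p \<zeta> (T_field \<epsilon> c f p) = \<mu> *\<^sub>R T_field \<epsilon> c f p"
      using eig[OF p(1) \<zeta>] by (auto simp: eigenvector_def)
    have lin2: "linear (second_differential c f p u)" for u
      using linear_fD_fD[OF cc(2) sf q, of u] by (simp add: second_differential_def[abs_def] p(2))
    \<comment> \<open>The product of A T = \<mu> T with \<open>w\<close> is computed twice: through
      the shape operator it is the pairing of the second derivative with \<open>\<zeta>\<close>,
      through the eigenvalue it is \<mu> dh(w) = 0.\<close>
    have "G c p (shape_operator (QxR \<epsilon>) G c f p \<zeta> (T_field \<epsilon> c f p)) w
        = form (QxR \<epsilon>) (second_differential c f p (T_field \<epsilon> c f p) w) \<zeta>"
      by (rule QxR.shape_operator[of f p c G, OF fp[OF p(1)] lin[OF p(1)] inj[OF p(1)] tan[OF p(1)] G[OF p(1)] \<zeta> lin2])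
    moreover have "G c p (\<mu> *\<^sub>R T_field \<epsilon> c f p) w = 0"
      using T[of w] w QxR.sym[of "differential c f p w"]
      by (simp add: G[OF p(1)] linear_scale[OF lin[OF p(1)]] QxR.scaleR_left p(5))
    ultimately show "form (QxR \<epsilon>) (fD (\<lambda>x. fD (in_coords c f) x w) q (?T q)) \<zeta> = 0"
      by (simp add: \<mu> second_differential_def p)
  qed
qed

text \<open>In the Euclidean inner product of the model space, ker dh at \<open>y0\<close> is the
  hyperplane orthogonal to \<open>n\<close>, and \<open>n\<close> is nonzero because dh(T) > 0. The
  hyperplane has the dimension of \<open>'p\<close>.\<close>

lemma (in class_A_coords) frame_exists:
  assumes y0: "y0 \<in> \<Omega>" and dim: "DIM('m) = DIM('p::euclidean_space) + 1"
  obtains J :: "'p::euclidean_space \<Rightarrow> 'm" where "class_A_frame \<epsilon> \<Omega> f T y0 J"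
proof -
  define n where "n = (\<Sum>i\<in>Basis. dh y0 i *\<^sub>R i)"
  have l: "linear (\<lambda>u. dh y0 u)"
    by (rule linearI) (simp_all add: Df_simps[OF y0])
  have dh: "dh y0 u = n \<bullet> u" for u
    using linear_basis_expansion[OF l, of u] by (simp add: n_def inner_sum_left inner_commute[of u] mult.commute)
  have "n \<noteq> 0" using dh_T_pos[OF y0] dh by auto
  then have "dim (UNIV :: 'p set) = dim {u. n \<bullet> u = 0}" using dim by (simp add: dim_hyperplane)
  then obtain J :: "'p \<Rightarrow> 'm" and K where J: "linear J" "range J = {u. n \<bullet> u = 0}" "\<And>x. K (J x) = x"
    using isometries_subspaces[OF subspace_UNIV subspace_hyperplane] by (metis UNIV_I)
  have "class_A_frame \<epsilon> \<Omega> f T y0 J"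
  proof (intro class_A_frame.intro class_A_frame_axioms.intro)
    show "class_A_coords \<epsilon> \<Omega> f T" by unfold_locales
    show "inj J" using J(3) by (metis injI)
  qed (use y0 J dh in auto)
  then show ?thesis by (rule that)
qed

lemma smooth_manifold_dim:
  assumes "smooth_manifold m (M :: ('b, 'm::euclidean_space) manifold)"
  shows "DIM('m) = m"
proof -
  obtain B :: "'m set" where "independent B" "span B = UNIV" "card B = m"
    using assms unfolding smooth_manifold_def by blast
  then show ?thesis using dim_span_eq_card_independent[of B] by simp
qed

lemma atlas_product_domain:
  "atlas (product_interval (domain_manifold D) I) = {(D \<times> I, id)}"
  "points (product_interval (domain_manifold D) I) = top_of_set (D \<times> I)"
proof -
  have "map_prod id id = (id :: 'a \<times> real \<Rightarrow> _)" by (simp add: fun_eq_iff)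
  then show "atlas (product_interval (domain_manifold D) I) = {(D \<times> I, id)}"
    by (simp add: product_interval_def domain_manifold_simps)
  show "points (product_interval (domain_manifold D) I) = top_of_set (D \<times> I)"
    using subtopology_Times[of euclidean euclidean D I]
    by (simp add: product_interval_def domain_manifold_simps)
qed

text \<open>The map \<open>\<Phi>\<close> is the inverse of the chart after \<open>\<Theta>\<close>,
  so f \<circ> \<Phi> is the map \<open>F\<close> that the reconstruction identifies with the
  constructed map. Its inverse is \<open>Xi\<close> after the chart.\<close>

lemma locally_constructed_in_chart:
  fixes M :: "('b, 'm::euclidean_space) manifold" and f :: "'b \<Rightarrow> (real \<times> (real^'n)) \<times> real"
    and J :: "'p::euclidean_space \<Rightarrow> 'm"
  assumes e: "\<epsilon> \<in> {-1, 0, 1}" and M: "smooth_manifold m M" "c \<in> atlas M"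
    and imm: "isometric_immersion_on M (topspace (points M)) G (QxR \<epsilon>) f"
    and prod: "class_A_product \<epsilon> (snd c ` fst c) (in_coords c f) T y0 J U D I \<Theta>"
    and cD: "convex D" "D \<noteq> {}"
  shows "\<exists>(N :: ('p, 'p) manifold) H g k \<xi> \<alpha> \<Phi>. construction_data \<epsilon> DIM('p) N H g k \<xi> I \<alpha> \<and>
    isometry_onto_open (product_interval N I) (induced_metric (QxR \<epsilon>) (constructed_map \<epsilon> g k \<xi> \<alpha>))
      M G {p \<in> fst c. snd c p \<in> U} \<Phi> \<and>
    (\<forall>z\<in>topspace (points (product_interval N I)). f (\<Phi> z) = constructed_map \<epsilon> g k \<xi> \<alpha> z)"
proof -
  interpret class_A_product \<epsilon> "snd c ` fst c" "in_coords c f" T y0 J U D I \<Theta> by (rule prod)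
  note cc = smooth_manifold_chart[OF M]
  obtain H g k \<xi> \<alpha> where data: "construction_data \<epsilon> DIM('p) (domain_manifold D) H g k \<xi> I \<alpha>"
    and F_eq: "\<And>z. z \<in> D \<times> I \<Longrightarrow> F z = constructed_map \<epsilon> g k \<xi> \<alpha> z"
    using construction_exists[OF cD] by blast
  let ?C = "constructed_map \<epsilon> g k \<xi> \<alpha>"
  define \<Phi> where "\<Phi> z = inv_into (fst c) (snd c) (\<Theta> z)" for z
  define U' where "U' = {p \<in> fst c. snd c p \<in> U}"
  have \<Phi>: "\<Phi> z \<in> fst c" "snd c (\<Phi> z) = \<Theta> z" "\<Phi> z \<in> U'" if "z \<in> D \<times> I" for z
  proof -
    have z: "\<Theta> z \<in> snd c ` fst c" by (rule \<Theta>_\<Omega>(2)[OF that])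
    show "\<Phi> z \<in> fst c" "snd c (\<Phi> z) = \<Theta> z"
      unfolding \<Phi>_def using z by (rule inv_into_into, rule f_inv_into_f)
    then show "\<Phi> z \<in> U'" using \<Theta>(1)[OF that] by (simp add: U'_def)
  qed
  have \<Xi>: "Xi (snd c p) \<in> D \<times> I" "\<Phi> (Xi (snd c p)) = p" if "p \<in> U'" for p
  proof -
    have "snd c p \<in> U" "p \<in> fst c" using that by (auto simp: U'_def)
    then show "Xi (snd c p) \<in> D \<times> I" "\<Phi> (Xi (snd c p)) = p"
      using Xi_image \<Theta>_Xi[of "snd c p"] cc(4) by (auto simp: \<Phi>_def)
  qed
  have f\<Phi>: "f (\<Phi> z) = ?C z" if "z \<in> D \<times> I" for z
  proof -
    have "F z = f (\<Phi> z)" unfolding F_def \<Phi>(2)[OF that, symmetric] by (rule in_coords_apply[OF cc(4) \<Phi>(1)[OF that]])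
    then show ?thesis using F_eq[OF that] by simp
  qed
  have openU': "openin (points M) U'" unfolding U'_def by (rule smooth_manifold_open_preimage[OF M U(1)])
  have topU': "topspace (points M) \<inter> U' = U'" using openin_subset[OF openU'] by blast
  have inv_\<Phi>: "inv_into (D \<times> I) \<Phi> (\<Phi> z) = z" if "z \<in> D \<times> I" for z
  proof (rule inv_into_f_f[OF _ that])
    show "inj_on \<Phi> (D \<times> I)" by (rule inj_on_inverseI[of _ "\<lambda>p. Xi (snd c p)"]) (simp add: \<Phi>(2) \<Theta>(2))
  qed
  have inv_\<Phi>': "inv_into (D \<times> I) \<Phi> p = Xi (snd c p)" if "p \<in> U'" for p
    using inv_\<Phi>[OF \<Xi>(1)[OF that]] \<Xi>(2)[OF that] by simp
  have "homeomorphic_maps (top_of_set (D \<times> I)) (subtopology (points M) U') \<Phi> (\<lambda>p. Xi (snd c p))"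
    unfolding homeomorphic_maps_def
  proof (intro conjI ballI)
    obtain \<phi>' where \<phi>': "homeomorphic_maps (subtopology (points M) (fst c)) (top_of_set (snd c ` fst c)) (snd c) \<phi>'"
      using cc(3) homeomorphic_map_maps by blast
    have \<phi>'_eq: "\<phi>' (snd c p) = p" if "p \<in> fst c" for p
      using \<phi>' that cc(5) unfolding homeomorphic_maps_def by auto
    have "continuous_map (top_of_set (D \<times> I)) (top_of_set (snd c ` fst c)) \<Theta>"
      using smooth_on_continuous[OF smooth_\<Theta>] \<Theta>_\<Omega>(2) by auto
    moreover have "continuous_map (top_of_set (snd c ` fst c)) (subtopology (points M) (fst c)) \<phi>'"
      using \<phi>' unfolding homeomorphic_maps_def by blast
    ultimately have "continuous_map (top_of_set (D \<times> I)) (subtopology (points M) (fst c)) (\<phi>' \<circ> \<Theta>)"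
      by (rule continuous_map_compose)
    then have "continuous_map (top_of_set (D \<times> I)) (points M) (\<phi>' \<circ> \<Theta>)"
      by (rule continuous_map_into_fulltopology)
    then have "continuous_map (top_of_set (D \<times> I)) (points M) \<Phi>"
      by (rule continuous_map_eq) (metis \<Phi>(1,2) \<phi>'_eq comp_apply topspace_euclidean_subtopology)
    then show "continuous_map (top_of_set (D \<times> I)) (subtopology (points M) U') \<Phi>"
      using \<Phi>(3) by (auto simp: continuous_map_in_subtopology)
    have "continuous_map (subtopology (points M) (fst c)) (top_of_set (snd c ` fst c)) (snd c)"
      by (rule homeomorphic_imp_continuous_map[OF cc(3)])
    then have "continuous_map (subtopology (points M) U') (top_of_set (snd c ` fst c)) (snd c)"
      by (rule continuous_map_from_subtopology_mono) (auto simp: U'_def)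
    then have "continuous_map (subtopology (points M) U') (top_of_set U) (snd c)"
      by (auto simp: continuous_map_in_subtopology U'_def)
    moreover have "continuous_map (top_of_set U) (top_of_set (D \<times> I)) Xi"
      using continuous_on_subset[OF smooth_on_continuous[OF smooth_Xi] U(2)] Xi_image by auto
    ultimately have "continuous_map (subtopology (points M) U') (top_of_set (D \<times> I)) (Xi \<circ> snd c)"
      by (rule continuous_map_compose)
    then show "continuous_map (subtopology (points M) U') (top_of_set (D \<times> I)) (\<lambda>p. Xi (snd c p))"
      by (simp add: o_def)
    show "Xi (snd c (\<Phi> z)) = z" if "z \<in> topspace (top_of_set (D \<times> I))" for z
      using that \<Phi>(2) \<Theta>(2) by simp
    show "\<Phi> (Xi (snd c p)) = p" if "p \<in> topspace (subtopology (points M) U')" for p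
      using that \<Xi>(2) by simp
  qed
  then have homeo: "homeomorphic_map (top_of_set (D \<times> I)) (subtopology (points M) U') \<Phi>"
    using homeomorphic_map_maps by blast
  have "isometry_onto_open (product_interval (domain_manifold D) I) (induced_metric (QxR \<epsilon>) ?C) M G U' \<Phi>"
    unfolding isometry_onto_open_def atlas_product_domain
  proof (intro conjI openU' homeo ballI)
    fix C d assume "C \<in> {(D \<times> I, id :: 'p \<times> real \<Rightarrow> _)}" and d: "d \<in> atlas M"
    then have C: "C = (D \<times> I, id)" by simp
    note dd = smooth_manifold_chart[OF M(1) d]
    note t = smooth_manifold_transition[OF M d] and t' = smooth_manifold_transition[OF M(1) d M(2)]
    define W where "W = {z \<in> D \<times> I. \<Phi> z \<in> fst d}"
    \<comment> \<open>The domain of the coordinate expression is the preimage of a chart overlap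
      under the continuous map \<open>\<Theta>\<close>, hence open.\<close>
    have W_eq: "W = (D \<times> I) \<inter> \<Theta> -` (snd c ` (fst c \<inter> fst d))"
    proof (intro equalityI subsetI)
      fix z assume "z \<in> W"
      then show "z \<in> (D \<times> I) \<inter> \<Theta> -` (snd c ` (fst c \<inter> fst d))"
        using \<Phi>(1,2)[of z] by (auto simp: W_def intro!: image_eqI[of _ _ "\<Phi> z"])
    next
      fix z assume z: "z \<in> (D \<times> I) \<inter> \<Theta> -` (snd c ` (fst c \<inter> fst d))"
      then obtain p where "p \<in> fst c" "p \<in> fst d" "\<Theta> z = snd c p" by blast
      then have "\<Phi> z = p" unfolding \<Phi>_def using cc(4) by simp
      then show "z \<in> W" using z \<open>p \<in> fst d\<close> by (simp add: W_def)
    qed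
    have oW: "open W" unfolding W_eq
      by (rule continuous_open_preimage[OF smooth_on_continuous[OF smooth_\<Theta>] open_DI t(2)])
    have W: "z \<in> D \<times> I" "\<Phi> z \<in> fst d" if "z \<in> W" for z using that by (auto simp: W_def)
    have W_id: "snd C ` W = W" "{z \<in> fst C. \<Phi> z \<in> fst d} = W" by (simp_all add: C W_def)
    have eq1: "in_coords c (snd d) (\<Theta> z) = in_coords C (snd d \<circ> \<Phi>) z" if "z \<in> W" for z
      using in_coords_apply[OF cc(4) \<Phi>(1)[OF W(1)[OF that]], of "snd d"] \<Phi>(2)[OF W(1)[OF that]]
        in_coords_domain[of z "D \<times> I" "snd d \<circ> \<Phi>"] W(1)[OF that] by (simp add: C)
    have "smooth_on W (\<lambda>z. in_coords c (snd d) (\<Theta> z))"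
      by (rule smooth_on_compose[OF oW t(2) smooth_on_subset[OF smooth_\<Theta>] _ t(1)]) (auto simp: W_eq)
    then have s1: "smooth_on W (in_coords C (snd d \<circ> \<Phi>))"
      by (rule smooth_on_cong[OF oW, rotated]) (rule eq1)
    have \<Phi>W: "\<Phi> ` W = fst d \<inter> U'"
    proof (intro equalityI subsetI)
      fix p assume p: "p \<in> fst d \<inter> U'"
      then show "p \<in> \<Phi> ` W"
        using \<Xi>[of p] by (auto simp: W_def intro!: image_eqI[of _ _ "Xi (snd c p)"])
    qed (use \<Phi>(3) in \<open>auto simp: W_def\<close>)
    have oV: "open (snd d ` \<Phi> ` W)" unfolding \<Phi>W by (rule smooth_manifold_open_image[OF M(1) d openU'])
    have V: "\<exists>p. p \<in> fst d \<and> p \<in> U' \<and> y = snd d p" if "y \<in> snd d ` \<Phi> ` W" for y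
      using that unfolding \<Phi>W by blast
    have "smooth_on (snd d ` \<Phi> ` W) (\<lambda>y. Xi (in_coords d (snd c) y))"
    proof (rule smooth_on_compose[OF oV \<Omega>1(1) smooth_on_subset[OF t'(1)] _ smooth_Xi])
      show "snd d ` \<Phi> ` W \<subseteq> snd d ` (fst d \<inter> fst c)" unfolding \<Phi>W by (auto simp: U'_def)
      show "in_coords d (snd c) ` snd d ` \<Phi> ` W \<subseteq> \<Omega>1"
        unfolding \<Phi>W using U(2) by (auto simp: in_coords_apply[OF dd(4)] U'_def)
    qed
    then have s2: "smooth_on (snd d ` \<Phi> ` W) (in_coords d (snd C \<circ> inv_into (D \<times> I) \<Phi>))"
    proof (rule smooth_on_cong[OF oV, rotated])
      fix y assume "y \<in> snd d ` \<Phi> ` W"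
      then obtain p where p: "p \<in> fst d" "p \<in> U'" "y = snd d p" using V by blast
      show "Xi (in_coords d (snd c) y) = in_coords d (snd C \<circ> inv_into (D \<times> I) \<Phi>) y"
        using p by (simp add: in_coords_apply[OF dd(4)] C inv_\<Phi>')
    qed
    \<comment> \<open>Since \<open>G\<close> is induced by f and f \<circ> \<Phi> is the constructed
      map, this is the chain rule in the chart \<open>d\<close>.\<close>
    have metric: "induced_metric (QxR \<epsilon>) ?C C z v w =
        G d (\<Phi> z) (differential C (snd d \<circ> \<Phi>) z v) (differential C (snd d \<circ> \<Phi>) z w)" if z: "z \<in> W" for z v w
    proof -
      have top: "\<Phi> z \<in> topspace (points M)" using W(2)[OF z] dd(5) by blast
      have sm: "smooth_map_on M (topspace (points M)) f" using imm unfolding isometric_immersion_on_def by blast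
      have G: "G d (\<Phi> z) v w = form (QxR \<epsilon>) (differential d f (\<Phi> z) v) (differential d f (\<Phi> z) w)" for v w
        using imm d W(2)[OF z] top unfolding isometric_immersion_on_def by simp
      have val: "in_coords C (snd d \<circ> \<Phi>) z = snd d (\<Phi> z)" if "z \<in> W" for z
        using in_coords_domain[of z "D \<times> I" "snd d \<circ> \<Phi>"] W(1)[OF that] by (simp add: C)
      have 1: "(in_coords C (snd d \<circ> \<Phi>) has_derivative differential C (snd d \<circ> \<Phi>) z) (at z)"
        using smooth_on_has_derivative[OF s1 z] unfolding differential_def[abs_def] C by simp
      have 2: "(in_coords d f has_derivative differential d f (\<Phi> z)) (at (in_coords C (snd d \<circ> \<Phi>) z))"
        unfolding val[OF z] by (rule smooth_map_on_has_derivative[OF sm d W(2)[OF z] top])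
      have "(in_coords C ?C has_derivative (\<lambda>v. differential d f (\<Phi> z) (differential C (snd d \<circ> \<Phi>) z v))) (at z)"
      proof (rule has_derivative_transform_within_open[OF has_derivative_compose[OF 1 2] oW z])
        fix y assume y: "y \<in> W"
        show "in_coords d f (in_coords C (snd d \<circ> \<Phi>) y) = in_coords C ?C y"
          unfolding val[OF y] in_coords_apply[OF dd(4) W(2)[OF y]]
          using f\<Phi>[OF W(1)[OF y]] in_coords_domain[OF W(1)[OF y], of ?C] by (simp add: C)
      qed
      from fD_eqI[OF this]
      have "differential C ?C z v = differential d f (\<Phi> z) (differential C (snd d \<circ> \<Phi>) z v)" for v
        unfolding differential_def[of C ?C] by (simp add: C)
      then show ?thesis by (simp add: induced_metric_def G)
    qed
    show "let W = {z \<in> fst C. \<Phi> z \<in> fst d} in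
        smooth_on (snd C ` W) (in_coords C (snd d \<circ> \<Phi>)) \<and>
        smooth_on (snd d ` \<Phi> ` W) (in_coords d (snd C \<circ> inv_into (topspace (top_of_set (D \<times> I))) \<Phi>)) \<and>
        (\<forall>z\<in>W. \<forall>v w. induced_metric (QxR \<epsilon>) ?C C z v w =
           G d (\<Phi> z) (differential C (snd d \<circ> \<Phi>) z v) (differential C (snd d \<circ> \<Phi>) z w))"
      unfolding Let_def W_id topspace_euclidean_subtopology using s1 s2 metric by blast
  qed
  then show ?thesis
    unfolding U'_def using data f\<Phi>
    by (intro exI[of _ "domain_manifold D"] exI[of _ H] exI[of _ g] exI[of _ k] exI[of _ \<xi>] exI[of _ \<alpha>] exI[of _ \<Phi>])
      (simp add: atlas_product_domain)
qed

theorem theorem2: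
  fixes \<epsilon> :: real and m :: nat
    and N :: "('a, 'd::real_normed_vector) manifold" and H :: "('a, 'd) metric"
    and g :: "'a \<Rightarrow> real \<times> (real^'n)" and \<xi> :: "nat \<Rightarrow> 'a \<Rightarrow> real \<times> (real^'n)"
    and k :: nat and I :: "real set" and \<alpha> :: "nat \<Rightarrow> real \<Rightarrow> real"
    and M :: "('b, 'm::euclidean_space) manifold" and G :: "('b, 'm) metric"
    and f :: "'b \<Rightarrow> (real \<times> (real^'n)) \<times> real"
  assumes "\<epsilon> \<in> {-1, 0, 1}"
  shows "(m \<ge> 1 \<and> construction_data \<epsilon> (m - 1) N H g k \<xi> I \<alpha> \<longrightarrow>
        (let P = product_interval N I; F = constructed_map \<epsilon> g k \<xi> \<alpha>
         in smooth_manifold m P \<and>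
            class_A_on \<epsilon> P (regular_points P F) (induced_metric (QxR \<epsilon>) F) F)) \<and>
    (m \<ge> 2 \<and> smooth_manifold m M \<and> class_A_on \<epsilon> M (topspace (points M)) G f \<and>
        DIM('p::euclidean_space) = m - 1 \<longrightarrow>
      locally_constructed TYPE('p) \<epsilon> (m - 1) M G f)"
proof (intro conjI impI)
  assume m: "m \<ge> 1 \<and> construction_data \<epsilon> (m - 1) N H g k \<xi> I \<alpha>"
  then interpret construction \<epsilon> "m - 1" N H g k \<xi> I \<alpha> using assms by unfold_locales auto
  show "let P = product_interval N I; F = constructed_map \<epsilon> g k \<xi> \<alpha>
         in smooth_manifold m P \<and> class_A_on \<epsilon> P (regular_points P F) (induced_metric (QxR \<epsilon>) F) F"
    unfolding Let_def using product_manifold class_A m by simp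
next
  assume A: "m \<ge> 2 \<and> smooth_manifold m M \<and> class_A_on \<epsilon> M (topspace (points M)) G f \<and> DIM('p::euclidean_space) = m - 1"
  then have M: "smooth_manifold m M" and f: "class_A_on \<epsilon> M (topspace (points M)) G f" by auto
  have dim: "DIM('m) = DIM('p) + 1" using A smooth_manifold_dim[OF M] by simp
  show "locally_constructed TYPE('p) \<epsilon> (m - 1) M G f"
    unfolding locally_constructed_def
  proof
    fix p assume "p \<in> topspace (points M)"
    then obtain c where c: "c \<in> atlas M" "p \<in> fst c" using M unfolding smooth_manifold_def by blast
    interpret class_A_coords \<epsilon> "snd c ` fst c" "in_coords c f" "\<lambda>q. T_field \<epsilon> c f (inv_into (fst c) (snd c) q)"
      by (rule class_A_coords_chart[OF assms M c(1) f])
    have y0: "snd c p \<in> snd c ` fst c" using c(2) by blast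
    obtain J :: "'p \<Rightarrow> 'm" where J: "class_A_frame \<epsilon> (snd c ` fst c) (in_coords c f)
        (\<lambda>q. T_field \<epsilon> c f (inv_into (fst c) (snd c) q)) (snd c p) J"
      by (rule frame_exists[OF y0 dim])
    interpret class_A_frame \<epsilon> "snd c ` fst c" "in_coords c f" "\<lambda>q. T_field \<epsilon> c f (inv_into (fst c) (snd c) q)" "snd c p" J
      by (rule J)
    obtain U D I \<Theta> where U: "open U" "snd c p \<in> U" "U \<subseteq> \<Omega>1" and D: "open D" "convex D" "D \<noteq> {}"
      and I: "open_interval I" and Xi: "Xi ` U = D \<times> I" "\<And>q. q \<in> U \<Longrightarrow> \<Theta> (Xi q) = q"
      and \<Theta>: "\<And>z. z \<in> D \<times> I \<Longrightarrow> \<Theta> z \<in> U \<and> Xi (\<Theta> z) = z" "smooth_on (D \<times> I) \<Theta>"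
      by (rule local_coordinates[OF dim]) blast
    have prod: "class_A_product \<epsilon> (snd c ` fst c) (in_coords c f) (\<lambda>q. T_field \<epsilon> c f (inv_into (fst c) (snd c) q)) (snd c p) J U D I \<Theta>"
      by (intro class_A_product.intro J class_A_product_axioms.intro) (use U D I Xi \<Theta> in auto)
    have "isometric_immersion_on M (topspace (points M)) G (QxR \<epsilon>) f"
      using f unfolding class_A_on_def by blast
    from locally_constructed_in_chart[OF assms M c(1) this prod D(2,3)]
    obtain N :: "('p, 'p) manifold" and H g k \<xi> \<alpha> \<Phi> where
      C: "construction_data \<epsilon> DIM('p) N H g k \<xi> I \<alpha>"
        "isometry_onto_open (product_interval N I) (induced_metric (QxR \<epsilon>) (constructed_map \<epsilon> g k \<xi> \<alpha>))
          M G {p \<in> fst c. snd c p \<in> U} \<Phi>"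
        "\<forall>z\<in>topspace (points (product_interval N I)). f (\<Phi> z) = constructed_map \<epsilon> g k \<xi> \<alpha> z"
      by blast
    have m: "DIM('p) = m - 1" using A by simp
    show "\<exists>U. p \<in> U \<and> (\<exists>(N :: ('p, 'p) manifold) H g k \<xi> I \<alpha> \<Phi> t\<^sub>0.
          construction_data \<epsilon> (m - 1) N H g k \<xi> I \<alpha> \<and>
          isometry_onto_open (product_interval N I)
            (induced_metric (QxR \<epsilon>) (constructed_map \<epsilon> g k \<xi> \<alpha>)) M G U \<Phi> \<and>
          (\<forall>z\<in>topspace (points (product_interval N I)).
             f (\<Phi> z) = constructed_map \<epsilon> g k \<xi> \<alpha> z + t\<^sub>0 *\<^sub>R ddt))"
      \<comment> \<open>The translation is 0, because the interval coordinate is the height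
        itself.\<close>
      using C c(2) U(2) unfolding m
      by (intro exI[of _ "{p \<in> fst c. snd c p \<in> U}"] conjI exI[of _ N] exI[of _ H] exI[of _ g] exI[of _ k]
          exI[of _ \<xi>] exI[of _ I] exI[of _ \<alpha>] exI[of _ \<Phi>] exI[of _ 0]) auto
  qed
qed

end
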